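(* Let $\mathcal{C}$ be a stably $2$-Calabi--Yau Frobenius extriangulated category with subcategory $\mathcal{P}$ of projective-injective objects, and let $\mathcal{X}\subseteq\mathcal{C}$ be a rigid functorially finite subcategory. Then $\mathcal{X}^{\perp_1}$ is also a stably $2$-Calabi--Yau Frobenius extriangulated category, functorially finite in $\mathcal{C}$, with projective-injectives $\mathrm{add}(\mathcal{X},\mathcal{P})$. If $\mathcal{C}$ is weakly idempotent complete, so is $\mathcal{X}^{\perp_1}$. The cluster-tilting subcategories of $\mathcal{X}^{\perp_1}$ are precisely those cluster-tilting subcategories $\mathcal{T}\subseteq\mathcal{C}$ such that $\mathcal{X}\subseteq\mathcal{T}$.
   Context: Let $\mathbb{K}$ be a field. An extriangulated category (Nakaoka--Palu) $(\mathcal{C},\mathbb{E}_{\mathcal{C}},\mathfrak{s})$ consists of a $\mathbb{K}$-linear additive category, a $\mathbb{K}$-bilinear bifunctor $\mathbb{E}_{\mathcal{C}}\colon\mathcal{C}^{\mathrm{op}}\times\mathcal{C}\to\{\mathbb{K}\text{-modules}\}$, and an additive realisation $\mathfrak{s}$ sending $\delta\in\mathbb{E}_{\mathcal{C}}(C,A)$ to an equivalence class of sequences $A\to B\to C$ (conflations; first maps are inflations, second maps deflations), satisfying (ET3), (ET3)$^{\mathrm{op}}$, (ET4), (ET4)$^{\mathrm{op}}$. Extension-closed full subcategories inherit an extriangulated structure by restriction of $\mathbb{E}_{\mathcal C}$ and $\mathfrak{s}$. $\mathcal{C}$ is Frobenius if it has enough projectives (objects with the lifting property for deflations) and enough injectives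 (extension property for inflations) and the two classes coincide. The stable category $\underline{\mathcal{C}}$, the quotient by morphisms factoring through projective-injectives, is triangulated, with $\mathbb{E}_{\mathcal{C}}(X,Y)=\mathrm{Hom}_{\underline{\mathcal{C}}}(X,\Sigma Y)$. $\mathcal{C}$ is stably $2$-Calabi--Yau if $\underline{\mathcal{C}}$ is Hom-finite with a functorial isomorphism $\mathrm{Ext}^1_{\underline{\mathcal{C}}}(X,Y)\cong\mathrm{Hom}_{\mathbb{K}}(\mathrm{Ext}^1_{\underline{\mathcal{C}}}(Y,X),\mathbb{K})$. Subcategories are full. $\mathcal{X}^{\perp_1}=\{Y:\mathbb{E}_{\mathcal{C}}(X,Y)=0\ \forall X\in\mathcal{X}\}$, ${}^{\perp_1}\mathcal{X}=\{Y:\mathbb{E}_{\mathcal{C}}(Y,X)=0\ \forall X\in\mathcal{X}\}$; both are extension-closed. $\mathcal{X}$ is rigid if $\mathcal{X}\subseteq\mathcal{X}^{\perp_1}$, and functorially finite if every object of the ambient category has a left and a right $\mathcal{X}$-approximation. $\mathrm{add}(\mathcal{X},\mathcal{P})$ is the smallest full subcategory containing $\mathcal{X}$ and $\mathcal{P}$ and closed under finite direct sums and direct summands. $\mathcal{T}$ is cluster-tilting if it is functorially finite and ${}^{\perp_1}\mathcal{T}=\mathcal{T}=\mathcal{T}^{\perp_1}$ (all taken in the ambient category under consideration). An additive category is weakly idempotent complete if every retraction has a kernel. *)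

theory Defs
  imports "HOL-Algebra.AbelCoset" "Jordan_Normal_Form.Missing_VectorSpace"
begin

section \<open>Additive categories over a field\<close>

text \<open>Hom-spaces are HOL-Algebra vector spaces over \<open>K\<close> and, as usual, pairwise disjoint. A full
  subcategory is represented by its set of objects; it need not be closed under isomorphisms or
  direct sums.\<close>

record ('k, 'o, 'm) linear_cat =
  Obj :: "'o set"
  Hom :: "'o \<Rightarrow> 'o \<Rightarrow> ('k, 'm) module"
  Comp :: "'m \<Rightarrow> 'm \<Rightarrow> 'm" (infixl "\<cdot>\<index>" 70)
  Id :: "'o \<Rightarrow> 'm"

abbreviation mor :: "('k, 'o, 'm, 'z) linear_cat_scheme \<Rightarrow> 'o \<Rightarrow> 'o \<Rightarrow> 'm set" where
  "mor \<C> A B \<equiv> carrier (Hom \<C> A B)"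

locale linear_category = field K
  for K :: "('k, 'r) ring_scheme" (structure) +
  fixes \<C> :: "('k, 'o, 'm, 'z) linear_cat_scheme"
  assumes hom_vectorspace:
      "\<lbrakk>A \<in> Obj \<C>; B \<in> Obj \<C>\<rbrakk> \<Longrightarrow> vectorspace K (Hom \<C> A B)"
    and hom_disjoint:
      "\<lbrakk>A \<in> Obj \<C>; B \<in> Obj \<C>; A' \<in> Obj \<C>; B' \<in> Obj \<C>; f \<in> mor \<C> A B; f \<in> mor \<C> A' B'\<rbrakk>
       \<Longrightarrow> A = A' \<and> B = B'"
    and id_mor: "A \<in> Obj \<C> \<Longrightarrow> Id \<C> A \<in> mor \<C> A A"
    and comp_linear_right:
      "\<lbrakk>A \<in> Obj \<C>; B \<in> Obj \<C>; C \<in> Obj \<C>; g \<in> mor \<C> B C\<rbrakk>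
       \<Longrightarrow> (\<lambda>f. g \<cdot>\<^bsub>\<C>\<^esub> f) \<in> module_hom K (Hom \<C> A B) (Hom \<C> A C)"
    and comp_linear_left:
      "\<lbrakk>A \<in> Obj \<C>; B \<in> Obj \<C>; C \<in> Obj \<C>; f \<in> mor \<C> A B\<rbrakk>
       \<Longrightarrow> (\<lambda>g. g \<cdot>\<^bsub>\<C>\<^esub> f) \<in> module_hom K (Hom \<C> B C) (Hom \<C> A C)"
    and comp_assoc:
      "\<lbrakk>A \<in> Obj \<C>; B \<in> Obj \<C>; C \<in> Obj \<C>; D \<in> Obj \<C>;
        f \<in> mor \<C> A B; g \<in> mor \<C> B C; h \<in> mor \<C> C D\<rbrakk>
       \<Longrightarrow> (h \<cdot>\<^bsub>\<C>\<^esub> g) \<cdot>\<^bsub>\<C>\<^esub> f = h \<cdot>\<^bsub>\<C>\<^esub> (g \<cdot>\<^bsub>\<C>\<^esub> f)"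
    and id_comp:
      "\<lbrakk>A \<in> Obj \<C>; B \<in> Obj \<C>; f \<in> mor \<C> A B\<rbrakk> \<Longrightarrow> Id \<C> B \<cdot>\<^bsub>\<C>\<^esub> f = f"
    and comp_id:
      "\<lbrakk>A \<in> Obj \<C>; B \<in> Obj \<C>; f \<in> mor \<C> A B\<rbrakk> \<Longrightarrow> f \<cdot>\<^bsub>\<C>\<^esub> Id \<C> A = f"

definition is_iso :: "('k, 'o, 'm, 'z) linear_cat_scheme \<Rightarrow> 'o \<Rightarrow> 'o \<Rightarrow> 'm \<Rightarrow> bool" where
  "is_iso \<C> A B f \<longleftrightarrow> f \<in> mor \<C> A B \<and>
     (\<exists>g \<in> mor \<C> B A. g \<cdot>\<^bsub>\<C>\<^esub> f = Id \<C> A \<and> f \<cdot>\<^bsub>\<C>\<^esub> g = Id \<C> B)"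

definition is_zero_object :: "('k, 'o, 'm, 'z) linear_cat_scheme \<Rightarrow> 'o \<Rightarrow> bool" where
  "is_zero_object \<C> Z \<longleftrightarrow> Z \<in> Obj \<C> \<and>
     (\<forall>A \<in> Obj \<C>. (\<exists>!f. f \<in> mor \<C> Z A) \<and> (\<exists>!f. f \<in> mor \<C> A Z))"

text \<open>\<open>S\<close> is the biproduct of \<open>A\<close> and \<open>B\<close> with inclusions \<open>i\<close>, \<open>j\<close> and projections \<open>p\<close>, \<open>q\<close>.\<close>

definition is_biproduct ::
  "('k, 'o, 'm, 'z) linear_cat_scheme \<Rightarrow> 'o \<Rightarrow> 'o \<Rightarrow> 'o \<Rightarrow> 'm \<Rightarrow> 'm \<Rightarrow> 'm \<Rightarrow> 'm \<Rightarrow> bool" where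
  "is_biproduct \<C> A B S i j p q \<longleftrightarrow>
     A \<in> Obj \<C> \<and> B \<in> Obj \<C> \<and> S \<in> Obj \<C> \<and>
     i \<in> mor \<C> A S \<and> j \<in> mor \<C> B S \<and> p \<in> mor \<C> S A \<and> q \<in> mor \<C> S B \<and>
     p \<cdot>\<^bsub>\<C>\<^esub> i = Id \<C> A \<and> q \<cdot>\<^bsub>\<C>\<^esub> j = Id \<C> B \<and>
     q \<cdot>\<^bsub>\<C>\<^esub> i = \<zero>\<^bsub>Hom \<C> A B\<^esub> \<and> p \<cdot>\<^bsub>\<C>\<^esub> j = \<zero>\<^bsub>Hom \<C> B A\<^esub> \<and>
     (i \<cdot>\<^bsub>\<C>\<^esub> p) \<oplus>\<^bsub>Hom \<C> S S\<^esub> (j \<cdot>\<^bsub>\<C>\<^esub> q) = Id \<C> S"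

locale additive_category = linear_category K \<C>
  for K :: "('k, 'r) ring_scheme" (structure) and \<C> :: "('k, 'o, 'm, 'z) linear_cat_scheme" +
  assumes zero_object_exists: "\<exists>Z. is_zero_object \<C> Z"
    and biproduct_exists:
      "\<lbrakk>A \<in> Obj \<C>; B \<in> Obj \<C>\<rbrakk> \<Longrightarrow> \<exists>S i j p q. is_biproduct \<C> A B S i j p q"

definition is_kernel ::
  "('k, 'o, 'm, 'z) linear_cat_scheme \<Rightarrow> 'o \<Rightarrow> 'o \<Rightarrow> 'm \<Rightarrow> 'o \<Rightarrow> 'm \<Rightarrow> bool" where
  "is_kernel \<C> A B r N k \<longleftrightarrow> N \<in> Obj \<C> \<and> k \<in> mor \<C> N A \<and> r \<cdot>\<^bsub>\<C>\<^esub> k = \<zero>\<^bsub>Hom \<C> N B\<^esub> \<and>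
     (\<forall>M \<in> Obj \<C>. \<forall>f \<in> mor \<C> M A. r \<cdot>\<^bsub>\<C>\<^esub> f = \<zero>\<^bsub>Hom \<C> M B\<^esub> \<longrightarrow>
        (\<exists>!g. g \<in> mor \<C> M N \<and> k \<cdot>\<^bsub>\<C>\<^esub> g = f))"

definition weakly_idempotent_complete :: "('k, 'o, 'm, 'z) linear_cat_scheme \<Rightarrow> bool" where
  "weakly_idempotent_complete \<C> \<longleftrightarrow>
     (\<forall>A \<in> Obj \<C>. \<forall>B \<in> Obj \<C>. \<forall>r \<in> mor \<C> A B.
        (\<exists>s \<in> mor \<C> B A. r \<cdot>\<^bsub>\<C>\<^esub> s = Id \<C> B) \<longrightarrow> (\<exists>N k. is_kernel \<C> A B r N k))"

text \<open>The object set of \<open>add(\<S>)\<close>; a zero object is the empty direct sum.\<close>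

inductive_set add_closure :: "('k, 'o, 'm, 'z) linear_cat_scheme \<Rightarrow> 'o set \<Rightarrow> 'o set"
  for \<C> :: "('k, 'o, 'm, 'z) linear_cat_scheme" and \<S> :: "'o set" where
  base: "A \<in> \<S> \<Longrightarrow> A \<in> add_closure \<C> \<S>"
| zero: "is_zero_object \<C> Z \<Longrightarrow> Z \<in> add_closure \<C> \<S>"
| sum: "\<lbrakk>A \<in> add_closure \<C> \<S>; B \<in> add_closure \<C> \<S>; is_biproduct \<C> A B S i j p q\<rbrakk>
        \<Longrightarrow> S \<in> add_closure \<C> \<S>"
| summand: "\<lbrakk>S \<in> add_closure \<C> \<S>; is_biproduct \<C> A B S i j p q\<rbrakk> \<Longrightarrow> A \<in> add_closure \<C> \<S>"

definition is_left_approx ::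
  "('k, 'o, 'm, 'z) linear_cat_scheme \<Rightarrow> 'o set \<Rightarrow> 'o \<Rightarrow> 'o \<Rightarrow> 'm \<Rightarrow> bool" where
  "is_left_approx \<C> \<X> A X f \<longleftrightarrow> X \<in> \<X> \<and> f \<in> mor \<C> A X \<and>
     (\<forall>X' \<in> \<X>. \<forall>g \<in> mor \<C> A X'. \<exists>h \<in> mor \<C> X X'. h \<cdot>\<^bsub>\<C>\<^esub> f = g)"

definition is_right_approx ::
  "('k, 'o, 'm, 'z) linear_cat_scheme \<Rightarrow> 'o set \<Rightarrow> 'o \<Rightarrow> 'o \<Rightarrow> 'm \<Rightarrow> bool" where
  "is_right_approx \<C> \<X> A X f \<longleftrightarrow> X \<in> \<X> \<and> f \<in> mor \<C> X A \<and>
     (\<forall>X' \<in> \<X>. \<forall>g \<in> mor \<C> X' A. \<exists>h \<in> mor \<C> X' X. f \<cdot>\<^bsub>\<C>\<^esub> h = g)"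

definition functorially_finite :: "('k, 'o, 'm, 'z) linear_cat_scheme \<Rightarrow> 'o set \<Rightarrow> bool" where
  "functorially_finite \<C> \<X> \<longleftrightarrow> \<X> \<subseteq> Obj \<C> \<and>
     (\<forall>A \<in> Obj \<C>. (\<exists>X f. is_left_approx \<C> \<X> A X f) \<and> (\<exists>X f. is_right_approx \<C> \<X> A X f))"


section \<open>Extriangulated categories\<close>

text \<open>\<open>Ext \<C> C A\<close> is the space of extensions of \<open>C\<close> by \<open>A\<close>, written E(C,A) in the literature, while
  \<open>push \<C> a\<close> and \<open>pull \<C> c\<close> are its covariant and contravariant actions. \<open>realise \<C> C A \<delta>\<close> is the
  realisation of \<open>\<delta>\<close>: a set of triples \<open>(x, B, y)\<close> standing for sequences
  \<open>A \<rightarrow> B \<rightarrow> C\<close> with first map \<open>x\<close> and second map \<open>y\<close>.\<close>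

record ('k, 'o, 'm, 'e) extri_cat = "('k, 'o, 'm) linear_cat" +
  Ext :: "'o \<Rightarrow> 'o \<Rightarrow> ('k, 'e) module"
  push :: "'m \<Rightarrow> 'e \<Rightarrow> 'e"
  pull :: "'m \<Rightarrow> 'e \<Rightarrow> 'e"
  realise :: "'o \<Rightarrow> 'o \<Rightarrow> 'e \<Rightarrow> ('m \<times> 'o \<times> 'm) set"

definition seq_class ::
  "('k, 'o, 'm, 'z) linear_cat_scheme \<Rightarrow> 'o \<Rightarrow> 'o \<Rightarrow> 'm \<times> 'o \<times> 'm \<Rightarrow> ('m \<times> 'o \<times> 'm) set" where
  "seq_class \<C> A C = (\<lambda>(x, B, y).
     {(x', B', y'). B' \<in> Obj \<C> \<and> x' \<in> mor \<C> A B' \<and> y' \<in> mor \<C> B' C \<and>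
        (\<exists>b. is_iso \<C> B B' b \<and> b \<cdot>\<^bsub>\<C>\<^esub> x = x' \<and> y' \<cdot>\<^bsub>\<C>\<^esub> b = y)})"

locale extriangulated = additive_category K \<C>
  for K :: "('k, 'r) ring_scheme" (structure) and \<C> :: "('k, 'o, 'm, 'e) extri_cat" +
  assumes ext_vectorspace:
      "\<lbrakk>A \<in> Obj \<C>; C \<in> Obj \<C>\<rbrakk> \<Longrightarrow> vectorspace K (Ext \<C> C A)"
    and push_linear:
      "\<lbrakk>A \<in> Obj \<C>; A' \<in> Obj \<C>; C \<in> Obj \<C>; a \<in> mor \<C> A A'\<rbrakk>
       \<Longrightarrow> push \<C> a \<in> module_hom K (Ext \<C> C A) (Ext \<C> C A')"
    and pull_linear:
      "\<lbrakk>A \<in> Obj \<C>; C \<in> Obj \<C>; C' \<in> Obj \<C>; c \<in> mor \<C> C' C\<rbrakk>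
       \<Longrightarrow> pull \<C> c \<in> module_hom K (Ext \<C> C A) (Ext \<C> C' A)"
    and push_linear_mor:
      "\<lbrakk>A \<in> Obj \<C>; A' \<in> Obj \<C>; C \<in> Obj \<C>; \<delta> \<in> carrier (Ext \<C> C A)\<rbrakk>
       \<Longrightarrow> (\<lambda>a. push \<C> a \<delta>) \<in> module_hom K (Hom \<C> A A') (Ext \<C> C A')"
    and pull_linear_mor:
      "\<lbrakk>A \<in> Obj \<C>; C \<in> Obj \<C>; C' \<in> Obj \<C>; \<delta> \<in> carrier (Ext \<C> C A)\<rbrakk>
       \<Longrightarrow> (\<lambda>c. pull \<C> c \<delta>) \<in> module_hom K (Hom \<C> C' C) (Ext \<C> C' A)"
    and push_id:
      "\<lbrakk>A \<in> Obj \<C>; C \<in> Obj \<C>; \<delta> \<in> carrier (Ext \<C> C A)\<rbrakk> \<Longrightarrow> push \<C> (Id \<C> A) \<delta> = \<delta>"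
    and pull_id:
      "\<lbrakk>A \<in> Obj \<C>; C \<in> Obj \<C>; \<delta> \<in> carrier (Ext \<C> C A)\<rbrakk> \<Longrightarrow> pull \<C> (Id \<C> C) \<delta> = \<delta>"
    and push_comp:
      "\<lbrakk>A \<in> Obj \<C>; A' \<in> Obj \<C>; A'' \<in> Obj \<C>; C \<in> Obj \<C>;
        a \<in> mor \<C> A A'; a' \<in> mor \<C> A' A''; \<delta> \<in> carrier (Ext \<C> C A)\<rbrakk>
       \<Longrightarrow> push \<C> (a' \<cdot>\<^bsub>\<C>\<^esub> a) \<delta> = push \<C> a' (push \<C> a \<delta>)"
    and pull_comp:
      "\<lbrakk>A \<in> Obj \<C>; C \<in> Obj \<C>; C' \<in> Obj \<C>; C'' \<in> Obj \<C>;
        c \<in> mor \<C> C' C; c' \<in> mor \<C> C'' C'; \<delta> \<in> carrier (Ext \<C> C A)\<rbrakk>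
       \<Longrightarrow> pull \<C> (c \<cdot>\<^bsub>\<C>\<^esub> c') \<delta> = pull \<C> c' (pull \<C> c \<delta>)"
    and push_pull:
      "\<lbrakk>A \<in> Obj \<C>; A' \<in> Obj \<C>; C \<in> Obj \<C>; C' \<in> Obj \<C>;
        a \<in> mor \<C> A A'; c \<in> mor \<C> C' C; \<delta> \<in> carrier (Ext \<C> C A)\<rbrakk>
       \<Longrightarrow> push \<C> a (pull \<C> c \<delta>) = pull \<C> c (push \<C> a \<delta>)"
  assumes real_class:
      "\<lbrakk>A \<in> Obj \<C>; C \<in> Obj \<C>; \<delta> \<in> carrier (Ext \<C> C A)\<rbrakk>
       \<Longrightarrow> \<exists>B \<in> Obj \<C>. \<exists>x \<in> mor \<C> A B. \<exists>y \<in> mor \<C> B C. realise \<C> C A \<delta> = seq_class \<C> A C (x, B, y)"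
    and real_lift:
      "\<lbrakk>A \<in> Obj \<C>; C \<in> Obj \<C>; A' \<in> Obj \<C>; C' \<in> Obj \<C>;
        \<delta> \<in> carrier (Ext \<C> C A); \<delta>' \<in> carrier (Ext \<C> C' A');
        (x, B, y) \<in> realise \<C> C A \<delta>; (x', B', y') \<in> realise \<C> C' A' \<delta>';
        a \<in> mor \<C> A A'; c \<in> mor \<C> C C'; push \<C> a \<delta> = pull \<C> c \<delta>'\<rbrakk>
       \<Longrightarrow> \<exists>b \<in> mor \<C> B B'. b \<cdot>\<^bsub>\<C>\<^esub> x = x' \<cdot>\<^bsub>\<C>\<^esub> a \<and> y' \<cdot>\<^bsub>\<C>\<^esub> b = c \<cdot>\<^bsub>\<C>\<^esub> y"
  \<comment> \<open>in \<open>real_sum\<close>, the four equations say that \<open>\<epsilon>\<close> is \<open>\<delta> \<oplus> \<delta>'\<close>\<close>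
    and real_split:
      "is_biproduct \<C> A C S i j p q \<Longrightarrow> (i, S, q) \<in> realise \<C> C A \<zero>\<^bsub>Ext \<C> C A\<^esub>"
    and real_sum:
      "\<lbrakk>\<delta> \<in> carrier (Ext \<C> C A); \<delta>' \<in> carrier (Ext \<C> C' A');
        (x, B, y) \<in> realise \<C> C A \<delta>; (x', B', y') \<in> realise \<C> C' A' \<delta>';
        is_biproduct \<C> A A' SA iA jA pA qA;
        is_biproduct \<C> B B' SB iB jB pB qB;
        is_biproduct \<C> C C' SC iC jC pC qC;
        \<epsilon> \<in> carrier (Ext \<C> SC SA);
        push \<C> pA (pull \<C> iC \<epsilon>) = \<delta>; push \<C> pA (pull \<C> jC \<epsilon>) = \<zero>\<^bsub>Ext \<C> C' A\<^esub>;
        push \<C> qA (pull \<C> iC \<epsilon>) = \<zero>\<^bsub>Ext \<C> C A'\<^esub>; push \<C> qA (pull \<C> jC \<epsilon>) = \<delta>'\<rbrakk>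
       \<Longrightarrow> ((iB \<cdot>\<^bsub>\<C>\<^esub> x \<cdot>\<^bsub>\<C>\<^esub> pA) \<oplus>\<^bsub>Hom \<C> SA SB\<^esub> (jB \<cdot>\<^bsub>\<C>\<^esub> x' \<cdot>\<^bsub>\<C>\<^esub> qA), SB,
            (iC \<cdot>\<^bsub>\<C>\<^esub> y \<cdot>\<^bsub>\<C>\<^esub> pB) \<oplus>\<^bsub>Hom \<C> SB SC\<^esub> (jC \<cdot>\<^bsub>\<C>\<^esub> y' \<cdot>\<^bsub>\<C>\<^esub> qB)) \<in> realise \<C> SC SA \<epsilon>"
  assumes ET3:
      "\<lbrakk>A \<in> Obj \<C>; C \<in> Obj \<C>; A' \<in> Obj \<C>; C' \<in> Obj \<C>;
        \<delta> \<in> carrier (Ext \<C> C A); \<delta>' \<in> carrier (Ext \<C> C' A');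
        (x, B, y) \<in> realise \<C> C A \<delta>; (x', B', y') \<in> realise \<C> C' A' \<delta>';
        a \<in> mor \<C> A A'; b \<in> mor \<C> B B'; b \<cdot>\<^bsub>\<C>\<^esub> x = x' \<cdot>\<^bsub>\<C>\<^esub> a\<rbrakk>
       \<Longrightarrow> \<exists>c \<in> mor \<C> C C'. y' \<cdot>\<^bsub>\<C>\<^esub> b = c \<cdot>\<^bsub>\<C>\<^esub> y \<and> push \<C> a \<delta> = pull \<C> c \<delta>'"
    and ET3_op:
      "\<lbrakk>A \<in> Obj \<C>; C \<in> Obj \<C>; A' \<in> Obj \<C>; C' \<in> Obj \<C>;
        \<delta> \<in> carrier (Ext \<C> C A); \<delta>' \<in> carrier (Ext \<C> C' A');
        (x, B, y) \<in> realise \<C> C A \<delta>; (x', B', y') \<in> realise \<C> C' A' \<delta>';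
        b \<in> mor \<C> B B'; c \<in> mor \<C> C C'; y' \<cdot>\<^bsub>\<C>\<^esub> b = c \<cdot>\<^bsub>\<C>\<^esub> y\<rbrakk>
       \<Longrightarrow> \<exists>a \<in> mor \<C> A A'. b \<cdot>\<^bsub>\<C>\<^esub> x = x' \<cdot>\<^bsub>\<C>\<^esub> a \<and> push \<C> a \<delta> = pull \<C> c \<delta>'"
    and ET4:
      "\<lbrakk>A \<in> Obj \<C>; B \<in> Obj \<C>; C \<in> Obj \<C>; D \<in> Obj \<C>; F \<in> Obj \<C>;
        \<delta> \<in> carrier (Ext \<C> D A); \<delta>' \<in> carrier (Ext \<C> F B);
        (f, B, f') \<in> realise \<C> D A \<delta>; (g, C, g') \<in> realise \<C> F B \<delta>'\<rbrakk>
       \<Longrightarrow> \<exists>E \<in> Obj \<C>. \<exists>d \<in> mor \<C> D E. \<exists>e \<in> mor \<C> E F. \<exists>h' \<in> mor \<C> C E.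
            \<exists>\<delta>'' \<in> carrier (Ext \<C> E A).
              (g \<cdot>\<^bsub>\<C>\<^esub> f, C, h') \<in> realise \<C> E A \<delta>'' \<and>
              h' \<cdot>\<^bsub>\<C>\<^esub> g = d \<cdot>\<^bsub>\<C>\<^esub> f' \<and> e \<cdot>\<^bsub>\<C>\<^esub> h' = g' \<and>
              (d, E, e) \<in> realise \<C> F D (push \<C> f' \<delta>') \<and>
              pull \<C> d \<delta>'' = \<delta> \<and> push \<C> f \<delta>'' = pull \<C> e \<delta>'"
    and ET4_op:
      "\<lbrakk>A \<in> Obj \<C>; B \<in> Obj \<C>; C \<in> Obj \<C>; D \<in> Obj \<C>; F \<in> Obj \<C>;
        \<delta> \<in> carrier (Ext \<C> B D); \<delta>' \<in> carrier (Ext \<C> C F);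
        (f', A, f) \<in> realise \<C> B D \<delta>; (g', B, g) \<in> realise \<C> C F \<delta>'\<rbrakk>
       \<Longrightarrow> \<exists>E \<in> Obj \<C>. \<exists>d \<in> mor \<C> D E. \<exists>e \<in> mor \<C> E F. \<exists>h' \<in> mor \<C> E A.
            \<exists>\<delta>'' \<in> carrier (Ext \<C> C E).
              (h', A, g \<cdot>\<^bsub>\<C>\<^esub> f) \<in> realise \<C> C E \<delta>'' \<and>
              h' \<cdot>\<^bsub>\<C>\<^esub> d = f' \<and> f \<cdot>\<^bsub>\<C>\<^esub> h' = g' \<cdot>\<^bsub>\<C>\<^esub> e \<and>
              (d, E, e) \<in> realise \<C> F D (pull \<C> g' \<delta>) \<and>
              push \<C> e \<delta>'' = \<delta>' \<and> push \<C> d \<delta> = pull \<C> g \<delta>''"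

definition is_inflation :: "('k, 'o, 'm, 'e) extri_cat \<Rightarrow> 'o \<Rightarrow> 'o \<Rightarrow> 'm \<Rightarrow> bool" where
  "is_inflation \<C> A B x \<longleftrightarrow> A \<in> Obj \<C> \<and>
     (\<exists>C \<in> Obj \<C>. \<exists>\<delta> \<in> carrier (Ext \<C> C A). \<exists>y. (x, B, y) \<in> realise \<C> C A \<delta>)"

definition is_deflation :: "('k, 'o, 'm, 'e) extri_cat \<Rightarrow> 'o \<Rightarrow> 'o \<Rightarrow> 'm \<Rightarrow> bool" where
  "is_deflation \<C> B C y \<longleftrightarrow> C \<in> Obj \<C> \<and>
     (\<exists>A \<in> Obj \<C>. \<exists>\<delta> \<in> carrier (Ext \<C> C A). \<exists>x. (x, B, y) \<in> realise \<C> C A \<delta>)"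

text \<open>The structure inherited by an (extension-closed) full subcategory: realisations keep only
  sequences inside the subcategory.\<close>

definition full_sub :: "('k, 'o, 'm, 'e) extri_cat \<Rightarrow> 'o set \<Rightarrow> ('k, 'o, 'm, 'e) extri_cat" where
  "full_sub \<C> \<D> = \<C>\<lparr>Obj := \<D>,
     realise := (\<lambda>C A \<delta>. {(x, B, y). (x, B, y) \<in> realise \<C> C A \<delta> \<and> B \<in> \<D>})\<rparr>"

definition right_perp :: "('k, 'o, 'm, 'e) extri_cat \<Rightarrow> 'o set \<Rightarrow> 'o set" where
  "right_perp \<C> \<X> = {Y \<in> Obj \<C>. \<forall>X \<in> \<X>. carrier (Ext \<C> X Y) = {\<zero>\<^bsub>Ext \<C> X Y\<^esub>}}"

definition left_perp :: "('k, 'o, 'm, 'e) extri_cat \<Rightarrow> 'o set \<Rightarrow> 'o set" where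
  "left_perp \<C> \<X> = {Y \<in> Obj \<C>. \<forall>X \<in> \<X>. carrier (Ext \<C> Y X) = {\<zero>\<^bsub>Ext \<C> Y X\<^esub>}}"

definition rigid :: "('k, 'o, 'm, 'e) extri_cat \<Rightarrow> 'o set \<Rightarrow> bool" where
  "rigid \<C> \<X> \<longleftrightarrow> \<X> \<subseteq> right_perp \<C> \<X>"

definition cluster_tilting :: "('k, 'o, 'm, 'e) extri_cat \<Rightarrow> 'o set \<Rightarrow> bool" where
  "cluster_tilting \<C> \<T> \<longleftrightarrow>
     functorially_finite \<C> \<T> \<and> left_perp \<C> \<T> = \<T> \<and> right_perp \<C> \<T> = \<T>"


section \<open>Frobenius extriangulated categories and their stable categories\<close>

definition projectives :: "('k, 'o, 'm, 'e) extri_cat \<Rightarrow> 'o set" where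
  "projectives \<C> = {P \<in> Obj \<C>. \<forall>B \<in> Obj \<C>. \<forall>C \<in> Obj \<C>. \<forall>y c.
     is_deflation \<C> B C y \<and> c \<in> mor \<C> P C \<longrightarrow> (\<exists>b \<in> mor \<C> P B. y \<cdot>\<^bsub>\<C>\<^esub> b = c)}"

definition injectives :: "('k, 'o, 'm, 'e) extri_cat \<Rightarrow> 'o set" where
  "injectives \<C> = {I \<in> Obj \<C>. \<forall>A \<in> Obj \<C>. \<forall>B \<in> Obj \<C>. \<forall>x a.
     is_inflation \<C> A B x \<and> a \<in> mor \<C> A I \<longrightarrow> (\<exists>b \<in> mor \<C> B I. b \<cdot>\<^bsub>\<C>\<^esub> x = a)}"

definition proj_inj :: "('k, 'o, 'm, 'e) extri_cat \<Rightarrow> 'o set" where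
  "proj_inj \<C> = projectives \<C> \<inter> injectives \<C>"

definition frobenius :: "('k, 'o, 'm, 'e) extri_cat \<Rightarrow> bool" where
  "frobenius \<C> \<longleftrightarrow>
     (\<forall>C \<in> Obj \<C>. \<exists>P \<in> projectives \<C>. \<exists>y. is_deflation \<C> P C y) \<and>
     (\<forall>A \<in> Obj \<C>. \<exists>I \<in> injectives \<C>. \<exists>x. is_inflation \<C> A I x) \<and>
     projectives \<C> = injectives \<C>"

definition proj_inj_ideal :: "('k, 'o, 'm, 'e) extri_cat \<Rightarrow> 'o \<Rightarrow> 'o \<Rightarrow> 'm set" where
  "proj_inj_ideal \<C> A B =
     {h \<cdot>\<^bsub>\<C>\<^esub> g | P g h. P \<in> proj_inj \<C> \<and> g \<in> mor \<C> A P \<and> h \<in> mor \<C> P B}"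

definition stable_class :: "('k, 'o, 'm, 'e) extri_cat \<Rightarrow> 'o \<Rightarrow> 'o \<Rightarrow> 'm \<Rightarrow> 'm set" where
  "stable_class \<C> A B f = proj_inj_ideal \<C> A B +>\<^bsub>Hom \<C> A B\<^esub> f"

text \<open>The multiplicative fields of a \<open>module\<close> record carry no meaning for a vector space.\<close>

definition stable_hom :: "('k, 'o, 'm, 'e) extri_cat \<Rightarrow> 'o \<Rightarrow> 'o \<Rightarrow> ('k, 'm set) module" where
  "stable_hom \<C> A B = \<lparr>
     carrier = stable_class \<C> A B ` mor \<C> A B,
     mult = undefined, one = undefined,
     zero = proj_inj_ideal \<C> A B,
     add = (\<lambda>F G. F <+>\<^bsub>Hom \<C> A B\<^esub> G),
     smult = (\<lambda>k F. \<Union>f \<in> F. stable_class \<C> A B (k \<odot>\<^bsub>Hom \<C> A B\<^esub> f))\<rparr>"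

definition stable_category :: "('k, 'o, 'm, 'e) extri_cat \<Rightarrow> ('k, 'o, 'm set) linear_cat" where
  "stable_category \<C> = \<lparr>
     Obj = Obj \<C>,
     Hom = stable_hom \<C>,
     Comp = (\<lambda>G F. \<Union>{stable_class \<C> A C (g \<cdot>\<^bsub>\<C>\<^esub> f) | A B C f g.
        A \<in> Obj \<C> \<and> B \<in> Obj \<C> \<and> C \<in> Obj \<C> \<and>
        f \<in> F \<inter> mor \<C> A B \<and> g \<in> G \<inter> mor \<C> B C}),
     Id = (\<lambda>A. stable_class \<C> A A (Id \<C> A))\<rparr>"

text \<open>A choice of suspension on the stable category: conflations \<open>A \<rightarrow> I \<rightarrow> \<Sigma> A\<close> with
  \<open>I\<close> projective-injective, realising \<open>\<epsilon> A\<close>. On a stable morphism \<open>F\<close>, the suspension is the class of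
  those \<open>c\<close> such that \<open>(f, c)\<close> is a morphism of extensions \<open>\<epsilon> A \<rightarrow> \<epsilon> B\<close> for some \<open>f\<close>
  representing \<open>F\<close>.\<close>

definition is_suspension :: "('k, 'o, 'm, 'e) extri_cat \<Rightarrow> ('o \<Rightarrow> 'o) \<Rightarrow> ('o \<Rightarrow> 'e) \<Rightarrow> bool" where
  "is_suspension \<C> \<Sigma> \<epsilon> \<longleftrightarrow> (\<forall>A \<in> Obj \<C>. \<Sigma> A \<in> Obj \<C> \<and> \<epsilon> A \<in> carrier (Ext \<C> (\<Sigma> A) A) \<and>
     (\<exists>x I y. I \<in> proj_inj \<C> \<and> (x, I, y) \<in> realise \<C> (\<Sigma> A) A (\<epsilon> A)))"

definition susp_map ::
  "('k, 'o, 'm, 'e) extri_cat \<Rightarrow> ('o \<Rightarrow> 'o) \<Rightarrow> ('o \<Rightarrow> 'e) \<Rightarrow> 'o \<Rightarrow> 'o \<Rightarrow> 'm set \<Rightarrow> 'm set" where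
  "susp_map \<C> \<Sigma> \<epsilon> A B F =
     {c \<in> mor \<C> (\<Sigma> A) (\<Sigma> B). \<exists>f \<in> F. push \<C> f (\<epsilon> A) = pull \<C> c (\<epsilon> B)}"

definition self_module :: "('k, 'r) ring_scheme \<Rightarrow> ('k, 'k) module" where
  "self_module K = \<lparr>carrier = carrier K, mult = mult K, one = one K, zero = zero K, add = add K,
     smult = mult K\<rparr>"

definition dual_space ::
  "('k, 'r) ring_scheme \<Rightarrow> ('k, 'v) module \<Rightarrow> ('k, 'v \<Rightarrow> 'k) module" where
  "dual_space K V = \<lparr>
     carrier = module_hom K V (self_module K) \<inter> extensional (carrier V),
     mult = undefined, one = undefined,
     zero = (\<lambda>v \<in> carrier V. \<zero>\<^bsub>K\<^esub>),
     add = (\<lambda>\<phi> \<psi>. \<lambda>v \<in> carrier V. \<phi> v \<oplus>\<^bsub>K\<^esub> \<psi> v),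
     smult = (\<lambda>k \<phi>. \<lambda>v \<in> carrier V. k \<otimes>\<^bsub>K\<^esub> \<phi> v)\<rparr>"

text \<open>Here \<open>Ext\<^sup>1(X, Y)\<close> of the stable category is its space of morphisms \<open>X \<rightarrow> \<Sigma> Y\<close>. The
  isomorphisms \<open>\<Phi> X Y\<close> from \<open>Ext\<^sup>1(X, Y)\<close> to the dual of \<open>Ext\<^sup>1(Y, X)\<close> are natural in
  both variables, with respect to stable morphisms \<open>U : X' \<rightarrow> X\<close> and \<open>V : Y \<rightarrow> Y'\<close>.\<close>

definition stably_2_calabi_yau ::
  "('k, 'r) ring_scheme \<Rightarrow> ('k, 'o, 'm, 'e) extri_cat \<Rightarrow> bool" where
  "stably_2_calabi_yau K \<C> \<longleftrightarrow> (let \<S> = stable_category \<C> in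
     (\<forall>X \<in> Obj \<S>. \<forall>Y \<in> Obj \<S>. vectorspace.fin_dim K (Hom \<S> X Y)) \<and>
     (\<exists>\<Sigma> \<epsilon> \<Phi>. is_suspension \<C> \<Sigma> \<epsilon> \<and>
        (\<forall>X \<in> Obj \<S>. \<forall>Y \<in> Obj \<S>.
           \<Phi> X Y \<in> module_hom K (Hom \<S> X (\<Sigma> Y)) (dual_space K (Hom \<S> Y (\<Sigma> X))) \<and>
           bij_betw (\<Phi> X Y) (mor \<S> X (\<Sigma> Y)) (carrier (dual_space K (Hom \<S> Y (\<Sigma> X))))) \<and>
        (\<forall>X \<in> Obj \<S>. \<forall>X' \<in> Obj \<S>. \<forall>Y \<in> Obj \<S>. \<forall>Y' \<in> Obj \<S>.
           \<forall>U \<in> mor \<S> X' X. \<forall>V \<in> mor \<S> Y Y'. \<forall>F \<in> mor \<S> X (\<Sigma> Y). \<forall>G \<in> mor \<S> Y' (\<Sigma> X').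
             \<Phi> X' Y' (susp_map \<C> \<Sigma> \<epsilon> Y Y' V \<cdot>\<^bsub>\<S>\<^esub> F \<cdot>\<^bsub>\<S>\<^esub> U) G =
             \<Phi> X Y F (susp_map \<C> \<Sigma> \<epsilon> X' X U \<cdot>\<^bsub>\<S>\<^esub> G \<cdot>\<^bsub>\<S>\<^esub> V))))"

definition stably_2_calabi_yau_frobenius ::
  "('k, 'r) ring_scheme \<Rightarrow> ('k, 'o, 'm, 'e) extri_cat \<Rightarrow> bool" where
  "stably_2_calabi_yau_frobenius K \<C> \<longleftrightarrow>
     extriangulated K \<C> \<and> frobenius \<C> \<and> stably_2_calabi_yau K \<C>"

end

theory Submission
  imports Defs
begin

text \<open>
  Write \<open>\<D>\<close> for the right perpendicular category of \<open>\<X>\<close>. A conflation \<open>Y \<rightarrow> I \<rightarrow> \<Sigma> Y\<close> with projective-injective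
  \<open>I\<close> identifies the stable morphisms \<open>X \<rightarrow> \<Sigma> Y\<close> with \<open>Ext X Y\<close>, so being stably 2-Calabi-Yau amounts to
  finite-dimensional extension spaces together with a natural duality between \<open>Ext X Y\<close> and
  \<open>Ext Y X\<close>. In this form the property restricts to every Frobenius extension-closed subcategory,
  and it makes vanishing of extensions symmetric, so that \<open>\<D>\<close> is also the left perpendicular category.

  For \<open>Y\<close> in \<open>\<D>\<close>, combining a right \<open>\<X>\<close>-approximation \<open>X \<rightarrow> Y\<close> with a projective deflation
  \<open>P \<rightarrow> Y\<close> yields a deflation \<open>X \<oplus> P \<rightarrow> Y\<close> whose kernel is again in \<open>\<D>\<close>; with its dual this gives
  the Frobenius property and the projective-injectives \<open>add(\<X>, \<P>)\<close>. Approximations by \<open>\<D>\<close>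
  are universal extensions, and they compose with approximations inside \<open>\<D>\<close>, which yields the
  statement on cluster-tilting subcategories.
\<close>

text \<open>The obstacle is that \<D> has more projective-injectives than the ambient category. Its
  suspension and its stable morphisms are therefore not restrictions of the ambient ones, and the
  given stable pairing cannot simply be restricted. Its extension spaces, with push and pull, are
  literally those of the ambient category. The Calabi-Yau condition is thus first freed of every
  suspension (\<open>ext_duality\<close>), then restricted, and finally rebuilt over a suspension
  chosen anew in \<D>.

  Projectives and injectives are described by vanishing extensions, so the structure of \<D> is read
  off from a few exact sequences. The kernel of a deflation within \<D> stays in \<D> as soon as all
  maps from \<X> lift along it; this is what the approximations are for.

  Cancelling \<open>j\<close> from \<open>[f, y] j = y\<close> to see that \<open>[f, y]\<close> is
  a deflation would be a form of weak idempotent completeness, which is assumed only for one clause.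
  The map \<open>[f, y]\<close> is therefore factored by explicit matrices.

  The axioms and hypotheses are self-dual, so one half of each dual pair is proved and the other
  half is its instance in \<open>op_cat\<close>.\<close>

definition arr :: "('k, 'o, 'm, 'z) linear_cat_scheme \<Rightarrow> 'o \<Rightarrow> 'o \<Rightarrow> 'm set" where
  "arr \<C> A B = {f. A \<in> Obj \<C> \<and> B \<in> Obj \<C> \<and> f \<in> mor \<C> A B}"

lemma arrI: "\<lbrakk>A \<in> Obj \<C>; B \<in> Obj \<C>; f \<in> mor \<C> A B\<rbrakk> \<Longrightarrow> f \<in> arr \<C> A B"
  by (simp add: arr_def)

lemma arrD:
  assumes "f \<in> arr \<C> A B"
  shows "A \<in> Obj \<C>" "B \<in> Obj \<C>" "f \<in> mor \<C> A B"
  using assms by (simp_all add: arr_def)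

text \<open>As in \<open>arr\<close>, membership carries the objecthood of both ends, since nothing
  is assumed about morphisms or extensions at non-objects. One such fact discharges several typing
  premises of an axiom.\<close>

definition exts :: "('k, 'o, 'm, 'e) extri_cat \<Rightarrow> 'o \<Rightarrow> 'o \<Rightarrow> 'e set" where
  "exts \<C> C A = {\<delta>. C \<in> Obj \<C> \<and> A \<in> Obj \<C> \<and> \<delta> \<in> carrier (Ext \<C> C A)}"

lemma extsI: "\<lbrakk>C \<in> Obj \<C>; A \<in> Obj \<C>; \<delta> \<in> carrier (Ext \<C> C A)\<rbrakk> \<Longrightarrow> \<delta> \<in> exts \<C> C A"
  by (simp add: exts_def)

lemma extsD:
  assumes "\<delta> \<in> exts \<C> C A"
  shows "C \<in> Obj \<C>" "A \<in> Obj \<C>" "\<delta> \<in> carrier (Ext \<C> C A)"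
  using assms by (simp_all add: exts_def)

text \<open>The class \<delta> stays an argument because it provides, by push and pull, the
  connecting maps of the exact sequences below.\<close>

definition conflation ::
  "('k, 'o, 'm, 'e) extri_cat \<Rightarrow> 'o \<Rightarrow> 'm \<Rightarrow> 'o \<Rightarrow> 'm \<Rightarrow> 'o \<Rightarrow> 'e \<Rightarrow> bool" where
  "conflation \<C> A x B y C \<delta> \<longleftrightarrow> \<delta> \<in> exts \<C> C A \<and> (x, B, y) \<in> realise \<C> C A \<delta>"

lemma is_inflation_iff: "is_inflation \<C> A B x \<longleftrightarrow> (\<exists>y C \<delta>. conflation \<C> A x B y C \<delta>)"
  by (auto simp: is_inflation_def conflation_def exts_def)

lemma is_deflation_iff: "is_deflation \<C> B C y \<longleftrightarrow> (\<exists>A x \<delta>. conflation \<C> A x B y C \<delta>)"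
  by (auto simp: is_deflation_def conflation_def exts_def)

section \<open>Linear maps and differences in abelian groups\<close>

lemma module_hom_zero:
  assumes "module R V" "module R W" "\<kappa> \<in> module_hom R V W"
  shows "\<kappa> \<zero>\<^bsub>V\<^esub> = \<zero>\<^bsub>W\<^esub>"
  using mod_hom.f0_is_0[of R V W \<kappa>] assms by (simp add: mod_hom_def mod_hom_axioms_def)

lemma module_hom_minus:
  assumes "module R V" "module R W" "\<kappa> \<in> module_hom R V W" "v \<in> carrier V" "w \<in> carrier V"
  shows "\<kappa> (v \<ominus>\<^bsub>V\<^esub> w) = \<kappa> v \<ominus>\<^bsub>W\<^esub> \<kappa> w"
  using mod_hom.f_minus[of R V W \<kappa>] assms by (simp add: mod_hom_def mod_hom_axioms_def)

lemma module_hom_carrier: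
  "\<lbrakk>\<kappa> \<in> module_hom R V W; v \<in> carrier V\<rbrakk> \<Longrightarrow> \<kappa> v \<in> carrier W"
  using module_hom_closed by blast

lemma (in abelian_group) minus_eq_zero_iff:
  "\<lbrakk>x \<in> carrier G; y \<in> carrier G\<rbrakk> \<Longrightarrow> x \<ominus> y = \<zero> \<longleftrightarrow> x = y"
  by (metis a_minus_def add.inv_equality add.inv_inv a_inv_closed r_neg)

lemma (in abelian_group) minus_add_cancel:
  "\<lbrakk>x \<in> carrier G; y \<in> carrier G\<rbrakk> \<Longrightarrow> (x \<ominus> y) \<oplus> y = x"
  by (simp add: a_minus_def a_assoc l_neg)

section \<open>Calculus of morphisms, zero objects and biproducts\<close>

context linear_category
begin

abbreviation comp_syn (infixl "\<bullet>" 70) where "g \<bullet> f \<equiv> g \<cdot>\<^bsub>\<C>\<^esub> f"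
abbreviation zm where "zm A B \<equiv> \<zero>\<^bsub>Hom \<C> A B\<^esub>"

lemma hom_module: "\<lbrakk>A \<in> Obj \<C>; B \<in> Obj \<C>\<rbrakk> \<Longrightarrow> module K (Hom \<C> A B)"
  using hom_vectorspace vectorspace_def by blast

lemma hom_group: "\<lbrakk>A \<in> Obj \<C>; B \<in> Obj \<C>\<rbrakk> \<Longrightarrow> abelian_group (Hom \<C> A B)"
  using hom_module module_def by blast

lemma arr_comp: "\<lbrakk>g \<in> arr \<C> B C; f \<in> arr \<C> A B\<rbrakk> \<Longrightarrow> g \<bullet> f \<in> arr \<C> A C"
  using comp_linear_right[of A B C g] module_hom_carrier by (fastforce simp: arr_def)

lemma arr_id: "A \<in> Obj \<C> \<Longrightarrow> Id \<C> A \<in> arr \<C> A A"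
  by (simp add: arr_def id_mor)

lemma arr_zero: "\<lbrakk>A \<in> Obj \<C>; B \<in> Obj \<C>\<rbrakk> \<Longrightarrow> zm A B \<in> arr \<C> A B"
  using abelian_group.axioms(1)[OF hom_group, of A B]
  by (simp add: arr_def abelian_monoid.zero_closed)

lemma arr_add: "\<lbrakk>f \<in> arr \<C> A B; g \<in> arr \<C> A B\<rbrakk> \<Longrightarrow> f \<oplus>\<^bsub>Hom \<C> A B\<^esub> g \<in> arr \<C> A B"
  using hom_group[of A B] by (simp add: arr_def abelian_groupE)

lemma arr_minus: "\<lbrakk>f \<in> arr \<C> A B; g \<in> arr \<C> A B\<rbrakk> \<Longrightarrow> f \<ominus>\<^bsub>Hom \<C> A B\<^esub> g \<in> arr \<C> A B"
  using hom_group[of A B] by (simp add: arr_def abelian_group.minus_closed)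

lemma assoc: "\<lbrakk>h \<in> arr \<C> C D; g \<in> arr \<C> B C; f \<in> arr \<C> A B\<rbrakk> \<Longrightarrow> h \<bullet> g \<bullet> f = h \<bullet> (g \<bullet> f)"
  using comp_assoc[of A B C D f g h] by (simp add: arr_def)

lemma id_left: "f \<in> arr \<C> A B \<Longrightarrow> Id \<C> B \<bullet> f = f"
  using id_comp[of A B f] by (simp add: arr_def)

lemma id_right: "f \<in> arr \<C> A B \<Longrightarrow> f \<bullet> Id \<C> A = f"
  using comp_id[of A B f] by (simp add: arr_def)

lemma zero_right: "\<lbrakk>g \<in> arr \<C> B C; A \<in> Obj \<C>\<rbrakk> \<Longrightarrow> g \<bullet> zm A B = zm A C"
  using module_hom_zero[OF hom_module hom_module comp_linear_right]
  by (simp add: arr_def)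

lemma zero_left: "\<lbrakk>f \<in> arr \<C> A B; C \<in> Obj \<C>\<rbrakk> \<Longrightarrow> zm B C \<bullet> f = zm A C"
  using module_hom_zero[OF hom_module hom_module comp_linear_left]
  by (simp add: arr_def)

lemma add_right:
  "\<lbrakk>g \<in> arr \<C> B C; f \<in> arr \<C> A B; f' \<in> arr \<C> A B\<rbrakk>
   \<Longrightarrow> g \<bullet> (f \<oplus>\<^bsub>Hom \<C> A B\<^esub> f') = g \<bullet> f \<oplus>\<^bsub>Hom \<C> A C\<^esub> g \<bullet> f'"
  using module_hom_add[OF comp_linear_right, of A B C g f f'] by (simp add: arr_def)

lemma add_left:
  "\<lbrakk>f \<in> arr \<C> A B; g \<in> arr \<C> B C; g' \<in> arr \<C> B C\<rbrakk>
   \<Longrightarrow> (g \<oplus>\<^bsub>Hom \<C> B C\<^esub> g') \<bullet> f = g \<bullet> f \<oplus>\<^bsub>Hom \<C> A C\<^esub> g' \<bullet> f"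
  using module_hom_add[OF comp_linear_left, of A B C f g g'] by (simp add: arr_def)

lemma minus_right:
  "\<lbrakk>g \<in> arr \<C> B C; f \<in> arr \<C> A B; f' \<in> arr \<C> A B\<rbrakk>
   \<Longrightarrow> g \<bullet> (f \<ominus>\<^bsub>Hom \<C> A B\<^esub> f') = g \<bullet> f \<ominus>\<^bsub>Hom \<C> A C\<^esub> g \<bullet> f'"
  using module_hom_minus[OF hom_module hom_module comp_linear_right]
  by (simp add: arr_def)

lemma minus_left:
  "\<lbrakk>f \<in> arr \<C> A B; g \<in> arr \<C> B C; g' \<in> arr \<C> B C\<rbrakk>
   \<Longrightarrow> (g \<ominus>\<^bsub>Hom \<C> B C\<^esub> g') \<bullet> f = g \<bullet> f \<ominus>\<^bsub>Hom \<C> A C\<^esub> g' \<bullet> f"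
  using module_hom_minus[OF hom_module hom_module comp_linear_left]
  by (simp add: arr_def)

lemma minus_zero_iff:
  "\<lbrakk>f \<in> arr \<C> A B; g \<in> arr \<C> A B\<rbrakk> \<Longrightarrow> f \<ominus>\<^bsub>Hom \<C> A B\<^esub> g = zm A B \<longleftrightarrow> f = g"
  using abelian_group.minus_eq_zero_iff[OF hom_group] by (simp add: arr_def)

lemma minus_add:
  "\<lbrakk>f \<in> arr \<C> A B; g \<in> arr \<C> A B\<rbrakk> \<Longrightarrow> (f \<ominus>\<^bsub>Hom \<C> A B\<^esub> g) \<oplus>\<^bsub>Hom \<C> A B\<^esub> g = f"
  using abelian_group.minus_add_cancel[OF hom_group] by (simp add: arr_def)

lemma arr_add_comm:
  "\<lbrakk>f \<in> arr \<C> A B; g \<in> arr \<C> A B\<rbrakk> \<Longrightarrow> f \<oplus>\<^bsub>Hom \<C> A B\<^esub> g = g \<oplus>\<^bsub>Hom \<C> A B\<^esub> f"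
  using abelian_groupE(4)[OF hom_group] by (simp add: arr_def)

lemma arr_add_assoc:
  "\<lbrakk>f \<in> arr \<C> A B; g \<in> arr \<C> A B; h \<in> arr \<C> A B\<rbrakk> \<Longrightarrow>
   f \<oplus>\<^bsub>Hom \<C> A B\<^esub> g \<oplus>\<^bsub>Hom \<C> A B\<^esub> h = f \<oplus>\<^bsub>Hom \<C> A B\<^esub> (g \<oplus>\<^bsub>Hom \<C> A B\<^esub> h)"
  using abelian_groupE(3)[OF hom_group] by (simp add: arr_def)

lemma zm_add: "f \<in> arr \<C> A B \<Longrightarrow> zm A B \<oplus>\<^bsub>Hom \<C> A B\<^esub> f = f"
  using abelian_groupE(5)[OF hom_group] by (simp add: arr_def)

lemma add_zm: "f \<in> arr \<C> A B \<Longrightarrow> f \<oplus>\<^bsub>Hom \<C> A B\<^esub> zm A B = f"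
  using zm_add[of f A B] arr_add_comm[of f A B "zm A B"] arr_zero[of A B] by (simp add: arr_def)

lemma minus_zm: "f \<in> arr \<C> A B \<Longrightarrow> f \<ominus>\<^bsub>Hom \<C> A B\<^esub> zm A B = f"
  using minus_add[of f A B "zm A B"] add_zm[of "f \<ominus>\<^bsub>Hom \<C> A B\<^esub> zm A B" A B]
    arr_minus[of f A B "zm A B"] arr_zero[of A B] by (simp add: arr_def)

lemma zero_object_arr:
  assumes "is_zero_object \<C> Z"
  shows "f \<in> arr \<C> Z A \<Longrightarrow> f = zm Z A" "f \<in> arr \<C> A Z \<Longrightarrow> f = zm A Z"
  using assms arr_zero[of Z A] arr_zero[of A Z] by (auto simp: is_zero_object_def arr_def)

lemma biproductD:
  assumes "is_biproduct \<C> A B S i j p q"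
  shows "i \<in> arr \<C> A S" "j \<in> arr \<C> B S" "p \<in> arr \<C> S A" "q \<in> arr \<C> S B"
    "p \<bullet> i = Id \<C> A" "q \<bullet> j = Id \<C> B" "q \<bullet> i = zm A B" "p \<bullet> j = zm B A"
    "(i \<bullet> p) \<oplus>\<^bsub>Hom \<C> S S\<^esub> (j \<bullet> q) = Id \<C> S"
  using assms by (simp_all add: is_biproduct_def arr_def)

lemma biproductI:
  assumes "i \<in> arr \<C> A S" "j \<in> arr \<C> B S" "p \<in> arr \<C> S A" "q \<in> arr \<C> S B"
    "p \<bullet> i = Id \<C> A" "q \<bullet> j = Id \<C> B" "q \<bullet> i = zm A B" "p \<bullet> j = zm B A"
    "(i \<bullet> p) \<oplus>\<^bsub>Hom \<C> S S\<^esub> (j \<bullet> q) = Id \<C> S"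
  shows "is_biproduct \<C> A B S i j p q"
  using assms by (simp_all add: is_biproduct_def arr_def)

lemma biproduct_swap:
  assumes "is_biproduct \<C> A B S i j p q"
  shows "is_biproduct \<C> B A S j i q p"
  using assms hom_group[of S S] biproductD[OF assms] arr_comp[of j B S q S] arr_comp[of i A S p S]
  by (auto simp: is_biproduct_def arr_def abelian_groupE)

lemma biproduct_zero_left:
  assumes Z: "is_zero_object \<C> Z" and C: "C \<in> Obj \<C>"
  shows "is_biproduct \<C> Z C C (zm Z C) (Id \<C> C) (zm C Z) (Id \<C> C)"
proof (rule biproductI)
  have ZO: "Z \<in> Obj \<C>" using Z by (simp add: is_zero_object_def)
  show "zm Z C \<in> arr \<C> Z C" "Id \<C> C \<in> arr \<C> C C" "zm C Z \<in> arr \<C> C Z" "Id \<C> C \<in> arr \<C> C C"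
    using ZO C by (simp_all add: arr_zero arr_id)
  then show "zm C Z \<bullet> zm Z C = Id \<C> Z"
    using zero_object_arr(1)[OF Z, of _ Z] by (metis ZO arr_comp arr_id)
  show "Id \<C> C \<bullet> Id \<C> C = Id \<C> C" using arr_id[OF C] id_left by blast
  show "Id \<C> C \<bullet> zm Z C = zm Z C" using arr_id[OF C] zero_right ZO by blast
  show "zm C Z \<bullet> Id \<C> C = zm C Z" using arr_id[OF C] zero_left ZO by blast
  have "zm Z C \<bullet> zm C Z = zm C C" using zero_left arr_zero ZO C by blast
  then show "zm Z C \<bullet> zm C Z \<oplus>\<^bsub>Hom \<C> C C\<^esub> Id \<C> C \<bullet> Id \<C> C = Id \<C> C"
    using abelian_groupE(5)[OF hom_group[OF C C] id_mor[OF C]] id_comp[OF C C id_mor[OF C]] by simp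
qed

lemma biproduct_zero_right:
  assumes "is_zero_object \<C> Z" and "C \<in> Obj \<C>"
  shows "is_biproduct \<C> C Z C (Id \<C> C) (zm Z C) (Id \<C> C) (zm C Z)"
  by (rule biproduct_swap[OF biproduct_zero_left[OF assms]])

end

section \<open>Extension spaces and conflations\<close>

context extriangulated
begin

lemma ext_module: "\<lbrakk>C \<in> Obj \<C>; A \<in> Obj \<C>\<rbrakk> \<Longrightarrow> module K (Ext \<C> C A)"
  using ext_vectorspace vectorspace_def by blast

lemma ext_group: "\<lbrakk>C \<in> Obj \<C>; A \<in> Obj \<C>\<rbrakk> \<Longrightarrow> abelian_group (Ext \<C> C A)"
  using ext_module module_def by blast

lemma exts_zero: "\<lbrakk>C \<in> Obj \<C>; A \<in> Obj \<C>\<rbrakk> \<Longrightarrow> \<zero>\<^bsub>Ext \<C> C A\<^esub> \<in> exts \<C> C A"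
  using ext_group by (simp add: exts_def abelian_groupE)

lemma exts_push: "\<lbrakk>a \<in> arr \<C> A A'; \<delta> \<in> exts \<C> C A\<rbrakk> \<Longrightarrow> push \<C> a \<delta> \<in> exts \<C> C A'"
  using module_hom_carrier[OF push_linear, of A A' C a \<delta>] by (simp add: arr_def exts_def)

lemma exts_pull: "\<lbrakk>c \<in> arr \<C> C' C; \<delta> \<in> exts \<C> C A\<rbrakk> \<Longrightarrow> pull \<C> c \<delta> \<in> exts \<C> C' A"
  using module_hom_carrier[OF pull_linear, of A C C' c \<delta>] by (simp add: arr_def exts_def)

lemma push_zero: "\<lbrakk>a \<in> arr \<C> A A'; C \<in> Obj \<C>\<rbrakk> \<Longrightarrow> push \<C> a \<zero>\<^bsub>Ext \<C> C A\<^esub> = \<zero>\<^bsub>Ext \<C> C A'\<^esub>"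
  using module_hom_zero[OF ext_module ext_module push_linear] by (simp add: arr_def)

lemma pull_zero: "\<lbrakk>c \<in> arr \<C> C' C; A \<in> Obj \<C>\<rbrakk> \<Longrightarrow> pull \<C> c \<zero>\<^bsub>Ext \<C> C A\<^esub> = \<zero>\<^bsub>Ext \<C> C' A\<^esub>"
  using module_hom_zero[OF ext_module ext_module pull_linear] by (simp add: arr_def)

lemma push_zero_arr: "\<lbrakk>\<delta> \<in> exts \<C> C A; A' \<in> Obj \<C>\<rbrakk> \<Longrightarrow> push \<C> (zm A A') \<delta> = \<zero>\<^bsub>Ext \<C> C A'\<^esub>"
  using module_hom_zero[OF hom_module ext_module push_linear_mor] by (simp add: exts_def)

lemma pull_zero_arr: "\<lbrakk>\<delta> \<in> exts \<C> C A; C' \<in> Obj \<C>\<rbrakk> \<Longrightarrow> pull \<C> (zm C' C) \<delta> = \<zero>\<^bsub>Ext \<C> C' A\<^esub>"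
  using module_hom_zero[OF hom_module ext_module pull_linear_mor] by (simp add: exts_def)

lemma push_add_arr:
  "\<lbrakk>\<delta> \<in> exts \<C> C A; a \<in> arr \<C> A A'; b \<in> arr \<C> A A'\<rbrakk>
   \<Longrightarrow> push \<C> (a \<oplus>\<^bsub>Hom \<C> A A'\<^esub> b) \<delta> = push \<C> a \<delta> \<oplus>\<^bsub>Ext \<C> C A'\<^esub> push \<C> b \<delta>"
  using module_hom_add[OF push_linear_mor, of A A' C \<delta> a b] by (simp add: exts_def arr_def)

lemma pull_add_arr:
  "\<lbrakk>\<delta> \<in> exts \<C> C A; a \<in> arr \<C> C' C; b \<in> arr \<C> C' C\<rbrakk>
   \<Longrightarrow> pull \<C> (a \<oplus>\<^bsub>Hom \<C> C' C\<^esub> b) \<delta> = pull \<C> a \<delta> \<oplus>\<^bsub>Ext \<C> C' A\<^esub> pull \<C> b \<delta>"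
  using module_hom_add[OF pull_linear_mor, of A C C' \<delta> a b] by (simp add: exts_def arr_def)

lemma pull_minus_arr:
  "\<lbrakk>\<delta> \<in> exts \<C> C A; a \<in> arr \<C> C' C; b \<in> arr \<C> C' C\<rbrakk>
   \<Longrightarrow> pull \<C> (a \<ominus>\<^bsub>Hom \<C> C' C\<^esub> b) \<delta> = pull \<C> a \<delta> \<ominus>\<^bsub>Ext \<C> C' A\<^esub> pull \<C> b \<delta>"
  using module_hom_minus[OF hom_module ext_module pull_linear_mor]
  by (simp add: exts_def arr_def)

lemma ext_push_id: "\<delta> \<in> exts \<C> C A \<Longrightarrow> push \<C> (Id \<C> A) \<delta> = \<delta>"
  using push_id[of A C] by (simp add: exts_def)

lemma ext_pull_id: "\<delta> \<in> exts \<C> C A \<Longrightarrow> pull \<C> (Id \<C> C) \<delta> = \<delta>"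
  using pull_id[of A C] by (simp add: exts_def)

lemma ext_push_comp:
  "\<lbrakk>a' \<in> arr \<C> A' A''; a \<in> arr \<C> A A'; \<delta> \<in> exts \<C> C A\<rbrakk>
   \<Longrightarrow> push \<C> (a' \<bullet> a) \<delta> = push \<C> a' (push \<C> a \<delta>)"
  using push_comp[of A A' A'' C a a' \<delta>] by (simp add: exts_def arr_def)

lemma ext_pull_comp:
  "\<lbrakk>c \<in> arr \<C> C' C; c' \<in> arr \<C> C'' C'; \<delta> \<in> exts \<C> C A\<rbrakk>
   \<Longrightarrow> pull \<C> (c \<bullet> c') \<delta> = pull \<C> c' (pull \<C> c \<delta>)"
  using pull_comp[of A C C' C'' c c' \<delta>] by (simp add: exts_def arr_def)

lemma ext_push_pull:
  "\<lbrakk>a \<in> arr \<C> A A'; c \<in> arr \<C> C' C; \<delta> \<in> exts \<C> C A\<rbrakk>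
   \<Longrightarrow> push \<C> a (pull \<C> c \<delta>) = pull \<C> c (push \<C> a \<delta>)"
  using push_pull[of A A' C C' a c \<delta>] by (simp add: exts_def arr_def)

lemma seq_classD:
  assumes "(x', B', y') \<in> seq_class \<C> A C t"
  shows "B' \<in> Obj \<C>" "x' \<in> mor \<C> A B'" "y' \<in> mor \<C> B' C"
  using assms by (simp_all add: seq_class_def split: prod.splits)

lemma seq_class_refl:
  assumes "x \<in> arr \<C> A B" "y \<in> arr \<C> B C"
  shows "(x, B, y) \<in> seq_class \<C> A C (x, B, y)"
proof -
  have B: "B \<in> Obj \<C>" "x \<in> mor \<C> A B" "y \<in> mor \<C> B C" using assms by (simp_all add: arr_def)
  have "Id \<C> B \<bullet> Id \<C> B = Id \<C> B" using id_left[OF arr_id[OF B(1)]] .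
  then have "is_iso \<C> B B (Id \<C> B)"
    unfolding is_iso_def using id_mor[OF B(1)] by blast
  then show ?thesis
    unfolding seq_class_def using B id_left[OF assms(1)] id_right[OF assms(2)] by blast
qed

lemma conflationD:
  assumes "conflation \<C> A x B y C \<delta>"
  shows "\<delta> \<in> exts \<C> C A" "x \<in> arr \<C> A B" "y \<in> arr \<C> B C"
proof -
  show *: "\<delta> \<in> exts \<C> C A" using assms by (simp add: conflation_def)
  then have O: "A \<in> Obj \<C>" "C \<in> Obj \<C>" "\<delta> \<in> carrier (Ext \<C> C A)" by (simp_all add: exts_def)
  then obtain t where "realise \<C> C A \<delta> = seq_class \<C> A C t"
    using real_class[OF O] by blast
  then have "(x, B, y) \<in> seq_class \<C> A C t" using assms by (simp add: conflation_def)
  from seq_classD[OF this] show "x \<in> arr \<C> A B" "y \<in> arr \<C> B C"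
    using O by (simp_all add: arr_def)
qed

lemma conflation_Obj:
  assumes "conflation \<C> A x B y C \<delta>"
  shows "A \<in> Obj \<C>" "B \<in> Obj \<C>" "C \<in> Obj \<C>"
  using conflationD[OF assms] by (simp_all add: arr_def)

lemma conflation_exists:
  assumes "\<delta> \<in> exts \<C> C A"
  obtains x B y where "conflation \<C> A x B y C \<delta>"
proof -
  have O: "A \<in> Obj \<C>" "C \<in> Obj \<C>" "\<delta> \<in> carrier (Ext \<C> C A)" using assms by (simp_all add: exts_def)
  obtain x B y where *: "B \<in> Obj \<C>" "x \<in> mor \<C> A B" "y \<in> mor \<C> B C"
    "realise \<C> C A \<delta> = seq_class \<C> A C (x, B, y)"
    using real_class[OF O] by blast
  then have "(x, B, y) \<in> realise \<C> C A \<delta>"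
    using seq_class_refl[of x A B y C] O by (simp add: arr_def)
  then show ?thesis using that assms by (simp add: conflation_def)
qed

lemma conflation_lift:
  assumes c: "conflation \<C> A x B y C \<delta>" "conflation \<C> A' x' B' y' C' \<delta>'"
    and "a \<in> arr \<C> A A'" "c \<in> arr \<C> C C'" "push \<C> a \<delta> = pull \<C> c \<delta>'"
  obtains b where "b \<in> arr \<C> B B'" "b \<bullet> x = x' \<bullet> a" "y' \<bullet> b = c \<bullet> y"
proof -
  note O = conflation_Obj[OF c(1)] conflation_Obj[OF c(2)]
  have "\<exists>b \<in> mor \<C> B B'. b \<bullet> x = x' \<bullet> a \<and> y' \<bullet> b = c \<bullet> y"
    using assms by (intro real_lift[OF O(1,3,4,6)]) (simp_all add: conflation_def exts_def arr_def)
  then show ?thesis using that O unfolding arr_def by blast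
qed

lemma conflation_ET3:
  assumes c: "conflation \<C> A x B y C \<delta>" "conflation \<C> A' x' B' y' C' \<delta>'"
    and "a \<in> arr \<C> A A'" "b \<in> arr \<C> B B'" "b \<bullet> x = x' \<bullet> a"
  obtains c where "c \<in> arr \<C> C C'" "y' \<bullet> b = c \<bullet> y" "push \<C> a \<delta> = pull \<C> c \<delta>'"
proof -
  note O = conflation_Obj[OF c(1)] conflation_Obj[OF c(2)]
  have "\<exists>c \<in> mor \<C> C C'. y' \<bullet> b = c \<bullet> y \<and> push \<C> a \<delta> = pull \<C> c \<delta>'"
    using assms by (intro ET3[OF O(1,3,4,6), of \<delta> \<delta>' x B y x' B' y' a b]) (simp_all add: conflation_def exts_def arr_def)
  then show ?thesis using that O unfolding arr_def by blast
qed

lemma conflation_ET4: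
  assumes c: "conflation \<C> A f B f' D \<delta>" "conflation \<C> B g C g' F \<delta>'"
  obtains E d e h' \<delta>'' where "conflation \<C> A (g \<bullet> f) C h' E \<delta>''"
    "conflation \<C> D d E e F (push \<C> f' \<delta>')" "h' \<bullet> g = d \<bullet> f'" "e \<bullet> h' = g'"
    "pull \<C> d \<delta>'' = \<delta>" "push \<C> f \<delta>'' = pull \<C> e \<delta>'"
proof -
  note O = conflation_Obj[OF c(1)] conflation_Obj[OF c(2)]
  have *: "\<delta> \<in> carrier (Ext \<C> D A)" "\<delta>' \<in> carrier (Ext \<C> F B)"
    "(f, B, f') \<in> realise \<C> D A \<delta>" "(g, C, g') \<in> realise \<C> F B \<delta>'"
    using c by (simp_all add: conflation_def exts_def)
  obtain E d e h' \<delta>'' where E: "E \<in> Obj \<C>" "\<delta>'' \<in> carrier (Ext \<C> E A)"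
      "(g \<bullet> f, C, h') \<in> realise \<C> E A \<delta>''" "h' \<bullet> g = d \<bullet> f'" "e \<bullet> h' = g'"
      "(d, E, e) \<in> realise \<C> F D (push \<C> f' \<delta>')" "pull \<C> d \<delta>'' = \<delta>" "push \<C> f \<delta>'' = pull \<C> e \<delta>'"
    using ET4[OF O(1,2,5,3,6) *] by (elim bexE conjE) rule
  moreover have "push \<C> f' \<delta>' \<in> exts \<C> F D"
    using conflationD[OF c(1)] conflationD[OF c(2)] exts_push by blast
  ultimately have "conflation \<C> A (g \<bullet> f) C h' E \<delta>''" "conflation \<C> D d E e F (push \<C> f' \<delta>')"
    using O by (simp_all add: conflation_def exts_def)
  then show ?thesis using E(4,5,7,8) by (rule that)
qed

lemma conflation_split:
  assumes "is_biproduct \<C> A C S i j p q"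
  shows "conflation \<C> A i S q C \<zero>\<^bsub>Ext \<C> C A\<^esub>"
  using real_split[OF assms] assms exts_zero by (simp add: conflation_def is_biproduct_def)

text \<open>Together with \<open>conflation_id_right\<close> these are the test conflations with a
  zero end. Comparing an arbitrary conflation with them by \<open>conflation_ET3\<close> or
  \<open>conflation_lift\<close> yields the exactness properties.\<close>

lemma conflation_id_left:
  assumes "is_zero_object \<C> Z" "A \<in> Obj \<C>"
  shows "conflation \<C> A (Id \<C> A) A (zm A Z) Z \<zero>\<^bsub>Ext \<C> Z A\<^esub>"
  using conflation_split[OF biproduct_zero_right[OF assms]] .

lemma conflation_id_right:
  assumes "is_zero_object \<C> Z" "C \<in> Obj \<C>"
  shows "conflation \<C> Z (zm Z C) C (Id \<C> C) C \<zero>\<^bsub>Ext \<C> C Z\<^esub>"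
  using conflation_split[OF biproduct_zero_left[OF assms]] .

end

section \<open>The opposite category\<close>

text \<open>Push and pull are exchanged and sequences are reversed, so that \<open>ET3\<close> and
  \<open>ET4\<close> become \<open>ET3_op\<close> and \<open>ET4_op\<close>. A statement proved for
  every extriangulated category then yields its dual by instantiating it here and unfolding
  \<open>op_simps\<close>.\<close>

definition op_cat :: "('k, 'o, 'm, 'e) extri_cat \<Rightarrow> ('k, 'o, 'm, 'e) extri_cat" where
  "op_cat \<C> = \<lparr>Obj = Obj \<C>, Hom = (\<lambda>A B. Hom \<C> B A), Comp = (\<lambda>g f. f \<cdot>\<^bsub>\<C>\<^esub> g), Id = Id \<C>,
     Ext = (\<lambda>C A. Ext \<C> A C), push = pull \<C>, pull = push \<C>,
     realise = (\<lambda>C A \<delta>. {(x, B, y). (y, B, x) \<in> realise \<C> A C \<delta>})\<rparr>"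

lemma op_simps [simp]:
  "Obj (op_cat \<C>) = Obj \<C>" "Hom (op_cat \<C>) A B = Hom \<C> B A" "g \<cdot>\<^bsub>op_cat \<C>\<^esub> f = f \<cdot>\<^bsub>\<C>\<^esub> g"
  "Id (op_cat \<C>) = Id \<C>" "Ext (op_cat \<C>) C A = Ext \<C> A C" "push (op_cat \<C>) = pull \<C>"
  "pull (op_cat \<C>) = push \<C>"
  "(x, B, y) \<in> realise (op_cat \<C>) C A \<delta> \<longleftrightarrow> (y, B, x) \<in> realise \<C> A C \<delta>"
  "arr (op_cat \<C>) A B = arr \<C> B A" "exts (op_cat \<C>) C A = exts \<C> A C"
  "conflation (op_cat \<C>) A x B y C \<delta> \<longleftrightarrow> conflation \<C> C y B x A \<delta>"
  "is_zero_object (op_cat \<C>) Z \<longleftrightarrow> is_zero_object \<C> Z"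
  "is_left_approx (op_cat \<C>) \<X> A X f \<longleftrightarrow> is_right_approx \<C> \<X> A X f"
  "is_right_approx (op_cat \<C>) \<X> A X f \<longleftrightarrow> is_left_approx \<C> \<X> A X f"
  "is_inflation (op_cat \<C>) A B x \<longleftrightarrow> is_deflation \<C> B A x"
  "is_deflation (op_cat \<C>) A B x \<longleftrightarrow> is_inflation \<C> B A x"
  by (auto simp: op_cat_def arr_def exts_def conflation_def is_zero_object_def is_left_approx_def
      is_right_approx_def is_inflation_def is_deflation_def)

lemma op_perps [simp]:
  "right_perp (op_cat \<C>) \<X> = left_perp \<C> \<X>" "left_perp (op_cat \<C>) \<X> = right_perp \<C> \<X>"
  "projectives (op_cat \<C>) = injectives \<C>" "injectives (op_cat \<C>) = projectives \<C>"
  by (auto simp: right_perp_def left_perp_def projectives_def injectives_def)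

lemma op_frobenius [simp]:
  "functorially_finite (op_cat \<C>) \<X> \<longleftrightarrow> functorially_finite \<C> \<X>"
  "proj_inj (op_cat \<C>) = proj_inj \<C>" "frobenius (op_cat \<C>) \<longleftrightarrow> frobenius \<C>"
  by (auto simp: functorially_finite_def proj_inj_def frobenius_def)

context extriangulated
begin

lemma op_biproduct [simp]:
  "is_biproduct (op_cat \<C>) A B S i j p q \<longleftrightarrow> is_biproduct \<C> A B S p q i j"
  by (auto simp: is_biproduct_def)

lemma op_iso: "is_iso (op_cat \<C>) A B f \<longleftrightarrow> is_iso \<C> B A f"
  by (auto simp: is_iso_def)

text \<open>Equivalence of sequences is stated with a direction of the middle isomorphism. Reversing
  the sequences turns this direction around, and the inverse isomorphism restores it.\<close>

lemma seq_iso_flip: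
  assumes "x \<in> arr \<C> A B" "y \<in> arr \<C> B C" "y' \<in> arr \<C> B' C"
    and b: "is_iso \<C> B B' b" "b \<bullet> x = x'" "y' \<bullet> b = y"
  shows "\<exists>c. is_iso \<C> B' B c \<and> y \<bullet> c = y' \<and> c \<bullet> x' = x"
proof -
  have O: "A \<in> Obj \<C>" "B \<in> Obj \<C>" "C \<in> Obj \<C>" "B' \<in> Obj \<C>"
    using assms(1-3) by (simp_all add: arr_def)
  obtain c where c: "c \<in> mor \<C> B' B" "c \<bullet> b = Id \<C> B" "b \<bullet> c = Id \<C> B'"
    using b(1) unfolding is_iso_def by blast
  have bc: "b \<in> arr \<C> B B'" "c \<in> arr \<C> B' B"
    using b(1) c(1) O by (simp_all add: is_iso_def arr_def)
  have "b \<in> mor \<C> B B'" using b(1) by (simp add: is_iso_def)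
  then have "is_iso \<C> B' B c" unfolding is_iso_def using c by blast
  moreover have "y \<bullet> c = y'"
    using assoc[OF assms(3) bc] c(3) id_right[OF assms(3)] b(3) by simp
  moreover have "c \<bullet> x' = x"
    using assoc[OF bc(2,1) assms(1)] c(2) id_left[OF assms(1)] b(2) by simp
  ultimately show ?thesis by blast
qed

lemma op_seq_class:
  assumes "x \<in> arr \<C> A B" "y \<in> arr \<C> B C"
  shows "(x', B', y') \<in> seq_class \<C> A C (x, B, y) \<longleftrightarrow>
    (y', B', x') \<in> seq_class (op_cat \<C>) C A (y, B, x)"
proof -
  have *: "(\<exists>b. is_iso \<C> B B' b \<and> b \<bullet> x = x' \<and> y' \<bullet> b = y) \<longleftrightarrow>
    (\<exists>c. is_iso \<C> B' B c \<and> y \<bullet> c = y' \<and> c \<bullet> x' = x)"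
    if "B' \<in> Obj \<C>" "x' \<in> mor \<C> A B'" "y' \<in> mor \<C> B' C"
  proof -
    have "x' \<in> arr \<C> A B'" "y' \<in> arr \<C> B' C" using that assms by (simp_all add: arr_def)
    then show ?thesis
      using seq_iso_flip[OF assms, of y' B'] seq_iso_flip[of x' A B' y' C y B] assms by blast
  qed
  show ?thesis
    by (simp add: seq_class_def op_iso) (use * in blast)
qed

lemma op_additive: "additive_category K (op_cat \<C>)"
proof (intro additive_category.intro linear_category.intro linear_category_axioms.intro
    additive_category_axioms.intro field_axioms, goal_cases)
  case (1 A B) then show ?case by (simp add: hom_vectorspace)
next
  case (2 A B A' B' f) then show ?case using hom_disjoint[of B A B' A' f] by simp
next
  case (3 A) then show ?case by (simp add: id_mor)
next
  case (4 A B C g) then show ?case using comp_linear_left[of C B A g] by simp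
next
  case (5 A B C f) then show ?case using comp_linear_right[of C B A f] by simp
next
  case (6 A B C D f g h) then show ?case using comp_assoc[of D C B A h g f] by simp
next
  case (7 A B f) then show ?case by (simp add: comp_id)
next
  case (8 A B f) then show ?case by (simp add: id_comp)
next
  case 9 then show ?case using zero_object_exists by simp
next
  case (10 A B)
  then obtain S i j p q where "is_biproduct \<C> A B S i j p q"
    using biproduct_exists[of A B] by auto
  then have "is_biproduct (op_cat \<C>) A B S p q i j" by simp
  then show ?case by (intro exI)
qed

lemma op_extriangulated: "extriangulated K (op_cat \<C>)"
proof (intro extriangulated.intro extriangulated_axioms.intro op_additive, goal_cases)
  case (1 A C) then show ?case by (simp add: ext_vectorspace)
next
  case (2 A A' C a) then show ?case by (simp add: pull_linear)
next
  case (3 A C C' c) then show ?case by (simp add: push_linear)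
next
  case (4 A A' C \<delta>) then show ?case by (simp add: pull_linear_mor)
next
  case (5 A C C' \<delta>) then show ?case by (simp add: push_linear_mor)
next
  case (6 A C \<delta>) then show ?case using pull_id[of C A] by simp
next
  case (7 A C \<delta>) then show ?case using push_id[of C A] by simp
next
  case (8 A A' A'' C a a' \<delta>) then show ?case using pull_comp[of C A A' A'' a a' \<delta>] by simp
next
  case (9 A C C' C'' c c' \<delta>) then show ?case using push_comp[of C C' C'' A c c' \<delta>] by simp
next
  case (10 A A' C C' a c \<delta>) then show ?case using push_pull[of C C' A A' c a \<delta>] by simp
next
  case (11 A C \<delta>)
  then obtain x B y where *: "B \<in> Obj \<C>" "x \<in> mor \<C> C B" "y \<in> mor \<C> B A"
    "realise \<C> A C \<delta> = seq_class \<C> C A (x, B, y)"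
    using real_class[of C A \<delta>] by auto
  have "realise (op_cat \<C>) C A \<delta> = seq_class (op_cat \<C>) A C (y, B, x)"
  proof (rule Set.set_eqI)
    fix t :: "'m \<times> 'o \<times> 'm"
    obtain x' B' y' where t: "t = (x', B', y')" by (cases t)
    show "t \<in> realise (op_cat \<C>) C A \<delta> \<longleftrightarrow> t \<in> seq_class (op_cat \<C>) A C (y, B, x)"
      using 11 *(1-3) op_seq_class[of x C B y A y' B' x'] by (simp add: t *(4) arr_def)
  qed
  then show ?case using * by auto
next
  case (12 A C A' C' \<delta> \<delta>' x B y x' B' y' a c)
  then show ?case
    using real_lift[of C' A' C A \<delta>' \<delta> y' B' x' y B x c a] by (simp; blast)
next
  case (13 A C S i j p q)
  then show ?case using real_split[of C A S q p j i] biproduct_swap by simp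
next
  case (14 \<delta> C A \<delta>' C' A' x B y x' B' y' SA iA jA pA qA SB iB jB pB qB SC iC jC pC qC \<epsilon>)
  have bip: "is_biproduct \<C> A A' SA pA qA iA jA" "is_biproduct \<C> B B' SB pB qB iB jB"
    "is_biproduct \<C> C C' SC pC qC iC jC"
    using 14(5-7) by simp_all
  have co: "conflation \<C> C y B x A \<delta>" "conflation \<C> C' y' B' x' A' \<delta>'"
    using 14(1-4) bip by (simp_all add: conflation_def exts_def is_biproduct_def)
  have \<epsilon>: "\<epsilon> \<in> exts \<C> SA SC" using 14(8) bip by (simp add: exts_def is_biproduct_def)
  note b = biproductD[OF bip(1)] biproductD[OF bip(2)] biproductD[OF bip(3)]
  \<comment> \<open>The components of \<epsilon> are given here as a pull of a push;
    \<open>ext_push_pull\<close> brings them into the form required by \<open>real_sum\<close>. The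
    composites are reassociated afterwards, since reversal also moves the brackets.\<close>
  have "(pB \<bullet> y \<bullet> iC \<oplus>\<^bsub>Hom \<C> SC SB\<^esub> qB \<bullet> y' \<bullet> jC, SB, pA \<bullet> x \<bullet> iB \<oplus>\<^bsub>Hom \<C> SB SA\<^esub> qA \<bullet> x' \<bullet> jB)
    \<in> realise \<C> SA SC \<epsilon>"
    using 14(1-4,8-12) ext_push_pull[OF b(21) b(1) \<epsilon>] ext_push_pull[OF b(21) b(2) \<epsilon>]
      ext_push_pull[OF b(22) b(1) \<epsilon>] ext_push_pull[OF b(22) b(2) \<epsilon>]
    by (intro real_sum[OF _ _ _ _ bip(3,2,1), of \<delta> \<delta>']) (simp_all only: op_simps)
  then have "(pB \<bullet> (y \<bullet> iC) \<oplus>\<^bsub>Hom \<C> SC SB\<^esub> qB \<bullet> (y' \<bullet> jC), SB,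
      pA \<bullet> (x \<bullet> iB) \<oplus>\<^bsub>Hom \<C> SB SA\<^esub> qA \<bullet> (x' \<bullet> jB)) \<in> realise \<C> SA SC \<epsilon>"
    unfolding assoc[OF b(10) conflationD(2)[OF co(1)] b(21)] assoc[OF b(1) conflationD(3)[OF co(1)] b(12)]
      assoc[OF b(11) conflationD(2)[OF co(2)] b(22)] assoc[OF b(2) conflationD(3)[OF co(2)] b(13)] .
  then show ?case unfolding op_simps .
next
  case (15 A C A' C' \<delta> \<delta>' x B y x' B' y' a b)
  note p = 15[unfolded op_simps]
  show ?case
    using ET3_op[OF p(4,3,2,1,6,5,8,7,10,9,11)] unfolding op_simps by metis
next
  case (16 A C A' C' \<delta> \<delta>' x B y x' B' y' b c)
  note p = 16[unfolded op_simps]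
  show ?case
    using ET3[OF p(4,3,2,1,6,5,8,7,10,9,11)] unfolding op_simps by metis
next
  case (17 A B C D F \<delta> \<delta>' f f' g g')
  note p = 17[unfolded op_simps]
  obtain E d e h' \<delta>'' where "E \<in> Obj \<C>" "d \<in> mor \<C> F E" "e \<in> mor \<C> E D" "h' \<in> mor \<C> E C"
    "\<delta>'' \<in> carrier (Ext \<C> A E)" "(h', C, f \<bullet> g) \<in> realise \<C> A E \<delta>''"
    "h' \<bullet> d = g'" "g \<bullet> h' = f' \<bullet> e" "(d, E, e) \<in> realise \<C> D F (pull \<C> f' \<delta>')"
    "push \<C> e \<delta>'' = \<delta>" "push \<C> d \<delta>' = pull \<C> f \<delta>''"
    using ET4_op[OF p(3,2,1,5,4,7,6,9,8)] by (elim bexE conjE) rule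
  then show ?case
    unfolding op_simps by - (rule bexI[of _ E], rule bexI[of _ e], rule bexI[of _ d], rule bexI[of _ h'],
      rule bexI[of _ \<delta>''], intro conjI; (assumption | erule sym))
next
  case (18 A B C D F \<delta> \<delta>' f' f g' g)
  note p = 18[unfolded op_simps]
  obtain E d e h' \<delta>'' where "E \<in> Obj \<C>" "d \<in> mor \<C> F E" "e \<in> mor \<C> E D" "h' \<in> mor \<C> A E"
    "\<delta>'' \<in> carrier (Ext \<C> E C)" "(f \<bullet> g, A, h') \<in> realise \<C> E C \<delta>''"
    "h' \<bullet> f = d \<bullet> g'" "e \<bullet> h' = f'" "(d, E, e) \<in> realise \<C> D F (push \<C> g' \<delta>)"
    "pull \<C> d \<delta>'' = \<delta>'" "push \<C> g \<delta>'' = pull \<C> e \<delta>"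
    using ET4[OF p(3,2,1,5,4,7,6,9,8)] by (elim bexE conjE) rule
  then show ?case
    unfolding op_simps by - (rule bexI[of _ E], rule bexI[of _ e], rule bexI[of _ d], rule bexI[of _ h'],
      rule bexI[of _ \<delta>''], intro conjI; (assumption | erule sym))
qed

end

section \<open>Exact sequences\<close>

context extriangulated
begin

lemma zero_object:
  obtains Z where "is_zero_object \<C> Z" "Z \<in> Obj \<C>"
  using zero_object_exists by (auto simp: is_zero_object_def)

text \<open>Each equation compares the conflation with one that has a zero end, by ET3 or its dual.
  The third map supplied by the axiom starts or ends at a zero object, where composites and
  extensions vanish.\<close>

lemma conflation_comp_zero:
  assumes "conflation \<C> A x B y C \<delta>"
  shows "y \<bullet> x = zm A C" "pull \<C> y \<delta> = \<zero>\<^bsub>Ext \<C> B A\<^esub>" "push \<C> x \<delta> = \<zero>\<^bsub>Ext \<C> C B\<^esub>"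
proof -
  obtain Z where Z: "is_zero_object \<C> Z" "Z \<in> Obj \<C>" by (rule zero_object)
  note c = conflationD[OF assms] and O = conflation_Obj[OF assms]
  show "y \<bullet> x = zm A C"
  proof (rule conflation_ET3[OF conflation_id_left[OF Z(1) O(1)] assms arr_id[OF O(1)] c(2)])
    fix d assume "d \<in> arr \<C> Z C" "y \<bullet> x = d \<bullet> zm A Z"
    then show ?thesis using zero_right O(1) by simp
  qed simp
  show "push \<C> x \<delta> = \<zero>\<^bsub>Ext \<C> C B\<^esub>"
  proof (rule conflation_ET3[OF assms conflation_id_left[OF Z(1) O(2)] c(2) arr_id[OF O(2)]])
    fix d assume "d \<in> arr \<C> C Z" "push \<C> x \<delta> = pull \<C> d \<zero>\<^bsub>Ext \<C> Z B\<^esub>"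
    then show ?thesis using pull_zero O(2) by simp
  qed simp
  show "pull \<C> y \<delta> = \<zero>\<^bsub>Ext \<C> B A\<^esub>"
  proof (rule extriangulated.conflation_ET3[OF op_extriangulated, unfolded op_simps,
      OF assms conflation_id_right[OF Z(1) O(2)] c(3) arr_id[OF O(2)]])
    fix d assume "d \<in> arr \<C> Z A" "pull \<C> y \<delta> = push \<C> d \<zero>\<^bsub>Ext \<C> B Z\<^esub>"
    then show ?thesis using push_zero O(2) by simp
  qed simp
qed

text \<open>The maps \<open>A \<rightarrow> 0\<close> and \<open>f\<close> form a commutative square
  into the conflation \<open>0 \<rightarrow> W = W\<close>, and ET3 supplies \<open>g\<close> as the
  third map.\<close>

lemma conflation_factor_right:
  assumes c: "conflation \<C> A x B y C \<delta>" and f: "f \<in> arr \<C> B W" and "f \<bullet> x = zm A W"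
  obtains g where "g \<in> arr \<C> C W" "f = g \<bullet> y"
proof -
  obtain Z where Z: "is_zero_object \<C> Z" "Z \<in> Obj \<C>" by (rule zero_object)
  have W: "W \<in> Obj \<C>" using f by (simp add: arr_def)
  note O = conflation_Obj[OF c]
  have eq: "f \<bullet> x = zm Z W \<bullet> zm A Z"
    using zero_left[OF arr_zero[OF O(1) Z(2)] W] assms(3) by simp
  obtain g where "g \<in> arr \<C> C W" "Id \<C> W \<bullet> f = g \<bullet> y"
    using conflation_ET3[OF c conflation_id_right[OF Z(1) W] arr_zero[OF O(1) Z(2)] f eq] .
  then show ?thesis using that id_left[OF f] by simp
qed

text \<open>By the vanishing of the push, \<open>f\<close> and \<open>C \<rightarrow> 0\<close> form
  a morphism of extensions to the class of \<open>W = W \<rightarrow> 0\<close>. The middle map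
  realising it is \<open>g\<close>.\<close>

lemma conflation_extend:
  assumes c: "conflation \<C> A x B y C \<delta>" and f: "f \<in> arr \<C> A W" and "push \<C> f \<delta> = \<zero>\<^bsub>Ext \<C> C W\<^esub>"
  obtains g where "g \<in> arr \<C> B W" "g \<bullet> x = f"
proof -
  obtain Z where Z: "is_zero_object \<C> Z" "Z \<in> Obj \<C>" by (rule zero_object)
  have W: "W \<in> Obj \<C>" using f by (simp add: arr_def)
  note O = conflation_Obj[OF c]
  have eq: "push \<C> f \<delta> = pull \<C> (zm C Z) \<zero>\<^bsub>Ext \<C> Z W\<^esub>"
    using assms(3) pull_zero[OF arr_zero[OF O(3) Z(2)] W] by simp
  obtain g where "g \<in> arr \<C> B W" "g \<bullet> x = Id \<C> W \<bullet> f"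
    using conflation_lift[OF c conflation_id_left[OF Z(1) W] f arr_zero[OF O(3) Z(2)] eq] .
  then show ?thesis using that id_left[OF f] by simp
qed

lemmas conflation_factor_left =
  extriangulated.conflation_factor_right[OF op_extriangulated, unfolded op_simps]
lemmas conflation_lift_right =
  extriangulated.conflation_extend[OF op_extriangulated, unfolded op_simps]

text \<open>Exactness at \<open>Ext C W\<close>. Since \<eta> vanishes along \<open>y\<close>, the
  map \<open>y\<close> lifts to the middle term of a realisation of \<eta>. The dual of ET3
  completes this lift and the identity of \<open>C\<close> to a morphism of conflations, with
  \<open>a\<close> on the left.\<close>

lemma conflation_ext_push:
  assumes c: "conflation \<C> A x B y C \<delta>" and \<eta>: "\<eta> \<in> exts \<C> C W" and "pull \<C> y \<eta> = \<zero>\<^bsub>Ext \<C> B W\<^esub>"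
  obtains a where "a \<in> arr \<C> A W" "\<eta> = push \<C> a \<delta>"
proof -
  obtain x' B' y' where c': "conflation \<C> W x' B' y' C \<eta>" using conflation_exists[OF \<eta>] .
  note O = conflation_Obj[OF c]
  obtain b where b: "b \<in> arr \<C> B B'" "y' \<bullet> b = y"
    using conflation_lift_right[OF c' conflationD(3)[OF c] assms(3)] .
  have eq: "y' \<bullet> b = Id \<C> C \<bullet> y" using b(2) id_left[OF conflationD(3)[OF c]] by simp
  obtain a where "a \<in> arr \<C> A W" "push \<C> a \<delta> = pull \<C> (Id \<C> C) \<eta>"
    using extriangulated.conflation_ET3[OF op_extriangulated, unfolded op_simps,
       OF c' c arr_id[OF O(3)] b(1) eq] by metis
  then show ?thesis using that ext_pull_id[OF \<eta>] by simp
qed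

lemmas conflation_ext_pull =
  extriangulated.conflation_ext_push[OF op_extriangulated, unfolded op_simps]

text \<open>Exactness at \<open>Ext X B\<close>. Applying ET4 to \<open>x\<close> followed by the
  inflation of a realisation of \<gamma> gives a conflation from \<open>C\<close> to
  \<open>X\<close> of class \<open>push y \<gamma>\<close>. Its deflation has a section, and pulling
  \<delta>'' back along that section gives \<eta>.\<close>

lemma conflation_ext_middle:
  assumes c: "conflation \<C> A x B y C \<delta>" and \<gamma>: "\<gamma> \<in> exts \<C> X B" and "push \<C> y \<gamma> = \<zero>\<^bsub>Ext \<C> X C\<^esub>"
  obtains \<eta> where "\<eta> \<in> exts \<C> X A" "\<gamma> = push \<C> x \<eta>"
proof -
  obtain g G g' where c': "conflation \<C> B g G g' X \<gamma>" using conflation_exists[OF \<gamma>] .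
  obtain E d e h' \<delta>'' where 1: "conflation \<C> A (g \<bullet> x) G h' E \<delta>''"
    "conflation \<C> C d E e X (push \<C> y \<gamma>)" "push \<C> x \<delta>'' = pull \<C> e \<gamma>"
    using conflation_ET4[OF c c'] .
  have X: "X \<in> Obj \<C>" using \<gamma> by (simp add: exts_def)
  have "pull \<C> (Id \<C> X) (push \<C> y \<gamma>) = \<zero>\<^bsub>Ext \<C> X C\<^esub>"
    using assms(3) pull_zero[OF arr_id[OF X]] conflation_Obj(3)[OF c] by simp
  then obtain s where s: "s \<in> arr \<C> X E" "e \<bullet> s = Id \<C> X"
    using conflation_lift_right[OF 1(2) arr_id[OF X]] by blast
  note e = conflationD(3)[OF 1(2)] and d = conflationD(1)[OF 1(1)]
  have "\<gamma> = pull \<C> s (pull \<C> e \<gamma>)"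
    using ext_pull_comp[OF e s(1) \<gamma>] ext_pull_id[OF \<gamma>] s(2) by simp
  also have "\<dots> = push \<C> x (pull \<C> s \<delta>'')"
    using 1(3) ext_push_pull[OF conflationD(2)[OF c] s(1) d] by simp
  finally show ?thesis using that exts_pull[OF s(1) d] by blast
qed

end

section \<open>Vanishing extensions, projectives and injectives\<close>

definition ext_vanish :: "('k, 'o, 'm, 'e) extri_cat \<Rightarrow> 'o \<Rightarrow> 'o \<Rightarrow> bool" where
  "ext_vanish \<C> C A \<longleftrightarrow> C \<in> Obj \<C> \<and> A \<in> Obj \<C> \<and> carrier (Ext \<C> C A) = {\<zero>\<^bsub>Ext \<C> C A\<^esub>}"

lemma op_vanish [simp]: "ext_vanish (op_cat \<C>) C A \<longleftrightarrow> ext_vanish \<C> A C"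
  by (auto simp: ext_vanish_def)

lemma ext_vanishD: "\<lbrakk>ext_vanish \<C> C A; \<delta> \<in> exts \<C> C A\<rbrakk> \<Longrightarrow> \<delta> = \<zero>\<^bsub>Ext \<C> C A\<^esub>"
  by (simp add: ext_vanish_def exts_def)

lemma right_perp_iff:
  "\<X> \<subseteq> Obj \<C> \<Longrightarrow> Y \<in> right_perp \<C> \<X> \<longleftrightarrow> Y \<in> Obj \<C> \<and> (\<forall>X \<in> \<X>. ext_vanish \<C> X Y)"
  by (auto simp: right_perp_def ext_vanish_def)

lemma left_perp_iff:
  "\<X> \<subseteq> Obj \<C> \<Longrightarrow> Y \<in> left_perp \<C> \<X> \<longleftrightarrow> Y \<in> Obj \<C> \<and> (\<forall>X \<in> \<X>. ext_vanish \<C> Y X)"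
  by (auto simp: left_perp_def ext_vanish_def)

context extriangulated
begin

lemma ext_vanishI:
  assumes "C \<in> Obj \<C>" "A \<in> Obj \<C>" "\<And>\<delta>. \<delta> \<in> exts \<C> C A \<Longrightarrow> \<delta> = \<zero>\<^bsub>Ext \<C> C A\<^esub>"
  shows "ext_vanish \<C> C A"
proof -
  have "carrier (Ext \<C> C A) \<subseteq> {\<zero>\<^bsub>Ext \<C> C A\<^esub>}" using assms(3) extsI[OF assms(1,2)] by blast
  moreover have "\<zero>\<^bsub>Ext \<C> C A\<^esub> \<in> carrier (Ext \<C> C A)" using extsD(3)[OF exts_zero[OF assms(1,2)]] .
  ultimately show ?thesis unfolding ext_vanish_def using assms(1,2) by blast
qed

lemma ext_vanish_middle:
  assumes "conflation \<C> A x B y C \<delta>" "ext_vanish \<C> W A" "ext_vanish \<C> W C"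
  shows "ext_vanish \<C> W B"
proof (rule ext_vanishI)
  note c = conflationD[OF assms(1)]
  show W: "W \<in> Obj \<C>" "B \<in> Obj \<C>"
    using assms(2) conflation_Obj[OF assms(1)] by (simp_all add: ext_vanish_def)
  fix \<gamma> assume g: "\<gamma> \<in> exts \<C> W B"
  have "push \<C> y \<gamma> = \<zero>\<^bsub>Ext \<C> W C\<^esub>" by (rule ext_vanishD[OF assms(3) exts_push[OF c(3) g]])
  then obtain \<eta> where \<eta>: "\<eta> \<in> exts \<C> W A" "\<gamma> = push \<C> x \<eta>"
    by (rule conflation_ext_middle[OF assms(1) g])
  have "\<eta> = \<zero>\<^bsub>Ext \<C> W A\<^esub>" by (rule ext_vanishD[OF assms(2) \<eta>(1)])
  then show "\<gamma> = \<zero>\<^bsub>Ext \<C> W B\<^esub>" using \<eta>(2) push_zero[OF c(2) W(1)] by simp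
qed

lemmas ext_vanish_middle_op =
  extriangulated.ext_vanish_middle[OF op_extriangulated, unfolded op_simps op_vanish]

lemma ext_vanish_retract:
  assumes "i \<in> arr \<C> A S" "p \<in> arr \<C> S A" "p \<bullet> i = Id \<C> A" "ext_vanish \<C> W S"
  shows "ext_vanish \<C> W A"
proof (rule ext_vanishI)
  show W: "W \<in> Obj \<C>" "A \<in> Obj \<C>"
    using assms by (simp_all add: ext_vanish_def arr_def)
  fix \<gamma> assume g: "\<gamma> \<in> exts \<C> W A"
  have "push \<C> i \<gamma> = \<zero>\<^bsub>Ext \<C> W S\<^esub>" by (rule ext_vanishD[OF assms(4) exts_push[OF assms(1) g]])
  then have "push \<C> p (push \<C> i \<gamma>) = \<zero>\<^bsub>Ext \<C> W A\<^esub>" using push_zero[OF assms(2) W(1)] by simp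
  then show "\<gamma> = \<zero>\<^bsub>Ext \<C> W A\<^esub>" using ext_push_comp[OF assms(2,1) g] ext_push_id[OF g] assms(3) by simp
qed

lemmas ext_vanish_retract_op =
  extriangulated.ext_vanish_retract[OF op_extriangulated, unfolded op_simps op_vanish]

lemma ext_vanish_zero:
  assumes "is_zero_object \<C> Z" "W \<in> Obj \<C>"
  shows "ext_vanish \<C> W Z"
proof (rule ext_vanishI)
  show Z: "Z \<in> Obj \<C>" using assms(1) by (simp add: is_zero_object_def)
  fix \<gamma> assume g: "\<gamma> \<in> exts \<C> W Z"
  have "Id \<C> Z = zm Z Z" by (rule zero_object_arr(1)[OF assms(1) arr_id[OF Z]])
  then show "\<gamma> = \<zero>\<^bsub>Ext \<C> W Z\<^esub>" using ext_push_id[OF g] push_zero_arr[OF g Z] by simp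
qed (rule assms(2))

lemma conflation_section:
  assumes c: "conflation \<C> A x B y C \<delta>" and v: "ext_vanish \<C> W A" and f: "f \<in> arr \<C> W C"
  obtains g where "g \<in> arr \<C> W B" "y \<bullet> g = f"
proof -
  have "pull \<C> f \<delta> = \<zero>\<^bsub>Ext \<C> W A\<^esub>"
    by (rule ext_vanishD[OF v exts_pull[OF f conflationD(1)[OF c]]])
  then obtain g where "g \<in> arr \<C> W B" "y \<bullet> g = f" by (rule conflation_lift_right[OF c f])
  then show ?thesis by (rule that)
qed

text \<open>A deflation onto a projective \<open>Q\<close> has a section, and a class is recovered
  by pulling it back along \<open>y\<close>, which already gives zero, and then along the section.
  Conversely, vanishing allows lifting by \<open>conflation_section\<close>. Only extension spaces
  occur in this form, so it can be evaluated in full subcategories.\<close>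

lemma projectives_iff:
  "Q \<in> projectives \<C> \<longleftrightarrow> Q \<in> Obj \<C> \<and> (\<forall>A \<in> Obj \<C>. ext_vanish \<C> Q A)"
proof (intro iffI conjI ballI)
  assume Q: "Q \<in> projectives \<C>"
  show QO: "Q \<in> Obj \<C>" using Q by (simp add: projectives_def)
  fix A assume A: "A \<in> Obj \<C>"
  show "ext_vanish \<C> Q A"
  proof (rule ext_vanishI[OF QO A])
    fix \<delta> assume d: "\<delta> \<in> exts \<C> Q A"
    obtain x B y where c: "conflation \<C> A x B y Q \<delta>" using conflation_exists[OF d] .
    then have "is_deflation \<C> B Q y" by (auto simp: is_deflation_iff)
    then obtain s where s: "s \<in> mor \<C> Q B" "y \<bullet> s = Id \<C> Q"
      using Q id_mor[OF QO] QO conflation_Obj[OF c] unfolding projectives_def by blast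
    have s': "s \<in> arr \<C> Q B" using s(1) QO conflation_Obj[OF c] by (simp add: arr_def)
    have "\<delta> = pull \<C> s (pull \<C> y \<delta>)"
      using ext_pull_comp[OF conflationD(3)[OF c] s' d] ext_pull_id[OF d] s(2) by simp
    also have "\<dots> = \<zero>\<^bsub>Ext \<C> Q A\<^esub>"
      using conflation_comp_zero(2)[OF c] pull_zero[OF s' A] by simp
    finally show "\<delta> = \<zero>\<^bsub>Ext \<C> Q A\<^esub>" .
  qed
next
  assume Q: "Q \<in> Obj \<C> \<and> (\<forall>A \<in> Obj \<C>. ext_vanish \<C> Q A)"
  show "Q \<in> projectives \<C>"
    unfolding projectives_def mem_Collect_eq
  proof (intro conjI ballI allI impI)
    show "Q \<in> Obj \<C>" using Q by simp
    fix B C y c assume "B \<in> Obj \<C>" "C \<in> Obj \<C>" and *: "is_deflation \<C> B C y \<and> c \<in> mor \<C> Q C"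
    then obtain A x \<delta> where co: "conflation \<C> A x B y C \<delta>" by (auto simp: is_deflation_iff)
    have "ext_vanish \<C> Q A" using Q conflation_Obj[OF co] by blast
    moreover have "c \<in> arr \<C> Q C" using Q * conflation_Obj[OF co] by (simp add: arr_def)
    ultimately obtain b where "b \<in> arr \<C> Q B" "y \<bullet> b = c" by (rule conflation_section[OF co])
    then show "\<exists>b \<in> mor \<C> Q B. y \<bullet> b = c" by (auto simp: arr_def)
  qed
qed

lemmas injectives_iff =
  extriangulated.projectives_iff[OF op_extriangulated, unfolded op_simps op_vanish op_perps]

text \<open>A section \<open>s\<close> and a retraction \<rho> chosen separately need not compose to
  zero. The projection \<open>r\<close> is instead read off from the complementary idempotent
  \<open>1 - s y\<close>, which \<open>y\<close> kills and which therefore factors through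
  \<open>x\<close>.\<close>

lemma conflation_zero_biproduct:
  assumes c: "conflation \<C> A x B y C \<zero>\<^bsub>Ext \<C> C A\<^esub>"
  obtains s r where "is_biproduct \<C> C A B s x y r"
proof -
  note x = conflationD(2)[OF c] and y = conflationD(3)[OF c] and O = conflation_Obj[OF c]
  obtain s where s: "s \<in> arr \<C> C B" "y \<bullet> s = Id \<C> C"
    using conflation_lift_right[OF c arr_id[OF O(3)] pull_zero[OF arr_id[OF O(3)] O(1)]] .
  \<comment> \<open>The retraction \<rho> serves to cancel \<open>x\<close> on the left.\<close>
  obtain \<rho> where \<rho>: "\<rho> \<in> arr \<C> B A" "\<rho> \<bullet> x = Id \<C> A"
    using conflation_extend[OF c arr_id[OF O(1)] push_zero[OF arr_id[OF O(1)] O(3)]] .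
  have mono: "f = g" if "f \<in> arr \<C> W A" "g \<in> arr \<C> W A" "x \<bullet> f = x \<bullet> g" for f g W
    using assoc[OF \<rho>(1) x that(1)] assoc[OF \<rho>(1) x that(2)] that(3) \<rho>(2)
      id_left[OF that(1)] id_left[OF that(2)] by simp
  have sy: "s \<bullet> y \<in> arr \<C> B B" using arr_comp[OF s(1) y] .
  define e where "e = Id \<C> B \<ominus>\<^bsub>Hom \<C> B B\<^esub> s \<bullet> y"
  have e: "e \<in> arr \<C> B B" unfolding e_def by (rule arr_minus[OF arr_id[OF O(2)] sy])
  have "y \<bullet> (s \<bullet> y) = y" using assoc[OF y s(1) y] s(2) id_left[OF y] by simp
  then have "y \<bullet> e = zm B C"
    unfolding e_def minus_right[OF y arr_id[OF O(2)] sy]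
    using id_right[OF y] minus_zero_iff[OF y y] by simp
  then obtain r where r: "r \<in> arr \<C> B A" "e = x \<bullet> r"
    using conflation_factor_left[OF c e] by blast
  have ex: "e \<bullet> x = x"
  proof -
    have "s \<bullet> y \<bullet> x = zm A B"
      using assoc[OF s(1) y x] conflation_comp_zero(1)[OF c] zero_right[OF s(1) O(1)] by simp
    then show ?thesis
      unfolding e_def minus_left[OF x arr_id[OF O(2)] sy] using id_left[OF x] minus_zm[OF x] by simp
  qed
  have es: "e \<bullet> s = zm C B"
    unfolding e_def minus_left[OF s(1) arr_id[OF O(2)] sy]
    using assoc[OF s(1) y s(1)] s id_right[OF s(1)] id_left[OF s(1)] minus_zero_iff[OF s(1) s(1)] by simp
  have "r \<bullet> x = Id \<C> A"
    using assoc[OF x r(1) x] r(2) ex id_right[OF x]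
    by (intro mono[OF arr_comp[OF r(1) x] arr_id[OF O(1)]]) simp
  moreover have "r \<bullet> s = zm C A"
    using assoc[OF x r(1) s(1)] r(2) es zero_right[OF x O(3)]
    by (intro mono[OF arr_comp[OF r(1) s(1)] arr_zero[OF O(3,1)]]) simp
  moreover have "s \<bullet> y \<oplus>\<^bsub>Hom \<C> B B\<^esub> x \<bullet> r = Id \<C> B"
    using minus_add[OF arr_id[OF O(2)] sy] arr_add_comm[OF sy e] r(2) by (simp add: e_def)
  ultimately have "is_biproduct \<C> C A B s x y r"
    using s x y r conflation_comp_zero(1)[OF c] by (intro biproductI)
  then show ?thesis by (rule that)
qed

section \<open>Deflations out of a biproduct\<close>

lemma biproduct_corner:
  assumes b: "is_biproduct \<C> X P S i j p q" and f: "f \<in> arr \<C> X C" and g: "g \<in> arr \<C> P C"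
  shows "f \<bullet> p \<oplus>\<^bsub>Hom \<C> S C\<^esub> g \<bullet> q \<in> arr \<C> S C"
    "(f \<bullet> p \<oplus>\<^bsub>Hom \<C> S C\<^esub> g \<bullet> q) \<bullet> i = f" "(f \<bullet> p \<oplus>\<^bsub>Hom \<C> S C\<^esub> g \<bullet> q) \<bullet> j = g"
proof -
  note b = biproductD[OF b]
  have fp: "f \<bullet> p \<in> arr \<C> S C" and gq: "g \<bullet> q \<in> arr \<C> S C"
    using arr_comp b f g by blast+
  have X: "X \<in> Obj \<C>" "P \<in> Obj \<C>" using f g by (simp_all add: arr_def)
  show "f \<bullet> p \<oplus>\<^bsub>Hom \<C> S C\<^esub> g \<bullet> q \<in> arr \<C> S C" using arr_add[OF fp gq] .
  show "(f \<bullet> p \<oplus>\<^bsub>Hom \<C> S C\<^esub> g \<bullet> q) \<bullet> i = f"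
    unfolding add_left[OF b(1) fp gq] assoc[OF f b(3,1)] assoc[OF g b(4,1)] b(5,7)
      id_right[OF f] zero_right[OF g X(1)] by (rule add_zm[OF f])
  show "(f \<bullet> p \<oplus>\<^bsub>Hom \<C> S C\<^esub> g \<bullet> q) \<bullet> j = g"
    unfolding add_left[OF b(2) fp gq] assoc[OF f b(3,2)] assoc[OF g b(4,2)] b(6,8)
      id_right[OF g] zero_right[OF f X(2)] by (rule zm_add[OF g])
qed

text \<open>The shear \<open>(x, c) \<mapsto> (x, c + f x)\<close> of \<open>X \<oplus> C\<close> turns the projection onto \<open>C\<close> into \<open>[f, 1]\<close>.\<close>

lemma biproduct_shear:
  assumes b: "is_biproduct \<C> X C S i j p q" and f: "f \<in> arr \<C> X C"
  shows "is_biproduct \<C> X C S (i \<ominus>\<^bsub>Hom \<C> X S\<^esub> j \<bullet> f) j p (f \<bullet> p \<oplus>\<^bsub>Hom \<C> S C\<^esub> q)"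
proof -
  note bd = biproductD[OF b]
  have O: "X \<in> Obj \<C>" "C \<in> Obj \<C>" "S \<in> Obj \<C>" using bd(1,2) by (simp_all add: arr_def)
  have jf: "j \<bullet> f \<in> arr \<C> X S" and fp: "f \<bullet> p \<in> arr \<C> S C" using arr_comp bd f by blast+
  let ?q = "f \<bullet> p \<oplus>\<^bsub>Hom \<C> S C\<^esub> q"
  have q: "?q \<in> arr \<C> S C" "?q \<bullet> i = f" "?q \<bullet> j = Id \<C> C"
    using biproduct_corner[OF b f arr_id[OF O(2)]] unfolding id_left[OF bd(4)] .
  show ?thesis
  proof (rule biproductI)
    show "i \<ominus>\<^bsub>Hom \<C> X S\<^esub> j \<bullet> f \<in> arr \<C> X S" by (rule arr_minus[OF bd(1) jf])
    show "p \<bullet> (i \<ominus>\<^bsub>Hom \<C> X S\<^esub> j \<bullet> f) = Id \<C> X"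
      unfolding minus_right[OF bd(3,1) jf] assoc[OF bd(3,2) f, symmetric] bd(5,8)
        zero_left[OF f O(1)] by (rule minus_zm[OF arr_id[OF O(1)]])
    show "?q \<bullet> (i \<ominus>\<^bsub>Hom \<C> X S\<^esub> j \<bullet> f) = zm X C"
      unfolding minus_right[OF q(1) bd(1) jf] assoc[OF q(1) bd(2) f, symmetric] q(2,3)
        id_left[OF f] using minus_zero_iff[OF f f] by simp
    have jfp: "j \<bullet> (f \<bullet> p) \<in> arr \<C> S S" and ip: "i \<bullet> p \<in> arr \<C> S S" and jq: "j \<bullet> q \<in> arr \<C> S S"
      using arr_comp bd fp by blast+
    have "(i \<ominus>\<^bsub>Hom \<C> X S\<^esub> j \<bullet> f) \<bullet> p \<oplus>\<^bsub>Hom \<C> S S\<^esub> j \<bullet> ?q =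
      (i \<bullet> p \<ominus>\<^bsub>Hom \<C> S S\<^esub> j \<bullet> (f \<bullet> p)) \<oplus>\<^bsub>Hom \<C> S S\<^esub> (j \<bullet> (f \<bullet> p) \<oplus>\<^bsub>Hom \<C> S S\<^esub> j \<bullet> q)"
      unfolding minus_left[OF bd(3,1) jf] add_right[OF bd(2) fp bd(4)] assoc[OF bd(2) f bd(3)] ..
    also have "\<dots> = i \<bullet> p \<oplus>\<^bsub>Hom \<C> S S\<^esub> j \<bullet> q"
      using arr_add_assoc[OF arr_minus[OF ip jfp] jfp jq] minus_add[OF ip jfp] by simp
    finally show "(i \<ominus>\<^bsub>Hom \<C> X S\<^esub> j \<bullet> f) \<bullet> p \<oplus>\<^bsub>Hom \<C> S S\<^esub> j \<bullet> ?q = Id \<C> S" using bd(9) by simp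
  qed (use q bd in auto)
qed

text \<open>This is the direct sum of \<open>0 \<rightarrow> X = X\<close> with the given
  conflation, where \<open>N\<close> itself serves as the sum of a zero object and \<open>N\<close>.
  As the first summand splits, the class of the sum is \<delta> pulled back along the projection
  \<open>q'\<close>.\<close>

lemma conflation_add_split:
  assumes c: "conflation \<C> N x P y C \<delta>" and X: "X \<in> Obj \<C>"
    and bP: "is_biproduct \<C> X P S i j p q" and bC: "is_biproduct \<C> X C S' i' j' p' q'"
  obtains a \<epsilon> where
    "conflation \<C> N a S (i' \<bullet> p \<oplus>\<^bsub>Hom \<C> S S'\<^esub> j' \<bullet> (y \<bullet> q)) S' \<epsilon>"
proof -
  obtain Z where Z: "is_zero_object \<C> Z" "Z \<in> Obj \<C>" by (rule zero_object)
  note O = conflation_Obj[OF c] and cd = conflationD[OF c]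
    and bPd = biproductD[OF bP] and bCd = biproductD[OF bC]
  note c0 = conflation_id_right[OF Z(1) X]
  have S: "S \<in> Obj \<C>" "S' \<in> Obj \<C>" using bPd(1) bCd(1) by (simp_all add: arr_def)
  define \<epsilon> where "\<epsilon> = pull \<C> q' \<delta>"
  have e: "\<epsilon> \<in> exts \<C> S' N" unfolding \<epsilon>_def using exts_pull[OF bCd(4) cd(1)] .
  have ei: "pull \<C> i' \<epsilon> = \<zero>\<^bsub>Ext \<C> X N\<^esub>" "pull \<C> j' \<epsilon> = \<delta>"
    unfolding \<epsilon>_def ext_pull_comp[OF bCd(4,1) cd(1), symmetric]
      ext_pull_comp[OF bCd(4,2) cd(1), symmetric] bCd(6,7)
    using pull_zero_arr[OF cd(1) X] ext_pull_id[OF cd(1)] by simp_all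
  note z = exts_zero[OF X O(1)]
  have "(i \<bullet> zm Z X \<bullet> zm N Z \<oplus>\<^bsub>Hom \<C> N S\<^esub> j \<bullet> x \<bullet> Id \<C> N, S,
      i' \<bullet> Id \<C> X \<bullet> p \<oplus>\<^bsub>Hom \<C> S S'\<^esub> j' \<bullet> y \<bullet> q) \<in> realise \<C> S' N \<epsilon>"
  proof (rule real_sum[OF _ _ _ _ biproduct_zero_left[OF Z(1) O(1)] bP bC])
    show "(zm Z X, X, Id \<C> X) \<in> realise \<C> X Z \<zero>\<^bsub>Ext \<C> X Z\<^esub>" "(x, P, y) \<in> realise \<C> C N \<delta>"
      using c0 c by (simp_all add: conflation_def)
    show "\<zero>\<^bsub>Ext \<C> X Z\<^esub> \<in> carrier (Ext \<C> X Z)" "\<delta> \<in> carrier (Ext \<C> C N)" "\<epsilon> \<in> carrier (Ext \<C> S' N)"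
      using exts_zero[OF X Z(2)] cd(1) e by (simp_all add: exts_def)
    show "push \<C> (zm N Z) (pull \<C> i' \<epsilon>) = \<zero>\<^bsub>Ext \<C> X Z\<^esub>"
      unfolding ei by (rule push_zero_arr[OF z Z(2)])
    show "push \<C> (zm N Z) (pull \<C> j' \<epsilon>) = \<zero>\<^bsub>Ext \<C> C Z\<^esub>"
      unfolding ei by (rule push_zero_arr[OF cd(1) Z(2)])
    show "push \<C> (Id \<C> N) (pull \<C> i' \<epsilon>) = \<zero>\<^bsub>Ext \<C> X N\<^esub>"
      unfolding ei by (rule ext_push_id[OF z])
    show "push \<C> (Id \<C> N) (pull \<C> j' \<epsilon>) = \<delta>"
      unfolding ei by (rule ext_push_id[OF cd(1)])
  qed
  then have "conflation \<C> N (i \<bullet> zm Z X \<bullet> zm N Z \<oplus>\<^bsub>Hom \<C> N S\<^esub> j \<bullet> x \<bullet> Id \<C> N) S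
      (i' \<bullet> p \<oplus>\<^bsub>Hom \<C> S S'\<^esub> j' \<bullet> (y \<bullet> q)) S' \<epsilon>"
    unfolding id_right[OF bCd(1)] assoc[OF bCd(2) cd(3) bPd(4)] using e by (simp add: conflation_def)
  then show ?thesis by (rule that)
qed

text \<open>A deflation stays one after adding a column: \<open>[f, y]\<close> is \<open>1 \<oplus> y\<close> followed by the split
  deflation \<open>[f, 1]\<close>.\<close>

lemma deflation_add_column:
  assumes c: "conflation \<C> N x P y C \<delta>" and f: "f \<in> arr \<C> X C"
  obtains S i j p q N' x' d \<delta>' where "is_biproduct \<C> X P S i j p q"
    "conflation \<C> N' x' S d C \<delta>'" "d \<bullet> i = f" "d \<bullet> j = y"
proof -
  note O = conflation_Obj[OF c] and cd = conflationD[OF c]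
  have X: "X \<in> Obj \<C>" using f by (simp add: arr_def)
  obtain S i j p q where bP: "is_biproduct \<C> X P S i j p q" using biproduct_exists[OF X O(2)] by blast
  obtain S' i' j' p' q' where bC: "is_biproduct \<C> X C S' i' j' p' q'"
    using biproduct_exists[OF X O(3)] by blast
  note bPd = biproductD[OF bP] and bCd = biproductD[OF bC]
  let ?D = "i' \<bullet> p \<oplus>\<^bsub>Hom \<C> S S'\<^esub> j' \<bullet> (y \<bullet> q)" and ?q = "f \<bullet> p' \<oplus>\<^bsub>Hom \<C> S' C\<^esub> q'"
  obtain a \<epsilon> where 1: "conflation \<C> N a S ?D S' \<epsilon>" using conflation_add_split[OF c X bP bC] .
  note sh = biproduct_shear[OF bC f]
  note 2 = conflation_split[OF sh]
  \<comment> \<open>By the dual of ET4 a composite of two deflations is again one, with some kernel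
    \<open>E\<close>.\<close>
  obtain E d e h' \<delta>'' where 3: "conflation \<C> E h' S (?q \<bullet> ?D) C \<delta>''"
    using extriangulated.conflation_ET4[OF op_extriangulated, unfolded op_simps, OF 2 1] .
  have jy: "j' \<bullet> y \<in> arr \<C> P S'" using arr_comp bCd(2) cd(3) by blast
  have D: "?D \<in> arr \<C> S S'" "?D \<bullet> i = i'" "?D \<bullet> j = j' \<bullet> y"
    using biproduct_corner[OF bP bCd(1) jy] unfolding assoc[OF bCd(2) cd(3) bPd(4)] .
  have q: "?q \<in> arr \<C> S' C" "?q \<bullet> i' = f" "?q \<bullet> j' = Id \<C> C"
    using biproduct_corner[OF bC f arr_id[OF O(3)]] unfolding id_left[OF bCd(4)] .
  have "?q \<bullet> ?D \<bullet> i = f" using assoc[OF q(1) D(1) bPd(1)] D(2) q(2) by simp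
  moreover have "?q \<bullet> ?D \<bullet> j = y"
    using assoc[OF q(1) D(1) bPd(2)] D(3) assoc[OF q(1) bCd(2) cd(3)] q(3) id_left[OF cd(3)] by simp
  ultimately show ?thesis by (rule that[OF bP 3])
qed

end

section \<open>Extension-closed subcategories\<close>

lemma full_sub_simps [simp]:
  "Obj (full_sub \<C> \<D>) = \<D>" "Hom (full_sub \<C> \<D>) = Hom \<C>" "Comp (full_sub \<C> \<D>) = Comp \<C>"
  "Id (full_sub \<C> \<D>) = Id \<C>" "Ext (full_sub \<C> \<D>) = Ext \<C>" "push (full_sub \<C> \<D>) = push \<C>"
  "pull (full_sub \<C> \<D>) = pull \<C>"
  "(x, B, y) \<in> realise (full_sub \<C> \<D>) C A \<delta> \<longleftrightarrow> (x, B, y) \<in> realise \<C> C A \<delta> \<and> B \<in> \<D>"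
  by (simp_all add: full_sub_def)

lemma full_sub_notions:
  assumes "\<D> \<subseteq> Obj \<C>"
  shows "arr (full_sub \<C> \<D>) A B = (if A \<in> \<D> \<and> B \<in> \<D> then arr \<C> A B else {})"
    "exts (full_sub \<C> \<D>) C A = (if C \<in> \<D> \<and> A \<in> \<D> then exts \<C> C A else {})"
    "conflation (full_sub \<C> \<D>) A x B y C \<delta> \<longleftrightarrow>
       conflation \<C> A x B y C \<delta> \<and> A \<in> \<D> \<and> B \<in> \<D> \<and> C \<in> \<D>"
    "ext_vanish (full_sub \<C> \<D>) C A \<longleftrightarrow> ext_vanish \<C> C A \<and> C \<in> \<D> \<and> A \<in> \<D>"
    "is_biproduct (full_sub \<C> \<D>) A B S i j p q \<longleftrightarrow>
       is_biproduct \<C> A B S i j p q \<and> A \<in> \<D> \<and> B \<in> \<D> \<and> S \<in> \<D>"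
    "is_iso (full_sub \<C> \<D>) A B f \<longleftrightarrow> is_iso \<C> A B f"
  using assms by (auto simp: arr_def exts_def conflation_def ext_vanish_def is_biproduct_def is_iso_def)

lemma full_sub_perps:
  "right_perp (full_sub \<C> \<D>) \<X> = {Y \<in> \<D>. \<forall>X \<in> \<X>. carrier (Ext \<C> X Y) = {\<zero>\<^bsub>Ext \<C> X Y\<^esub>}}"
  "left_perp (full_sub \<C> \<D>) \<X> = {Y \<in> \<D>. \<forall>X \<in> \<X>. carrier (Ext \<C> Y X) = {\<zero>\<^bsub>Ext \<C> Y X\<^esub>}}"
  by (simp_all add: right_perp_def left_perp_def)

lemma op_full_sub: "op_cat (full_sub \<C> \<D>) = full_sub (op_cat \<C>) \<D>"
  by (simp add: op_cat_def full_sub_def)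

lemma full_sub_zero_object:
  assumes "\<D> \<subseteq> Obj \<C>" "is_zero_object \<C> Z" "Z \<in> \<D>"
  shows "is_zero_object (full_sub \<C> \<D>) Z"
proof (unfold is_zero_object_def full_sub_simps, rule conjI[OF assms(3)], rule ballI)
  fix A assume "A \<in> \<D>"
  show "(\<exists>!f. f \<in> mor \<C> Z A) \<and> (\<exists>!f. f \<in> mor \<C> A Z)"
    by (rule bspec[OF conjunct2[OF assms(2)[unfolded is_zero_object_def]]
          subsetD[OF assms(1) \<open>A \<in> \<D>\<close>]])
qed

lemma (in extriangulated) full_sub_seq_class:
  assumes "\<D> \<subseteq> Obj \<C>"
  shows "(x', B', y') \<in> seq_class (full_sub \<C> \<D>) A C t \<longleftrightarrow> (x', B', y') \<in> seq_class \<C> A C t \<and> B' \<in> \<D>"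
  using assms by (cases t) (auto simp: seq_class_def full_sub_notions[OF assms])

text \<open>Further closure properties follow: biproducts are middle terms of split conflations, and
  an object isomorphic to \<open>A\<close> is a biproduct of \<open>A\<close> and a zero
  object.\<close>

locale extension_closed = extriangulated K \<C>
  for K :: "('k, 'r) ring_scheme" (structure) and \<C> :: "('k, 'o, 'm, 'e) extri_cat" +
  fixes \<D>
  assumes sub_Obj: "\<D> \<subseteq> Obj \<C>"
    and sub_zero: "is_zero_object \<C> Z \<Longrightarrow> Z \<in> \<D>"
    and sub_ext: "\<lbrakk>conflation \<C> A x B y C \<delta>; A \<in> \<D>; C \<in> \<D>\<rbrakk> \<Longrightarrow> B \<in> \<D>"
begin

lemma op_extension_closed: "extension_closed K (op_cat \<C>) \<D>"
  using op_extriangulated sub_Obj sub_zero sub_ext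
  by (simp add: extension_closed_def extension_closed_axioms_def)

lemma sub_biproduct: "\<lbrakk>is_biproduct \<C> A B S i j p q; A \<in> \<D>; B \<in> \<D>\<rbrakk> \<Longrightarrow> S \<in> \<D>"
  using sub_ext[OF conflation_split] by blast

lemma sub_additive: "additive_category K (full_sub \<C> \<D>)"
proof (intro additive_category.intro linear_category.intro linear_category_axioms.intro
    additive_category_axioms.intro field_axioms, unfold full_sub_simps, goal_cases)
  case (1 A B) then show ?case using hom_vectorspace sub_Obj by blast
next
  case (2 A B A' B' f) show ?case by (rule hom_disjoint[of _ _ _ _ f]) (use 2 sub_Obj in auto)
next
  case (3 A) then show ?case using id_mor sub_Obj by blast
next
  case (4 A B C g) show ?case by (rule comp_linear_right) (use 4 sub_Obj in auto)
next
  case (5 A B C f) show ?case by (rule comp_linear_left) (use 5 sub_Obj in auto)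
next
  case (6 A B C D f g h) show ?case by (rule comp_assoc[of A B C D]) (use 6 sub_Obj in auto)
next
  case (7 A B f) show ?case by (rule id_comp[of A B]) (use 7 sub_Obj in auto)
next
  case (8 A B f) show ?case by (rule comp_id[of A B]) (use 8 sub_Obj in auto)
next
  case 9
  obtain Z where "is_zero_object \<C> Z" using zero_object_exists by blast
  then show ?case using full_sub_zero_object[OF sub_Obj] sub_zero by blast
next
  case (10 A B)
  then obtain S i j p q where b: "is_biproduct \<C> A B S i j p q"
    using biproduct_exists[of A B] sub_Obj by blast
  then have "is_biproduct (full_sub \<C> \<D>) A B S i j p q"
    using 10 sub_biproduct[OF b] by (simp add: full_sub_notions(5)[OF sub_Obj])
  then show ?case by (intro exI)
qed

lemma sub_real_class:
  assumes "A \<in> \<D>" "C \<in> \<D>" "\<delta> \<in> carrier (Ext \<C> C A)"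
  shows "\<exists>B \<in> \<D>. \<exists>x \<in> mor \<C> A B. \<exists>y \<in> mor \<C> B C.
    realise (full_sub \<C> \<D>) C A \<delta> = seq_class (full_sub \<C> \<D>) A C (x, B, y)"
proof -
  have O: "A \<in> Obj \<C>" "C \<in> Obj \<C>" using assms sub_Obj by auto
  obtain x B y where *: "B \<in> Obj \<C>" "x \<in> mor \<C> A B" "y \<in> mor \<C> B C"
    "realise \<C> C A \<delta> = seq_class \<C> A C (x, B, y)"
    using real_class[OF O assms(3)] by blast
  have "(x, B, y) \<in> realise \<C> C A \<delta>"
    using seq_class_refl[of x A B y C] * O by (simp add: arr_def)
  then have "conflation \<C> A x B y C \<delta>" using O assms(3) by (simp add: conflation_def exts_def)
  then have B: "B \<in> \<D>" using sub_ext assms(1,2) by blast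
  have "realise (full_sub \<C> \<D>) C A \<delta> = seq_class (full_sub \<C> \<D>) A C (x, B, y)"
  proof (rule Set.set_eqI)
    fix t :: "'m \<times> 'o \<times> 'm"
    obtain x' B' y' where t: "t = (x', B', y')" by (cases t)
    show "t \<in> realise (full_sub \<C> \<D>) C A \<delta> \<longleftrightarrow> t \<in> seq_class (full_sub \<C> \<D>) A C (x, B, y)"
      unfolding t full_sub_simps full_sub_seq_class[OF sub_Obj] *(4) ..
  qed
  then show ?thesis using B *(2,3) by blast
qed

text \<open>The one object that ET4 creates is \<open>E\<close>. It is the middle term of a
  conflation from \<open>D\<close> to \<open>F\<close>, so extension-closure places it in
  \<D>.\<close>

lemma sub_ET4:
  assumes "A \<in> \<D>" "B \<in> \<D>" "C \<in> \<D>" "D \<in> \<D>" "F \<in> \<D>"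
    "\<delta> \<in> carrier (Ext \<C> D A)" "\<delta>' \<in> carrier (Ext \<C> F B)"
    "(f, B, f') \<in> realise \<C> D A \<delta>" "(g, C, g') \<in> realise \<C> F B \<delta>'"
  shows "\<exists>E \<in> \<D>. \<exists>d \<in> mor \<C> D E. \<exists>e \<in> mor \<C> E F. \<exists>h' \<in> mor \<C> C E. \<exists>\<delta>'' \<in> carrier (Ext \<C> E A).
      ((g \<bullet> f, C, h') \<in> realise \<C> E A \<delta>'' \<and> C \<in> \<D>) \<and> h' \<bullet> g = d \<bullet> f' \<and> e \<bullet> h' = g' \<and>
      ((d, E, e) \<in> realise \<C> F D (push \<C> f' \<delta>') \<and> E \<in> \<D>) \<and>
      pull \<C> d \<delta>'' = \<delta> \<and> push \<C> f \<delta>'' = pull \<C> e \<delta>'"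
proof -
  have c: "conflation \<C> A f B f' D \<delta>" "conflation \<C> B g C g' F \<delta>'"
    using assms sub_Obj by (auto simp: conflation_def exts_def)
  obtain E d e h' \<delta>'' where 1: "conflation \<C> A (g \<bullet> f) C h' E \<delta>''"
    "conflation \<C> D d E e F (push \<C> f' \<delta>')" "h' \<bullet> g = d \<bullet> f'" "e \<bullet> h' = g'"
    "pull \<C> d \<delta>'' = \<delta>" "push \<C> f \<delta>'' = pull \<C> e \<delta>'"
    using conflation_ET4[OF c] .
  have "E \<in> \<D>" by (rule sub_ext[OF 1(2) assms(4,5)])
  moreover have "d \<in> mor \<C> D E" "e \<in> mor \<C> E F" "h' \<in> mor \<C> C E"
    using arrD(3)[OF conflationD(2)[OF 1(2)]] arrD(3)[OF conflationD(3)[OF 1(2)]]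
      arrD(3)[OF conflationD(3)[OF 1(1)]] .
  moreover have "\<delta>'' \<in> carrier (Ext \<C> E A)" using extsD(3)[OF conflationD(1)[OF 1(1)]] .
  moreover have "(g \<bullet> f, C, h') \<in> realise \<C> E A \<delta>''" "(d, E, e) \<in> realise \<C> F D (push \<C> f' \<delta>')"
    using 1(1,2) by (simp_all add: conflation_def)
  ultimately show ?thesis using 1(3-6) assms(3)
    by - (rule bexI[of _ E], rule bexI[of _ d], rule bexI[of _ e], rule bexI[of _ h'],
      rule bexI[of _ \<delta>''], intro conjI)
qed

lemma sub_extriangulated: "extriangulated K (full_sub \<C> \<D>)"
proof (intro extriangulated.intro extriangulated_axioms.intro sub_additive,
    unfold full_sub_simps full_sub_notions(5)[OF sub_Obj], goal_cases)
  case (1 A C) then show ?case using ext_vectorspace sub_Obj by blast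
next
  case (2 A A' C a) show ?case by (rule push_linear) (use 2 sub_Obj in auto)
next
  case (3 A C C' c) show ?case by (rule pull_linear) (use 3 sub_Obj in auto)
next
  case (4 A A' C \<delta>) show ?case by (rule push_linear_mor) (use 4 sub_Obj in auto)
next
  case (5 A C C' \<delta>) show ?case by (rule pull_linear_mor) (use 5 sub_Obj in auto)
next
  case (6 A C \<delta>) show ?case by (rule push_id[of A C]) (use 6 sub_Obj in auto)
next
  case (7 A C \<delta>) show ?case by (rule pull_id[of A C]) (use 7 sub_Obj in auto)
next
  case (8 A A' A'' C a a' \<delta>) show ?case by (rule push_comp[of A A' A'' C]) (use 8 sub_Obj in auto)
next
  case (9 A C C' C'' c c' \<delta>) show ?case by (rule pull_comp[of A C C' C'']) (use 9 sub_Obj in auto)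
next
  case (10 A A' C C' a c \<delta>) show ?case by (rule push_pull[of A A' C C']) (use 10 sub_Obj in auto)
next
  case (11 A C \<delta>) then show ?case by (rule sub_real_class)
next
  case (12 A C A' C' \<delta> \<delta>' x B y x' B' y' a c)
  show ?case by (rule real_lift[of A C A' C' \<delta> \<delta>']) (use 12 sub_Obj in auto)
next
  case (13 A C S i j p q) then show ?case using real_split by blast
next
  case (14 \<delta> C A \<delta>' C' A' x B y x' B' y' SA iA jA pA qA SB iB jB pB qB SC iC jC pC qC \<epsilon>)
  show ?case
    by (intro conjI real_sum[of \<delta> C A \<delta>' C' A' x B y x' B' y' SA iA jA pA qA SB iB jB pB qB SC iC jC pC qC \<epsilon>])
      (use 14 in blast)+
next
  case (15 A C A' C' \<delta> \<delta>' x B y x' B' y' a b)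
  show ?case by (rule ET3[of A C A' C' \<delta> \<delta>' x B y x' B' y' a b]) (use 15 sub_Obj in auto)
next
  case (16 A C A' C' \<delta> \<delta>' x B y x' B' y' b c)
  show ?case by (rule ET3_op[of A C A' C' \<delta> \<delta>' x B y x' B' y' b c]) (use 16 sub_Obj in auto)
next
  case (17 A B C D F \<delta> \<delta>' f f' g g')
  then show ?case by (intro sub_ET4) blast+
next
  case (18 A B C D F \<delta> \<delta>' f' f g' g)
  obtain E d e h' \<delta>'' where "E \<in> \<D>" "d \<in> mor \<C> E F" "e \<in> mor \<C> D E" "h' \<in> mor \<C> E A"
    "\<delta>'' \<in> carrier (Ext \<C> C E)" "(h', A, g \<bullet> f) \<in> realise \<C> C E \<delta>''" "A \<in> \<D>"
    "f \<bullet> h' = g' \<bullet> d" "h' \<bullet> e = f'" "(e, E, d) \<in> realise \<C> F D (pull \<C> g' \<delta>)"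
    "push \<C> d \<delta>'' = \<delta>'" "pull \<C> g \<delta>'' = push \<C> e \<delta>"
    using extension_closed.sub_ET4[OF op_extension_closed, unfolded op_simps, of C B A F D \<delta>' \<delta> g' g f' f] 18
    by blast
  then show ?case
    by - (rule bexI[of _ E], rule bexI[of _ e], rule bexI[of _ d], rule bexI[of _ h'],
      rule bexI[of _ \<delta>''], intro conjI; (assumption | erule sym))
qed

end

section \<open>The perpendicular category of a rigid subcategory\<close>

lemma full_sub_approx [simp]:
  "is_left_approx (full_sub \<C> \<D>) \<T> A T f \<longleftrightarrow> is_left_approx \<C> \<T> A T f"
  "is_right_approx (full_sub \<C> \<D>) \<T> A T f \<longleftrightarrow> is_right_approx \<C> \<T> A T f"
  by (simp_all add: is_left_approx_def is_right_approx_def)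

context extriangulated
begin

text \<open>In the exact sequence \<open>Hom W S \<rightarrow> Hom W Y \<rightarrow> Ext W N
  \<rightarrow> Ext W S\<close> the last space is zero and the first map is onto, so the connecting
  map is both onto and zero. In this way approximations force kernels into a perpendicular
  category.\<close>

lemma ext_vanish_kernel:
  assumes c: "conflation \<C> N x S d Y \<delta>" and v: "ext_vanish \<C> W S"
    and lift: "\<And>f. f \<in> arr \<C> W Y \<Longrightarrow> \<exists>g \<in> arr \<C> W S. d \<bullet> g = f"
  shows "ext_vanish \<C> W N"
proof (rule ext_vanishI)
  show W: "W \<in> Obj \<C>" "N \<in> Obj \<C>"
    using v conflation_Obj[OF c] by (simp_all add: ext_vanish_def)
  note cd = conflationD[OF c]
  fix \<eta> assume e: "\<eta> \<in> exts \<C> W N"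
  have "push \<C> x \<eta> = \<zero>\<^bsub>Ext \<C> W S\<^esub>" by (rule ext_vanishD[OF v exts_push[OF cd(2) e]])
  then obtain f where f: "f \<in> arr \<C> W Y" "\<eta> = pull \<C> f \<delta>" by (rule conflation_ext_pull[OF c e])
  obtain g where g: "g \<in> arr \<C> W S" "d \<bullet> g = f" using lift[OF f(1)] by blast
  have "\<eta> = pull \<C> g (pull \<C> d \<delta>)" using f(2) ext_pull_comp[OF cd(3) g(1) cd(1)] g(2) by simp
  also have "\<dots> = \<zero>\<^bsub>Ext \<C> W N\<^esub>"
    unfolding conflation_comp_zero(2)[OF c] by (rule pull_zero[OF g(1) W(2)])
  finally show "\<eta> = \<zero>\<^bsub>Ext \<C> W N\<^esub>" .
qed

lemma right_approx_lift:
  assumes "is_right_approx \<C> \<X> A X f" "X' \<in> \<X>" "g \<in> arr \<C> X' A" "\<X> \<subseteq> Obj \<C>"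
  obtains h where "h \<in> arr \<C> X' X" "f \<bullet> h = g"
proof -
  have "\<exists>h \<in> mor \<C> X' X. f \<bullet> h = g"
    using assms(1-3) arrD(3)[OF assms(3)] unfolding is_right_approx_def by blast
  then obtain h where h: "h \<in> mor \<C> X' X" "f \<bullet> h = g" by blast
  have "X \<in> Obj \<C>" using assms(1,4) unfolding is_right_approx_def by blast
  then have "h \<in> arr \<C> X' X" using arrI[OF _ _ h(1)] arrD(1)[OF assms(3)] by blast
  then show ?thesis using h(2) by (rule that)
qed

text \<open>The ambient kernel of a retraction \<open>r\<close> with section \<open>s\<close> is a
  retract of the source \<open>A\<close>, because the idempotent \<open>1 - s r\<close> factors
  through it. Closure under retracts then keeps the kernel inside \<D>.\<close>

lemma weakly_idempotent_complete_sub: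
  assumes wic: "weakly_idempotent_complete \<C>" and sub: "\<D> \<subseteq> Obj \<C>"
    and retract: "\<And>A S i p. \<lbrakk>i \<in> arr \<C> A S; p \<in> arr \<C> S A; p \<bullet> i = Id \<C> A; S \<in> \<D>\<rbrakk> \<Longrightarrow> A \<in> \<D>"
  shows "weakly_idempotent_complete (full_sub \<C> \<D>)"
  unfolding weakly_idempotent_complete_def full_sub_simps
proof (intro ballI impI)
  fix A B r assume D: "A \<in> \<D>" "B \<in> \<D>" and r: "r \<in> mor \<C> A B" and "\<exists>s \<in> mor \<C> B A. r \<bullet> s = Id \<C> B"
  then obtain s where s: "s \<in> mor \<C> B A" "r \<bullet> s = Id \<C> B" by blast
  have O: "A \<in> Obj \<C>" "B \<in> Obj \<C>" using D sub by auto
  obtain N k where k: "is_kernel \<C> A B r N k"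
    using wic O r s unfolding weakly_idempotent_complete_def by blast
  then have N: "N \<in> Obj \<C>" "k \<in> mor \<C> N A" "r \<bullet> k = zm N B" by (simp_all add: is_kernel_def)
  have univ: "\<exists>!g. g \<in> mor \<C> M N \<and> k \<bullet> g = f"
    if "M \<in> Obj \<C>" "f \<in> mor \<C> M A" "r \<bullet> f = zm M B" for M f
    using k that unfolding is_kernel_def by blast
  have ar: "r \<in> arr \<C> A B" "s \<in> arr \<C> B A" "k \<in> arr \<C> N A" using O N r s by (simp_all add: arr_def)
  note sr = arr_comp[OF ar(2,1)] and idA = arr_id[OF O(1)]
  define e where "e = Id \<C> A \<ominus>\<^bsub>Hom \<C> A A\<^esub> s \<bullet> r"
  have e: "e \<in> arr \<C> A A" unfolding e_def by (rule arr_minus[OF idA sr])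
  have "r \<bullet> e = zm A B"
    unfolding e_def minus_right[OF ar(1) idA sr] assoc[OF ar(1,2,1), symmetric] s(2)
      id_left[OF ar(1)] id_right[OF ar(1)] using minus_zero_iff[OF ar(1,1)] by simp
  then obtain g where g: "g \<in> mor \<C> A N" "k \<bullet> g = e" using univ[OF O(1) arrD(3)[OF e]] by blast
  have ga: "g \<in> arr \<C> A N" using g O N by (simp add: arr_def)
  have ek: "e \<bullet> k = k"
    unfolding e_def minus_left[OF ar(3) idA sr] assoc[OF ar(2,1,3)] N(3) zero_right[OF ar(2) N(1)]
      id_left[OF ar(3)] by (rule minus_zm[OF ar(3)])
  \<comment> \<open>Both \<open>g k\<close> and the identity of \<open>N\<close> are factorisations
    of \<open>k\<close> through \<open>k\<close>; the universal property admits only one.\<close>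
  have "k \<bullet> (g \<bullet> k) = k" unfolding assoc[OF ar(3) ga ar(3), symmetric] g(2) ek ..
  moreover have "k \<bullet> Id \<C> N = k" by (rule id_right[OF ar(3)])
  moreover have "g \<bullet> k \<in> mor \<C> N N" "Id \<C> N \<in> mor \<C> N N"
    using arrD(3)[OF arr_comp[OF ga ar(3)]] id_mor[OF N(1)] .
  ultimately have "g \<bullet> k = Id \<C> N" using univ[OF N] by blast
  then have ND: "N \<in> \<D>" by (rule retract[OF ar(3) ga _ D(1)])
  have "is_kernel (full_sub \<C> \<D>) A B r N k"
    unfolding is_kernel_def full_sub_simps using ND N univ sub by blast
  then show "\<exists>N k. is_kernel (full_sub \<C> \<D>) A B r N k" by blast
qed

end

text \<open>The Calabi-Yau property is represented by the symmetry \<open>ext_sym\<close> of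
  vanishing. All assumptions are self-dual, so the opposite category is again an instance and dual
  statements are obtained from it.\<close>

locale rigid_frobenius = extriangulated K \<C>
  for K :: "('k, 'r) ring_scheme" (structure) and \<C> :: "('k, 'o, 'm, 'e) extri_cat" +
  fixes \<X>
  assumes X_Obj: "\<X> \<subseteq> Obj \<C>"
    and X_rigid: "\<lbrakk>X \<in> \<X>; X' \<in> \<X>\<rbrakk> \<Longrightarrow> ext_vanish \<C> X X'"
    and X_finite: "functorially_finite \<C> \<X>"
    and frobenius: "frobenius \<C>"
    and ext_sym: "ext_vanish \<C> A B \<Longrightarrow> ext_vanish \<C> B A"
begin

abbreviation perp where "perp \<equiv> right_perp \<C> \<X>"

lemma op_rigid_frobenius: "rigid_frobenius K (op_cat \<C>) \<X>"
  using op_extriangulated X_Obj X_rigid X_finite frobenius ext_sym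
  by (simp add: rigid_frobenius_def rigid_frobenius_axioms_def)

lemma perp_iff: "Y \<in> perp \<longleftrightarrow> Y \<in> Obj \<C> \<and> (\<forall>X \<in> \<X>. ext_vanish \<C> X Y)"
  by (rule right_perp_iff[OF X_Obj])

lemma left_perp_eq: "left_perp \<C> \<X> = perp"
  using perp_iff left_perp_iff[OF X_Obj] ext_sym by blast

lemma perp_vanish: "\<lbrakk>Y \<in> perp; X \<in> \<X>\<rbrakk> \<Longrightarrow> ext_vanish \<C> X Y"
  using perp_iff[of Y] by simp

lemma perp_retract:
  assumes "i \<in> arr \<C> A S" "p \<in> arr \<C> S A" "p \<bullet> i = Id \<C> A" "S \<in> perp"
  shows "A \<in> perp"
  unfolding perp_iff
proof (intro conjI ballI)
  show "A \<in> Obj \<C>" using arrD(1)[OF assms(1)] .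
  fix X assume "X \<in> \<X>"
  show "ext_vanish \<C> X A"
    by (rule ext_vanish_retract[OF assms(1-3) perp_vanish[OF assms(4) \<open>X \<in> \<X>\<close>]])
qed

lemma perp_extension_closed: "extension_closed K \<C> perp"
proof (unfold_locales)
  show "perp \<subseteq> Obj \<C>" by (auto simp: right_perp_def)
  fix Z assume Z: "is_zero_object \<C> Z"
  then have "Z \<in> Obj \<C>" by (simp add: is_zero_object_def)
  then show "Z \<in> perp"
    unfolding perp_iff using ext_vanish_zero[OF Z subsetD[OF X_Obj]] by simp
next
  fix A x B y C \<delta>
  assume c: "conflation \<C> A x B y C \<delta>" and "A \<in> perp" "C \<in> perp"
  then show "B \<in> perp"
    unfolding perp_iff[of B] using ext_vanish_middle[OF c perp_vanish perp_vanish] conflation_Obj(2)[OF c]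
    by simp
qed

sublocale perp: extension_closed K \<C> perp
  by (rule perp_extension_closed)

lemma perp_Obj: "A \<in> perp \<Longrightarrow> A \<in> Obj \<C>"
  using perp.sub_Obj by blast

lemma X_perp: "X \<in> \<X> \<Longrightarrow> X \<in> perp"
  unfolding perp_iff using X_rigid subsetD[OF X_Obj] by simp

lemma proj_inj_eq: "proj_inj \<C> = projectives \<C>" "injectives \<C> = projectives \<C>"
proof -
  show "injectives \<C> = projectives \<C>" using frobenius unfolding frobenius_def by simp
  then show "proj_inj \<C> = projectives \<C>" unfolding proj_inj_def by blast
qed

lemma projective_vanish:
  assumes "P \<in> projectives \<C>" "A \<in> Obj \<C>"
  shows "ext_vanish \<C> P A" "ext_vanish \<C> A P"
proof -
  show "ext_vanish \<C> P A" using assms(1)[unfolded projectives_iff] assms(2) by blast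
  then show "ext_vanish \<C> A P" by (rule ext_sym)
qed

lemma enough_projectives:
  assumes "A \<in> Obj \<C>"
  obtains N x P y \<delta> where "conflation \<C> N x P y A \<delta>" "P \<in> projectives \<C>"
proof -
  have "\<exists>P \<in> projectives \<C>. \<exists>y. is_deflation \<C> P A y"
    using frobenius assms unfolding frobenius_def by blast
  then show ?thesis unfolding is_deflation_iff using that by (elim bexE exE)
qed

lemma enough_injectives:
  assumes "A \<in> Obj \<C>"
  obtains x I y N \<delta> where "conflation \<C> A x I y N \<delta>" "I \<in> projectives \<C>"
proof -
  have "\<exists>I \<in> injectives \<C>. \<exists>x. is_inflation \<C> A I x"
    using frobenius assms unfolding frobenius_def by blast
  then show ?thesis unfolding is_inflation_iff proj_inj_eq(2) using that by (elim bexE exE)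
qed

lemma projective_perp: "P \<in> projectives \<C> \<Longrightarrow> P \<in> perp"
  unfolding perp_iff using projective_vanish(2) subsetD[OF X_Obj] by (simp add: projectives_iff)

text \<open>These are the projectives of \<open>perp\<close> in the form given by
  \<open>projectives_iff\<close>. By \<open>ext_sym\<close> the set is its own dual, so it describes
  the injectives as well.\<close>

definition core :: "'o set" where
  "core = {Q \<in> perp. \<forall>Y \<in> perp. ext_vanish \<C> Q Y}"

lemma op_core [simp]: "rigid_frobenius.core (op_cat \<C>) \<X> = core"
  unfolding core_def rigid_frobenius.core_def[OF op_rigid_frobenius]
  using ext_sym by (auto simp: left_perp_eq)

lemma X_core: "X \<in> \<X> \<Longrightarrow> X \<in> core"
  unfolding core_def using X_perp perp_vanish by simp

lemma projective_core: "P \<in> projectives \<C> \<Longrightarrow> P \<in> core"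
  unfolding core_def using projective_perp projective_vanish(1) perp_Obj by simp

lemma core_biproduct:
  assumes "is_biproduct \<C> A B S i j p q" "A \<in> core" "B \<in> core"
  shows "S \<in> core"
  unfolding core_def mem_Collect_eq
proof (intro conjI ballI)
  show "S \<in> perp" using perp.sub_biproduct[OF assms(1)] assms(2,3) unfolding core_def by simp
  fix Y assume "Y \<in> perp"
  then have "ext_vanish \<C> A Y" "ext_vanish \<C> B Y" using assms(2,3) unfolding core_def by simp_all
  then show "ext_vanish \<C> S Y" by (rule ext_vanish_middle_op[OF conflation_split[OF assms(1)], rotated])
qed

lemma core_retract:
  assumes "i \<in> arr \<C> A S" "p \<in> arr \<C> S A" "p \<bullet> i = Id \<C> A" "S \<in> core"
  shows "A \<in> core"
  unfolding core_def mem_Collect_eq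
proof (intro conjI ballI)
  show "A \<in> perp" using perp_retract[OF assms(1-3)] assms(4) unfolding core_def by simp
  fix Y assume "Y \<in> perp"
  then have "ext_vanish \<C> S Y" using assms(4) unfolding core_def by simp
  then show "ext_vanish \<C> A Y" by (rule ext_vanish_retract_op[OF assms(2,1,3)])
qed

text \<open>The two summands have separate tasks: \<open>P\<close> makes \<open>d\<close> a
  deflation, while \<open>X\<close> makes every map from \<X> to \<open>Y\<close> lift along
  \<open>d\<close>, so that \<open>ext_vanish_kernel\<close> places \<open>N\<close> in
  \<open>perp\<close>.\<close>

lemma perp_deflation:
  assumes Y: "Y \<in> perp"
  obtains X P S i j p q N x d \<delta> where "X \<in> \<X>" "P \<in> projectives \<C>" "is_biproduct \<C> X P S i j p q"
    "conflation \<C> N x S d Y \<delta>" "N \<in> perp"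
proof -
  obtain M z P y \<epsilon> where P: "conflation \<C> M z P y Y \<epsilon>" "P \<in> projectives \<C>"
    using enough_projectives[OF perp_Obj[OF Y]] .
  obtain X f where f: "is_right_approx \<C> \<X> Y X f"
    using X_finite perp_Obj[OF Y] unfolding functorially_finite_def by blast
  have X: "X \<in> \<X>" "f \<in> arr \<C> X Y"
    using f X_Obj perp_Obj[OF Y] by (auto simp: is_right_approx_def arr_def)
  obtain S i j p q N x d \<delta> where 1: "is_biproduct \<C> X P S i j p q"
    "conflation \<C> N x S d Y \<delta>" "d \<bullet> i = f" "d \<bullet> j = y"
    using deflation_add_column[OF P(1) X(2)] .
  note b = biproductD[OF 1(1)] and c = conflationD[OF 1(2)]
  have S: "S \<in> perp" using perp.sub_biproduct[OF 1(1) X_perp[OF X(1)] projective_perp[OF P(2)]] .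
  have "ext_vanish \<C> W N" if W: "W \<in> \<X>" for W
  proof (rule ext_vanish_kernel[OF 1(2)])
    show "ext_vanish \<C> W S" using perp_vanish[OF S W] .
    fix g assume g: "g \<in> arr \<C> W Y"
    obtain h where h: "h \<in> arr \<C> W X" "f \<bullet> h = g" using right_approx_lift[OF f W g X_Obj] .
    have "i \<bullet> h \<in> arr \<C> W S" using arr_comp[OF b(1) h(1)] .
    moreover have "d \<bullet> (i \<bullet> h) = g" using assoc[OF c(3) b(1) h(1)] 1(3) h(2) by simp
    ultimately show "\<exists>k \<in> arr \<C> W S. d \<bullet> k = g" by blast
  qed
  then have "N \<in> perp" unfolding perp_iff using conflation_Obj(1)[OF 1(2)] by simp
  then show ?thesis by (rule that[OF X(1) P(2) 1(1,2)])
qed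

lemma perp_deflation_core:
  assumes "Y \<in> perp"
  obtains N x S d \<delta> where "S \<in> core" "conflation \<C> N x S d Y \<delta>" "N \<in> perp"
proof -
  obtain X P S i j p q N x d \<delta> where 1: "X \<in> \<X>" "P \<in> projectives \<C>" "is_biproduct \<C> X P S i j p q"
    "conflation \<C> N x S d Y \<delta>" "N \<in> perp" using perp_deflation[OF assms] .
  have "S \<in> core" using core_biproduct[OF 1(3) X_core[OF 1(1)] projective_core[OF 1(2)]] .
  then show ?thesis using 1(4,5) by (rule that)
qed

lemma perp_inflation_core:
  assumes "Y \<in> perp"
  obtains x S d N \<delta> where "S \<in> core" "conflation \<C> Y x S d N \<delta>" "N \<in> perp"
  using rigid_frobenius.perp_deflation_core[OF op_rigid_frobenius, unfolded op_simps op_perps op_core left_perp_eq,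
    OF assms] .

lemma add_closure_eq_core: "add_closure \<C> (\<X> \<union> projectives \<C>) = core"
proof (intro equalityI subsetI)
  fix Q assume "Q \<in> add_closure \<C> (\<X> \<union> projectives \<C>)"
  then show "Q \<in> core"
  proof induction
    case (base A)
    then show ?case using X_core projective_core by blast
  next
    case (zero Z)
    \<comment> \<open>A zero object is projective: \<open>ext_vanish_zero\<close> concerns the
      second variable, and \<open>ext_sym\<close> carries it to the first.\<close>
    have "Z \<in> Obj \<C>" using zero by (simp add: is_zero_object_def)
    moreover have "ext_vanish \<C> Z A" if "A \<in> Obj \<C>" for A
      using ext_vanish_zero[OF zero that] by (rule ext_sym)
    ultimately have "Z \<in> projectives \<C>" by (simp add: projectives_iff)
    then show ?case by (rule projective_core)
  next
    case (sum A B S i j p q)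
    show ?case by (rule core_biproduct[OF sum(3) sum.IH])
  next
    case (summand S A B i j p q)
    show ?case by (rule core_retract[OF biproductD(1,3,5)[OF summand(2)] summand.IH])
  qed
next
  fix Q assume Q: "Q \<in> core"
  then have "Q \<in> perp" by (simp add: core_def)
  then obtain X P S i j p q N x d \<delta> where 1: "X \<in> \<X>" "P \<in> projectives \<C>"
    "is_biproduct \<C> X P S i j p q" "conflation \<C> N x S d Q \<delta>" "N \<in> perp" by (rule perp_deflation)
  have S: "S \<in> add_closure \<C> (\<X> \<union> projectives \<C>)"
    by (rule add_closure.sum[OF _ _ 1(3)]; rule add_closure.base) (use 1(1,2) in auto)
  \<comment> \<open>Since \<open>N\<close> lies in \<open>perp\<close> and \<open>Q\<close> in
    \<open>core\<close>, the conflation splits, which makes \<open>Q\<close> a summand of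
    \<open>X \<oplus> P\<close>.\<close>
  have v: "ext_vanish \<C> Q N" using Q 1(5) unfolding core_def by simp
  have "\<delta> = \<zero>\<^bsub>Ext \<C> Q N\<^esub>" by (rule ext_vanishD[OF v conflationD(1)[OF 1(4)]])
  then have "conflation \<C> N x S d Q \<zero>\<^bsub>Ext \<C> Q N\<^esub>" using 1(4) by simp
  then obtain s r where "is_biproduct \<C> Q N S s x d r" by (rule conflation_zero_biproduct)
  with S show "Q \<in> add_closure \<C> (\<X> \<union> projectives \<C>)" by (rule add_closure.summand)
qed

lemma sub_projectives: "projectives (full_sub \<C> perp) = core"
  using extriangulated.projectives_iff[OF perp.sub_extriangulated] perp.sub_Obj
  by (auto simp: core_def full_sub_notions(4)[OF perp.sub_Obj])

lemma sub_injectives: "injectives (full_sub \<C> perp) = core"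
  using rigid_frobenius.sub_projectives[OF op_rigid_frobenius]
  by (simp add: left_perp_eq op_full_sub[symmetric])

lemma sub_frobenius: "frobenius (full_sub \<C> perp)"
  unfolding frobenius_def sub_projectives sub_injectives full_sub_simps is_inflation_iff is_deflation_iff
    full_sub_notions(3)[OF perp.sub_Obj]
proof (intro conjI ballI)
  have core: "Q \<in> perp" if "Q \<in> core" for Q using that by (simp add: core_def)
  fix Y assume Y: "Y \<in> perp"
  show "\<exists>P \<in> core. \<exists>y A x \<delta>. conflation \<C> A x P y Y \<delta> \<and> A \<in> perp \<and> P \<in> perp \<and> Y \<in> perp"
    by (rule perp_deflation_core[OF Y]) (use Y core in blast)
  show "\<exists>I \<in> core. \<exists>x y C \<delta>. conflation \<C> Y x I y C \<delta> \<and> Y \<in> perp \<and> I \<in> perp \<and> C \<in> perp"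
    by (rule perp_inflation_core[OF Y]) (use Y core in blast)
qed (rule refl)

lemma sub_proj_inj: "proj_inj (full_sub \<C> perp) = add_closure \<C> (\<X> \<union> proj_inj \<C>)"
  unfolding proj_inj_eq add_closure_eq_core by (simp add: proj_inj_def sub_projectives sub_injectives)

text \<open>The left approximation of \<open>A\<close> is the extension of some \<open>X\<close> in \<open>\<X>\<close> by \<open>A\<close> that is universal
  among all extensions of objects of \<open>\<X>\<close> by \<open>A\<close>.\<close>

lemma perp_left_approx:
  assumes A: "A \<in> Obj \<C>"
  shows "\<exists>Y f. is_left_approx \<C> perp A Y f"
proof -
  obtain u I v \<Sigma> \<epsilon> where I: "conflation \<C> A u I v \<Sigma> \<epsilon>" "I \<in> projectives \<C>"
    using enough_injectives[OF A] .
  note Ic = conflationD[OF I(1)] and IO = conflation_Obj[OF I(1)]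
  \<comment> \<open>Extensions of objects of \<X> by \<open>A\<close> are pulled back from
    \<epsilon> along maps to \<Sigma>. A right approximation \<open>f\<close> of \<Sigma> captures
    all these maps, so \<open>pull f \<epsilon>\<close> is the universal class.\<close>
  obtain X f where f: "is_right_approx \<C> \<X> \<Sigma> X f"
    using X_finite IO(3) unfolding functorially_finite_def by blast
  have X: "X \<in> \<X>" "f \<in> arr \<C> X \<Sigma>"
    using f X_Obj IO by (auto simp: is_right_approx_def arr_def)
  note d = exts_pull[OF X(2) Ic(1)]
  obtain x Y y where Y: "conflation \<C> A x Y y X (pull \<C> f \<epsilon>)" using conflation_exists[OF d] .
  note Yc = conflationD[OF Y] and YO = conflation_Obj[OF Y]
  have "ext_vanish \<C> W Y" if W: "W \<in> \<X>" for W
  proof (rule ext_vanishI[OF _ YO(2)])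
    show WO: "W \<in> Obj \<C>" using W X_Obj by blast
    fix \<gamma> assume g: "\<gamma> \<in> exts \<C> W Y"
    \<comment> \<open>By rigidity \<gamma> comes from a class \<eta> of extensions by
      \<open>A\<close>. This \<eta> is pulled back from the universal class, which dies under
      \<open>x\<close>.\<close>
    have "push \<C> y \<gamma> = \<zero>\<^bsub>Ext \<C> W X\<^esub>" by (rule ext_vanishD[OF X_rigid[OF W X(1)] exts_push[OF Yc(3) g]])
    then obtain \<eta> where \<eta>: "\<eta> \<in> exts \<C> W A" "\<gamma> = push \<C> x \<eta>" by (rule conflation_ext_middle[OF Y g])
    have "push \<C> u \<eta> = \<zero>\<^bsub>Ext \<C> W I\<^esub>"
      by (rule ext_vanishD[OF projective_vanish(2)[OF I(2) WO] exts_push[OF Ic(2) \<eta>(1)]])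
    then obtain c where c: "c \<in> arr \<C> W \<Sigma>" "\<eta> = pull \<C> c \<epsilon>" by (rule conflation_ext_pull[OF I(1) \<eta>(1)])
    obtain h where h: "h \<in> arr \<C> W X" "f \<bullet> h = c" using right_approx_lift[OF f W c(1) X_Obj] .
    have "\<gamma> = pull \<C> h (push \<C> x (pull \<C> f \<epsilon>))"
      using \<eta>(2) c(2) h(2) ext_pull_comp[OF X(2) h(1) Ic(1)] ext_push_pull[OF Yc(2) h(1) d] by simp
    also have "\<dots> = \<zero>\<^bsub>Ext \<C> W Y\<^esub>"
      unfolding conflation_comp_zero(3)[OF Y] by (rule pull_zero[OF h(1) YO(2)])
    finally show "\<gamma> = \<zero>\<^bsub>Ext \<C> W Y\<^esub>" .
  qed
  then have "Y \<in> perp" unfolding perp_iff using YO(2) by simp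
  \<comment> \<open>The obstruction to extending \<open>g\<close> along \<open>x\<close> is a class
    in \<open>Ext X Y'\<close>, which is zero.\<close>
  moreover have "\<exists>h \<in> mor \<C> Y Y'. h \<bullet> x = g" if Y': "Y' \<in> perp" and g: "g \<in> mor \<C> A Y'" for Y' g
  proof -
    have ga: "g \<in> arr \<C> A Y'" using g A perp_Obj[OF Y'] by (simp add: arr_def)
    have v: "ext_vanish \<C> X Y'" by (rule perp_vanish[OF Y' X(1)])
    have "push \<C> g (pull \<C> f \<epsilon>) = \<zero>\<^bsub>Ext \<C> X Y'\<^esub>" by (rule ext_vanishD[OF v exts_push[OF ga d]])
    then obtain h where h: "h \<in> arr \<C> Y Y'" "h \<bullet> x = g" by (rule conflation_extend[OF Y ga])
    show ?thesis using arrD(3)[OF h(1)] h(2) by (rule bexI[rotated])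
  qed
  ultimately have "is_left_approx \<C> perp A Y x"
    using arrD(3)[OF Yc(2)] unfolding is_left_approx_def by blast
  then show ?thesis by blast
qed

lemma perp_right_approx:
  assumes "A \<in> Obj \<C>"
  shows "\<exists>Y f. is_right_approx \<C> perp A Y f"
  using rigid_frobenius.perp_left_approx[OF op_rigid_frobenius] assms by (simp add: left_perp_eq)

lemma perp_functorially_finite: "functorially_finite \<C> perp"
  unfolding functorially_finite_def using perp.sub_Obj perp_left_approx perp_right_approx by blast

lemma perp_weakly_idempotent_complete:
  "weakly_idempotent_complete \<C> \<Longrightarrow> weakly_idempotent_complete (full_sub \<C> perp)"
  using weakly_idempotent_complete_sub[OF _ perp.sub_Obj perp_retract] .

section \<open>Composite approximations and cluster-tilting subcategories\<close>

lemma left_approx_trans: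
  assumes f: "is_left_approx \<C> perp A Y f" and g: "is_left_approx \<C> \<T> Y T g"
    and "\<T> \<subseteq> perp" and A: "A \<in> Obj \<C>"
  shows "is_left_approx \<C> \<T> A T (g \<bullet> f)"
proof -
  have Y: "Y \<in> perp" "f \<in> mor \<C> A Y" and T: "T \<in> \<T>" "g \<in> mor \<C> Y T"
    using f g by (simp_all add: is_left_approx_def)
  have fa: "f \<in> arr \<C> A Y" and ga: "g \<in> arr \<C> Y T"
    using A Y T perp_Obj assms(3) by (auto simp: arr_def)
  have "\<exists>h \<in> mor \<C> T T'. h \<bullet> (g \<bullet> f) = k" if T': "T' \<in> \<T>" and k: "k \<in> mor \<C> A T'" for T' k
  proof -
    have "T' \<in> perp" using T' assms(3) by blast
    then obtain l where l: "l \<in> mor \<C> Y T'" "l \<bullet> f = k"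
      using f k unfolding is_left_approx_def by blast
    obtain h where h: "h \<in> mor \<C> T T'" "h \<bullet> g = l"
      using g T' l(1) unfolding is_left_approx_def by blast
    have ha: "h \<in> arr \<C> T T'" using h(1) ga perp_Obj[OF \<open>T' \<in> perp\<close>] by (simp add: arr_def)
    have "h \<bullet> (g \<bullet> f) = k" using assoc[OF ha ga fa] h(2) l(2) by simp
    then show ?thesis using h(1) by blast
  qed
  then show ?thesis
    unfolding is_left_approx_def using T(1) arrD(3)[OF arr_comp[OF ga fa]] by blast
qed

lemma right_approx_trans:
  assumes "is_right_approx \<C> perp A Y f" "is_right_approx \<C> \<T> Y T g" "\<T> \<subseteq> perp" "A \<in> Obj \<C>"
  shows "is_right_approx \<C> \<T> A T (f \<bullet> g)"
  using rigid_frobenius.left_approx_trans[OF op_rigid_frobenius, of A Y f \<T> T g] assms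
  by (simp add: left_perp_eq)

lemma sub_right_perp:
  assumes "\<T> \<subseteq> perp"
  shows "right_perp (full_sub \<C> perp) \<T> = right_perp \<C> \<T> \<inter> perp"
    "left_perp (full_sub \<C> perp) \<T> = left_perp \<C> \<T> \<inter> perp"
  using perp.sub_Obj unfolding full_sub_perps by (auto simp: right_perp_def left_perp_def)

lemma perps_subset:
  assumes "\<X> \<subseteq> \<T>" "\<T> \<subseteq> Obj \<C>"
  shows "right_perp \<C> \<T> \<subseteq> perp" "left_perp \<C> \<T> \<subseteq> perp"
proof -
  show "right_perp \<C> \<T> \<subseteq> perp" using assms(1) unfolding right_perp_def by blast
  have "left_perp \<C> \<T> \<subseteq> left_perp \<C> \<X>" using assms(1) unfolding left_perp_def by blast
  then show "left_perp \<C> \<T> \<subseteq> perp" by (simp only: left_perp_eq)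
qed

text \<open>Objects of \<X> are projective in \<open>perp\<close>, so they lie in the left
  perpendicular of \<T> there, which is \<T>. Once \<X> \<subseteq> \<T>, both ambient
  perpendiculars of \<T> already lie in \<open>perp\<close>, the left one by symmetry of vanishing,
  so perpendiculars in the two categories agree. Approximations by \<T> are obtained in the ambient
  category by passing through an approximation by \<open>perp\<close>.\<close>

lemma cluster_tilting_sub_iff:
  "cluster_tilting (full_sub \<C> perp) \<T> \<longleftrightarrow> cluster_tilting \<C> \<T> \<and> \<X> \<subseteq> \<T>"
proof (intro iffI conjI)
  assume T: "cluster_tilting (full_sub \<C> perp) \<T>"
  then have T': "functorially_finite (full_sub \<C> perp) \<T>" "\<T> \<subseteq> perp"
    "left_perp (full_sub \<C> perp) \<T> = \<T>" "right_perp (full_sub \<C> perp) \<T> = \<T>"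
    unfolding cluster_tilting_def functorially_finite_def by simp_all
  note perps = T'(3,4)[unfolded sub_right_perp[OF T'(2)]]
  have TO: "\<T> \<subseteq> Obj \<C>" using T'(2) perp_Obj by blast
  show XT: "\<X> \<subseteq> \<T>"
  proof
    fix X assume X: "X \<in> \<X>"
    have "ext_vanish \<C> X T" if "T \<in> \<T>" for T by (rule perp_vanish[OF subsetD[OF T'(2) that] X])
    then have "X \<in> left_perp \<C> \<T>" using left_perp_iff[OF TO] subsetD[OF X_Obj X] by simp
    then show "X \<in> \<T>" using perps(1) X_perp[OF X] by blast
  qed
  have "left_perp \<C> \<T> = \<T>" "right_perp \<C> \<T> = \<T>"
    using perps perps_subset[OF XT TO] by blast+
  moreover have "functorially_finite \<C> \<T>"
    unfolding functorially_finite_def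
  proof (intro conjI ballI TO)
    fix A assume A: "A \<in> Obj \<C>"
    have ap: "\<exists>T g. is_left_approx \<C> \<T> Y T g" "\<exists>T g. is_right_approx \<C> \<T> Y T g" if "Y \<in> perp" for Y
      using T'(1) that by (auto simp: functorially_finite_def)
    obtain Y f where f: "is_left_approx \<C> perp A Y f" using perp_left_approx[OF A] by blast
    then have "Y \<in> perp" by (simp add: is_left_approx_def)
    then show "\<exists>T f. is_left_approx \<C> \<T> A T f"
      using left_approx_trans[OF f _ T'(2) A] ap(1) by blast
    obtain Y f where f: "is_right_approx \<C> perp A Y f" using perp_right_approx[OF A] by blast
    then have "Y \<in> perp" by (simp add: is_right_approx_def)
    then show "\<exists>T f. is_right_approx \<C> \<T> A T f"
      using right_approx_trans[OF f _ T'(2) A] ap(2) by blast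
  qed
  ultimately show "cluster_tilting \<C> \<T>" by (simp add: cluster_tilting_def)
next
  assume T: "cluster_tilting \<C> \<T> \<and> \<X> \<subseteq> \<T>"
  then have T': "functorially_finite \<C> \<T>" "\<T> \<subseteq> Obj \<C>" "\<X> \<subseteq> \<T>"
    "left_perp \<C> \<T> = \<T>" "right_perp \<C> \<T> = \<T>"
    by (auto simp: cluster_tilting_def functorially_finite_def)
  \<comment> \<open>As \<T> equals its own right perpendicular, it is contained in that of the
    smaller \<X>.\<close>
  have TD: "\<T> \<subseteq> perp" using perps_subset(1)[OF T'(3,2)] T'(5) by simp
  have "functorially_finite (full_sub \<C> perp) \<T>"
    using T'(1) TD perp_Obj by (auto simp: functorially_finite_def)
  then show "cluster_tilting (full_sub \<C> perp) \<T>"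
    unfolding cluster_tilting_def sub_right_perp[OF TD] T'(4,5) using TD by blast
qed

end

section \<open>Transport of vector spaces and their duals along linear bijections\<close>

lemma vectorspace_transport:
  fixes K (structure)
  assumes W: "vectorspace K W" and \<theta>: "bij_betw \<theta> (carrier V) (carrier W)"
    and zero: "\<zero>\<^bsub>V\<^esub> \<in> carrier V" "\<theta> \<zero>\<^bsub>V\<^esub> = \<zero>\<^bsub>W\<^esub>"
    and add: "\<And>v w. \<lbrakk>v \<in> carrier V; w \<in> carrier V\<rbrakk> \<Longrightarrow> v \<oplus>\<^bsub>V\<^esub> w \<in> carrier V"
      "\<And>v w. \<lbrakk>v \<in> carrier V; w \<in> carrier V\<rbrakk> \<Longrightarrow> \<theta> (v \<oplus>\<^bsub>V\<^esub> w) = \<theta> v \<oplus>\<^bsub>W\<^esub> \<theta> w"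
    and smult: "\<And>k v. \<lbrakk>k \<in> carrier K; v \<in> carrier V\<rbrakk> \<Longrightarrow> k \<odot>\<^bsub>V\<^esub> v \<in> carrier V"
      "\<And>k v. \<lbrakk>k \<in> carrier K; v \<in> carrier V\<rbrakk> \<Longrightarrow> \<theta> (k \<odot>\<^bsub>V\<^esub> v) = k \<odot>\<^bsub>W\<^esub> \<theta> v"
  shows "vectorspace K V"
proof -
  interpret W: vectorspace K W by (rule W)
  have \<theta>c: "\<theta> v \<in> carrier W" if "v \<in> carrier V" for v using bij_betwE[OF \<theta>] that by blast
  \<comment> \<open>Each law for \<open>V\<close> is checked after applying \<theta>, where it
    becomes the same law for \<open>W\<close>.\<close>
  have inj: "v = w" if "\<theta> v = \<theta> w" "v \<in> carrier V" "w \<in> carrier V" for v w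
    using inj_onD[OF bij_betw_imp_inj_on[OF \<theta>] that] .
  have "abelian_group V"
  proof (rule abelian_groupI)
    fix x assume x: "x \<in> carrier V"
    have "\<ominus>\<^bsub>W\<^esub> \<theta> x \<in> \<theta> ` carrier V"
      using bij_betw_imp_surj_on[OF \<theta>] \<theta>c[OF x] by simp
    then obtain y where y: "y \<in> carrier V" "\<theta> y = \<ominus>\<^bsub>W\<^esub> \<theta> x" by force
    have "\<theta> (y \<oplus>\<^bsub>V\<^esub> x) = \<theta> \<zero>\<^bsub>V\<^esub>" using add(2)[OF y(1) x] y(2) zero(2) \<theta>c[OF x] by (simp add: W.l_neg)
    then show "\<exists>y \<in> carrier V. y \<oplus>\<^bsub>V\<^esub> x = \<zero>\<^bsub>V\<^esub>"
      using inj[OF _ add(1)[OF y(1) x] zero(1)] y(1) by blast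
    show "\<zero>\<^bsub>V\<^esub> \<oplus>\<^bsub>V\<^esub> x = x"
      by (rule inj[OF _ add(1)[OF zero(1) x] x]) (simp add: add(2)[OF zero(1) x] zero(2) \<theta>c[OF x])
  next
    fix x y assume x: "x \<in> carrier V" "y \<in> carrier V"
    show "x \<oplus>\<^bsub>V\<^esub> y \<in> carrier V" by (rule add(1)[OF x])
    show "x \<oplus>\<^bsub>V\<^esub> y = y \<oplus>\<^bsub>V\<^esub> x"
      by (rule inj[OF _ add(1)[OF x] add(1)[OF x(2,1)]]) (simp add: add(2) x \<theta>c W.a_comm)
  next
    fix x y z assume x: "x \<in> carrier V" "y \<in> carrier V" "z \<in> carrier V"
    show "x \<oplus>\<^bsub>V\<^esub> y \<oplus>\<^bsub>V\<^esub> z = x \<oplus>\<^bsub>V\<^esub> (y \<oplus>\<^bsub>V\<^esub> z)"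
      by (rule inj) (simp_all add: add x \<theta>c W.a_assoc)
  qed (rule zero(1))
  then have "module K V"
  proof (rule moduleI[OF W.R.is_cring])
    fix a b x assume ab: "a \<in> carrier K" "b \<in> carrier K" and x: "x \<in> carrier V"
    show "(a \<oplus> b) \<odot>\<^bsub>V\<^esub> x = a \<odot>\<^bsub>V\<^esub> x \<oplus>\<^bsub>V\<^esub> b \<odot>\<^bsub>V\<^esub> x"
      by (rule inj) (simp_all add: add smult ab x \<theta>c W.smult_l_distr)
    show "(a \<otimes> b) \<odot>\<^bsub>V\<^esub> x = a \<odot>\<^bsub>V\<^esub> (b \<odot>\<^bsub>V\<^esub> x)"
      by (rule inj) (simp_all add: add smult ab x \<theta>c W.smult_assoc1)
  next
    fix a x y assume a: "a \<in> carrier K" and x: "x \<in> carrier V" "y \<in> carrier V"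
    show "a \<odot>\<^bsub>V\<^esub> (x \<oplus>\<^bsub>V\<^esub> y) = a \<odot>\<^bsub>V\<^esub> x \<oplus>\<^bsub>V\<^esub> a \<odot>\<^bsub>V\<^esub> y"
      by (rule inj) (simp_all add: add smult a x \<theta>c W.smult_r_distr)
  next
    fix x assume x: "x \<in> carrier V"
    show "\<one> \<odot>\<^bsub>V\<^esub> x = x" by (rule inj) (simp_all add: smult x \<theta>c)
  qed (rule smult(1))
  then show ?thesis using W by (simp add: vectorspace_def)
qed

lemma fin_dim_image:
  assumes "vectorspace K V" "vectorspace K W" "T \<in> module_hom K V W" "T ` carrier V = carrier W"
    "vectorspace.fin_dim K V"
  shows "vectorspace.fin_dim K W"
proof -
  have "linear_map K V W T"
    using assms(1-3) by (simp add: linear_map_def mod_hom_def mod_hom_axioms_def vectorspace_def)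
  then show ?thesis using linear_map.surj_fin_dim assms(4,5) by blast
qed

lemma module_homI:
  assumes "\<And>v. v \<in> carrier V \<Longrightarrow> T v \<in> carrier W"
    "\<And>v w. \<lbrakk>v \<in> carrier V; w \<in> carrier V\<rbrakk> \<Longrightarrow> T (v \<oplus>\<^bsub>V\<^esub> w) = T v \<oplus>\<^bsub>W\<^esub> T w"
    "\<And>k v. \<lbrakk>k \<in> carrier K; v \<in> carrier V\<rbrakk> \<Longrightarrow> T (k \<odot>\<^bsub>V\<^esub> v) = k \<odot>\<^bsub>W\<^esub> T v"
  shows "T \<in> module_hom K V W"
  using assms unfolding module_hom_def by blast

lemma module_hom_comp:
  assumes "S \<in> module_hom K V W" "T \<in> module_hom K U V"
  shows "(\<lambda>u. S (T u)) \<in> module_hom K U W"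
  by (rule module_homI)
    (simp_all add: module_hom_carrier[OF assms(1)] module_hom_carrier[OF assms(2)]
      module_hom_add[OF assms(1)] module_hom_add[OF assms(2)]
      module_hom_smult[OF assms(1)] module_hom_smult[OF assms(2)])

lemma module_hom_inv:
  assumes V: "module K V" and T: "T \<in> module_hom K V W" and bij: "bij_betw T (carrier V) (carrier W)"
  shows "inv_into (carrier V) T \<in> module_hom K W V"
proof (rule module_homI)
  interpret V: module K V by (rule V)
  let ?S = "inv_into (carrier V) T"
  have S: "?S w \<in> carrier V" "T (?S w) = w" if "w \<in> carrier W" for w
    using bij_betwE[OF bij_betw_inv_into[OF bij]] bij_betw_inv_into_right[OF bij] that by blast+
  have eq: "?S (T v) = v" if "v \<in> carrier V" for v using bij_betw_inv_into_left[OF bij that] .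
  show "?S w \<in> carrier V" if "w \<in> carrier W" for w by (rule S(1)[OF that])
  show "?S (v \<oplus>\<^bsub>W\<^esub> w) = ?S v \<oplus>\<^bsub>V\<^esub> ?S w" if "v \<in> carrier W" "w \<in> carrier W" for v w
    using eq[of "?S v \<oplus>\<^bsub>V\<^esub> ?S w"] module_hom_add[OF T S(1)[OF that(1)] S(1)[OF that(2)]]
      S(1)[OF that(1)] S(1)[OF that(2)] by (simp add: S(2) that)
  show "?S (k \<odot>\<^bsub>W\<^esub> w) = k \<odot>\<^bsub>V\<^esub> ?S w" if "k \<in> carrier K" "w \<in> carrier W" for k w
    using eq[of "k \<odot>\<^bsub>V\<^esub> ?S w"] module_hom_smult[OF T that(1) S(1)[OF that(2)]] S(1)[OF that(2)] that(1)
    by (simp add: S(2) that)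
qed

lemma self_module_simps [simp]:
  "carrier (self_module K) = carrier K" "add (self_module K) = add K" "smult (self_module K) = mult K"
  by (simp_all add: self_module_def)

lemma dual_space_simps:
  "carrier (dual_space K V) = module_hom K V (self_module K) \<inter> extensional (carrier V)"
  "add (dual_space K V) = (\<lambda>\<phi> \<psi>. \<lambda>v \<in> carrier V. \<phi> v \<oplus>\<^bsub>K\<^esub> \<psi> v)"
  "smult (dual_space K V) = (\<lambda>k \<phi>. \<lambda>v \<in> carrier V. k \<otimes>\<^bsub>K\<^esub> \<phi> v)"
  by (simp_all add: dual_space_def)

text \<open>Elements of the dual are extensional functions, hence the restriction of the composite
  to the carrier of \<open>W'\<close>.\<close>

lemma dual_precomp_carrier:
  assumes W': "module K W'" and \<beta>: "\<beta> \<in> module_hom K W' W" and \<phi>: "\<phi> \<in> carrier (dual_space K W)"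
  shows "(\<lambda>w \<in> carrier W'. \<phi> (\<beta> w)) \<in> carrier (dual_space K W')"
proof -
  interpret W': module K W' by (rule W')
  have \<phi>': "\<phi> \<in> module_hom K W (self_module K)" using \<phi> by (simp add: dual_space_simps)
  note h = module_hom_comp[OF \<phi>' \<beta>]
  have "(\<lambda>w \<in> carrier W'. \<phi> (\<beta> w)) \<in> module_hom K W' (self_module K)"
    using module_hom_add[OF h] module_hom_smult[OF h] module_hom_carrier[OF h]
    by (intro module_homI) simp_all
  then show ?thesis by (simp add: dual_space_simps)
qed

lemma dual_precomp:
  assumes W': "module K W'" and \<beta>: "\<beta> \<in> module_hom K W' W"
  shows "(\<lambda>\<phi>. \<lambda>w \<in> carrier W'. \<phi> (\<beta> w)) \<in> module_hom K (dual_space K W) (dual_space K W')"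
proof (rule module_homI)
  show "(\<lambda>w \<in> carrier W'. \<phi> (\<beta> w)) \<in> carrier (dual_space K W')"
    if "\<phi> \<in> carrier (dual_space K W)" for \<phi>
    by (rule dual_precomp_carrier[OF assms that])
qed (auto simp: dual_space_simps fun_eq_iff module_hom_carrier[OF \<beta>])

lemma dual_precomp_bij:
  assumes W: "module K W" and W': "module K W'" and \<beta>: "\<beta> \<in> module_hom K W' W"
    and bij: "bij_betw \<beta> (carrier W') (carrier W)"
  shows "bij_betw (\<lambda>\<phi>. \<lambda>w \<in> carrier W'. \<phi> (\<beta> w)) (carrier (dual_space K W)) (carrier (dual_space K W'))"
proof -
  let ?\<beta>' = "inv_into (carrier W') \<beta>"
  note \<beta>' = module_hom_inv[OF W' \<beta> bij]
  have 1: "(\<lambda>w \<in> carrier W. (\<lambda>w \<in> carrier W'. \<phi> (\<beta> w)) (?\<beta>' w)) = \<phi>"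
    if "\<phi> \<in> carrier (dual_space K W)" for \<phi>
  proof
    fix w
    show "(\<lambda>w \<in> carrier W. (\<lambda>w \<in> carrier W'. \<phi> (\<beta> w)) (?\<beta>' w)) w = \<phi> w"
      using that module_hom_carrier[OF \<beta>', of w] bij_betw_inv_into_right[OF bij, of w]
      by (cases "w \<in> carrier W") (auto simp: dual_space_simps extensional_def)
  qed
  have 2: "(\<lambda>w \<in> carrier W'. (\<lambda>w \<in> carrier W. \<phi> (?\<beta>' w)) (\<beta> w)) = \<phi>"
    if "\<phi> \<in> carrier (dual_space K W')" for \<phi>
  proof
    fix w
    show "(\<lambda>w \<in> carrier W'. (\<lambda>w \<in> carrier W. \<phi> (?\<beta>' w)) (\<beta> w)) w = \<phi> w"
      using that module_hom_carrier[OF \<beta>, of w] bij_betw_inv_into_left[OF bij, of w]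
      by (cases "w \<in> carrier W'") (auto simp: dual_space_simps extensional_def)
  qed
  show ?thesis
    by (rule bij_betw_byWitness[where f' = "\<lambda>\<phi>. \<lambda>w \<in> carrier W. \<phi> (?\<beta>' w)"])
      (use 1 2 dual_precomp_carrier[OF W' \<beta>] dual_precomp_carrier[OF W \<beta>'] in blast)+
qed

text \<open>A perfect pairing stays perfect when isomorphisms are inserted in both arguments. This
  serves in both directions between stable morphisms and extensions.\<close>

lemma dual_transport:
  assumes "module K W" "module K W'"
    and \<alpha>: "\<alpha> \<in> module_hom K V' V" "bij_betw \<alpha> (carrier V') (carrier V)"
    and \<beta>: "\<beta> \<in> module_hom K W' W" "bij_betw \<beta> (carrier W') (carrier W)"
    and \<Phi>: "\<Phi> \<in> module_hom K V (dual_space K W)" "bij_betw \<Phi> (carrier V) (carrier (dual_space K W))"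
  shows "(\<lambda>v. \<lambda>w \<in> carrier W'. \<Phi> (\<alpha> v) (\<beta> w)) \<in> module_hom K V' (dual_space K W')"
    "bij_betw (\<lambda>v. \<lambda>w \<in> carrier W'. \<Phi> (\<alpha> v) (\<beta> w)) (carrier V') (carrier (dual_space K W'))"
proof -
  show "(\<lambda>v. \<lambda>w \<in> carrier W'. \<Phi> (\<alpha> v) (\<beta> w)) \<in> module_hom K V' (dual_space K W')"
    by (rule module_hom_comp[OF dual_precomp[OF assms(2) \<beta>(1)] module_hom_comp[OF \<Phi>(1) \<alpha>(1)]])
  show "bij_betw (\<lambda>v. \<lambda>w \<in> carrier W'. \<Phi> (\<alpha> v) (\<beta> w)) (carrier V') (carrier (dual_space K W'))"
    using bij_betw_trans[OF bij_betw_trans[OF \<alpha>(2) \<Phi>(2)] dual_precomp_bij[OF assms(1,2) \<beta>]]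
    by (simp add: comp_def)
qed

section \<open>The stable category\<close>

text \<open>For a stable class the choice of a representative is immaterial, because maps through
  projective-injectives pull every extension back to zero.\<close>

definition stable_ext :: "('k, 'o, 'm, 'e) extri_cat \<Rightarrow> 'e \<Rightarrow> 'm set \<Rightarrow> 'e" where
  "stable_ext \<C> \<delta> F = pull \<C> (SOME f. f \<in> F) \<delta>"

context extriangulated
begin

lemma op_ideal [simp]: "proj_inj_ideal (op_cat \<C>) A B = proj_inj_ideal \<C> B A"
  unfolding proj_inj_ideal_def op_simps op_frobenius by blast

text \<open>The pullback along \<open>h\<close> passes through \<open>Ext P W\<close>, which is zero
  because \<open>P\<close> is projective.\<close>

lemma ideal_pull:
  assumes h: "h \<in> proj_inj_ideal \<C> X Y" and \<eta>: "\<eta> \<in> exts \<C> Y W" and X: "X \<in> Obj \<C>"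
  shows "h \<in> arr \<C> X Y" "pull \<C> h \<eta> = \<zero>\<^bsub>Ext \<C> X W\<^esub>"
proof -
  obtain P a b where P: "P \<in> proj_inj \<C>" and ab: "a \<in> mor \<C> X P" "b \<in> mor \<C> P Y" and h': "h = b \<bullet> a"
    using h unfolding proj_inj_ideal_def by blast
  have PP: "P \<in> projectives \<C>" using P by (simp add: proj_inj_def)
  then have O: "P \<in> Obj \<C>" "Y \<in> Obj \<C>" "W \<in> Obj \<C>" using \<eta> by (simp_all add: projectives_iff exts_def)
  have ar: "a \<in> arr \<C> X P" "b \<in> arr \<C> P Y" using ab O X by (simp_all add: arr_def)
  have v: "ext_vanish \<C> P W" using PP O(3) by (simp add: projectives_iff)
  show "h \<in> arr \<C> X Y" unfolding h' by (rule arr_comp[OF ar(2,1)])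
  show "pull \<C> h \<eta> = \<zero>\<^bsub>Ext \<C> X W\<^esub>"
    unfolding h' ext_pull_comp[OF ar(2,1) \<eta>] ext_vanishD[OF v exts_pull[OF ar(2) \<eta>]]
    by (rule pull_zero[OF ar(1) O(3)])
qed

lemmas ideal_push = extriangulated.ideal_pull[OF op_extriangulated, unfolded op_simps op_ideal]

lemma stable_class_pull:
  assumes g: "g \<in> stable_class \<C> X Y f" and f: "f \<in> arr \<C> X Y" and \<eta>: "\<eta> \<in> exts \<C> Y W"
  shows "g \<in> arr \<C> X Y" "pull \<C> g \<eta> = pull \<C> f \<eta>"
proof -
  note O = arrD(1)[OF f] extsD(2)[OF \<eta>]
  obtain h where h: "h \<in> proj_inj_ideal \<C> X Y" "g = h \<oplus>\<^bsub>Hom \<C> X Y\<^esub> f"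
    using g unfolding stable_class_def a_r_coset_def' by blast
  note h' = ideal_pull[OF h(1) \<eta> O(1)]
  show "g \<in> arr \<C> X Y" unfolding h(2) by (rule arr_add[OF h'(1) f])
  have "pull \<C> f \<eta> \<in> carrier (Ext \<C> X W)" using extsD(3)[OF exts_pull[OF f \<eta>]] .
  then show "pull \<C> g \<eta> = pull \<C> f \<eta>"
    unfolding h(2) pull_add_arr[OF \<eta> h'(1) f] h'(2) using abelian_groupE(5)[OF ext_group[OF O]] by simp
qed

lemma stable_class_push:
  assumes g: "g \<in> stable_class \<C> X Y f" and f: "f \<in> arr \<C> X Y" and \<eta>: "\<eta> \<in> exts \<C> W X"
  shows "push \<C> g \<eta> = push \<C> f \<eta>"
proof -
  note O = arrD(2)[OF f] extsD(1)[OF \<eta>]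
  obtain h where h: "h \<in> proj_inj_ideal \<C> X Y" "g = h \<oplus>\<^bsub>Hom \<C> X Y\<^esub> f"
    using g unfolding stable_class_def a_r_coset_def' by blast
  note h' = ideal_push[OF h(1) \<eta> O(1)]
  have "push \<C> f \<eta> \<in> carrier (Ext \<C> W Y)" using extsD(3)[OF exts_push[OF f \<eta>]] .
  then show "push \<C> g \<eta> = push \<C> f \<eta>"
    unfolding h(2) push_add_arr[OF \<eta> h'(1) f] h'(2) using abelian_groupE(5)[OF ext_group[OF O(2,1)]] by simp
qed

end

text \<open>A conflation \<open>N \<rightarrow> P \<rightarrow> B\<close> with projective-injective \<open>P\<close> identifies the stable morphisms
  \<open>X \<rightarrow> B\<close> with the extensions of \<open>X\<close> by \<open>N\<close>: the ideal of morphisms factoring through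
  projective-injectives is the kernel of \<open>f \<mapsto> pull f \<delta>\<close>.\<close>

locale stable_conflation = extriangulated K \<C>
  for K :: "('k, 'r) ring_scheme" (structure) and \<C> :: "('k, 'o, 'm, 'e) extri_cat" +
  fixes N x P y B \<delta>
  assumes conf: "conflation \<C> N x P y B \<delta>" and P: "P \<in> proj_inj \<C>"
begin

lemmas \<delta> = conflationD(1)[OF conf] and B_Obj = conflation_Obj(3)[OF conf]
  and N_Obj = conflation_Obj(1)[OF conf]

lemma ideal_iff:
  assumes f: "f \<in> arr \<C> X B"
  shows "f \<in> proj_inj_ideal \<C> X B \<longleftrightarrow> pull \<C> f \<delta> = \<zero>\<^bsub>Ext \<C> X N\<^esub>"
proof
  assume "f \<in> proj_inj_ideal \<C> X B"
  then show "pull \<C> f \<delta> = \<zero>\<^bsub>Ext \<C> X N\<^esub>" by (rule ideal_pull(2)[OF _ \<delta> arrD(1)[OF f]])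
next
  assume "pull \<C> f \<delta> = \<zero>\<^bsub>Ext \<C> X N\<^esub>"
  \<comment> \<open>Vanishing of the pullback gives a lift along \<open>y\<close>, hence a
    factorisation through \<open>P\<close>.\<close>
  then obtain g where g: "g \<in> arr \<C> X P" "y \<bullet> g = f" by (rule conflation_lift_right[OF conf f])
  then show "f \<in> proj_inj_ideal \<C> X B"
    unfolding proj_inj_ideal_def using P arrD(3)[OF conflationD(3)[OF conf]] arrD(3)[OF g(1)] by blast
qed

text \<open>Membership in a coset becomes equality of pulled back classes, so computations with
  cosets reduce to computations in \<open>Ext X N\<close>.\<close>

lemma stable_class_iff:
  assumes f: "f \<in> arr \<C> X B"
  shows "g \<in> stable_class \<C> X B f \<longleftrightarrow> g \<in> arr \<C> X B \<and> pull \<C> g \<delta> = pull \<C> f \<delta>"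
proof
  assume g: "g \<in> stable_class \<C> X B f"
  show "g \<in> arr \<C> X B \<and> pull \<C> g \<delta> = pull \<C> f \<delta>"
    using stable_class_pull[OF g f \<delta>] by simp
next
  assume g: "g \<in> arr \<C> X B \<and> pull \<C> g \<delta> = pull \<C> f \<delta>"
  let ?h = "g \<ominus>\<^bsub>Hom \<C> X B\<^esub> f"
  have h: "?h \<in> arr \<C> X B" using g by (intro arr_minus f) simp
  have "pull \<C> ?h \<delta> = \<zero>\<^bsub>Ext \<C> X N\<^esub>"
    using pull_minus_arr[OF \<delta> conjunct1[OF g] f] g extsD(3)[OF exts_pull[OF f \<delta>]]
      abelian_group.minus_eq_zero_iff[OF ext_group[OF arrD(1)[OF f] N_Obj]] by simp
  then have "?h \<in> proj_inj_ideal \<C> X B" by (simp add: ideal_iff[OF h])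
  moreover have "g = ?h \<oplus>\<^bsub>Hom \<C> X B\<^esub> f" using minus_add[of g X B f] g f by simp
  ultimately show "g \<in> stable_class \<C> X B f"
    unfolding stable_class_def a_r_coset_def' by blast
qed

lemma stable_class_refl: "f \<in> arr \<C> X B \<Longrightarrow> f \<in> stable_class \<C> X B f"
  by (simp add: stable_class_iff)

lemma stable_class_eq_iff:
  assumes "f \<in> arr \<C> X B" "g \<in> arr \<C> X B"
  shows "stable_class \<C> X B f = stable_class \<C> X B g \<longleftrightarrow> pull \<C> f \<delta> = pull \<C> g \<delta>"
proof
  assume "stable_class \<C> X B f = stable_class \<C> X B g"
  then have "f \<in> stable_class \<C> X B g" using stable_class_refl[OF assms(1)] by simp
  then show "pull \<C> f \<delta> = pull \<C> g \<delta>" by (simp add: stable_class_iff[OF assms(2)])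
next
  assume "pull \<C> f \<delta> = pull \<C> g \<delta>"
  then show "stable_class \<C> X B f = stable_class \<C> X B g"
    by (intro Set.set_eqI) (simp add: stable_class_iff[OF assms(1)] stable_class_iff[OF assms(2)])
qed

lemma stable_ext_class:
  assumes f: "f \<in> arr \<C> X B" and \<eta>: "\<eta> \<in> exts \<C> B W"
  shows "stable_ext \<C> \<eta> (stable_class \<C> X B f) = pull \<C> f \<eta>"
  unfolding stable_ext_def
  by (rule stable_class_pull(2)[OF someI[of "\<lambda>g. g \<in> stable_class \<C> X B f", OF stable_class_refl[OF f]] f \<eta>])

lemma stable_hom_carrier:
  assumes "X \<in> Obj \<C>" "F \<in> carrier (stable_hom \<C> X B)"
  obtains f where "f \<in> arr \<C> X B" "F = stable_class \<C> X B f"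
  using assms B_Obj by (auto simp: stable_hom_def arr_def)

lemma stable_class_carrier: "f \<in> arr \<C> X B \<Longrightarrow> stable_class \<C> X B f \<in> carrier (stable_hom \<C> X B)"
  by (simp add: stable_hom_def arr_def)

lemma stable_zero:
  assumes X: "X \<in> Obj \<C>"
  shows "\<zero>\<^bsub>stable_hom \<C> X B\<^esub> = stable_class \<C> X B (zm X B)"
proof -
  note z = arr_zero[OF X B_Obj]
  have "f \<in> proj_inj_ideal \<C> X B \<longleftrightarrow> f \<in> stable_class \<C> X B (zm X B)" for f
    using ideal_pull(1)[OF _ \<delta> X] ideal_iff[of f X] pull_zero_arr[OF \<delta> X]
    unfolding stable_class_iff[OF z] by auto
  then show ?thesis by (auto simp: stable_hom_def)
qed

lemma stable_add:
  assumes f: "f \<in> arr \<C> X B" and g: "g \<in> arr \<C> X B"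
  shows "stable_class \<C> X B f \<oplus>\<^bsub>stable_hom \<C> X B\<^esub> stable_class \<C> X B g =
    stable_class \<C> X B (f \<oplus>\<^bsub>Hom \<C> X B\<^esub> g)"
proof -
  note fg = arr_add[OF f g]
  have "h \<in> stable_class \<C> X B f <+>\<^bsub>Hom \<C> X B\<^esub> stable_class \<C> X B g \<longleftrightarrow>
    h \<in> stable_class \<C> X B (f \<oplus>\<^bsub>Hom \<C> X B\<^esub> g)" for h
  proof
    assume "h \<in> stable_class \<C> X B f <+>\<^bsub>Hom \<C> X B\<^esub> stable_class \<C> X B g"
    then obtain f' g' where fg': "f' \<in> stable_class \<C> X B f" "g' \<in> stable_class \<C> X B g"
      "h = f' \<oplus>\<^bsub>Hom \<C> X B\<^esub> g'" unfolding set_add_def' by blast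
    then show "h \<in> stable_class \<C> X B (f \<oplus>\<^bsub>Hom \<C> X B\<^esub> g)"
      by (simp add: stable_class_iff[OF f] stable_class_iff[OF g] stable_class_iff[OF fg]
        arr_add pull_add_arr[OF \<delta>] f g)
  next
    assume "h \<in> stable_class \<C> X B (f \<oplus>\<^bsub>Hom \<C> X B\<^esub> g)"
    then have h: "h \<in> arr \<C> X B" "pull \<C> h \<delta> = pull \<C> f \<delta> \<oplus>\<^bsub>Ext \<C> X N\<^esub> pull \<C> g \<delta>"
      by (simp_all add: stable_class_iff[OF fg] pull_add_arr[OF \<delta> f g])
    interpret E: abelian_group "Ext \<C> X N" by (rule ext_group[OF arrD(1)[OF f] N_Obj])
    have "pull \<C> f \<delta> \<in> carrier (Ext \<C> X N)" "pull \<C> g \<delta> \<in> carrier (Ext \<C> X N)"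
      using extsD(3)[OF exts_pull[OF f \<delta>]] extsD(3)[OF exts_pull[OF g \<delta>]] .
    \<comment> \<open>To split \<open>h\<close> into representatives, \<open>g\<close> is kept and
      \<open>h - g\<close> is shown to represent the class of \<open>f\<close>.\<close>
    then have "pull \<C> (h \<ominus>\<^bsub>Hom \<C> X B\<^esub> g) \<delta> = pull \<C> f \<delta>"
      unfolding pull_minus_arr[OF \<delta> h(1) g] h(2)
      by (simp add: a_minus_def E.a_assoc E.r_neg)
    then have "h \<ominus>\<^bsub>Hom \<C> X B\<^esub> g \<in> stable_class \<C> X B f"
      using arr_minus[OF h(1) g] by (simp add: stable_class_iff[OF f])
    moreover have "h = (h \<ominus>\<^bsub>Hom \<C> X B\<^esub> g) \<oplus>\<^bsub>Hom \<C> X B\<^esub> g" using minus_add[OF h(1) g] by simp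
    ultimately show "h \<in> stable_class \<C> X B f <+>\<^bsub>Hom \<C> X B\<^esub> stable_class \<C> X B g"
      unfolding set_add_def' using stable_class_refl[OF g] by blast
  qed
  then show ?thesis by (auto simp: stable_hom_def)
qed

lemma arr_smult:
  assumes "k \<in> carrier K" "f \<in> arr \<C> X B"
  shows "k \<odot>\<^bsub>Hom \<C> X B\<^esub> f \<in> arr \<C> X B"
    "pull \<C> (k \<odot>\<^bsub>Hom \<C> X B\<^esub> f) \<delta> = k \<odot>\<^bsub>Ext \<C> X N\<^esub> pull \<C> f \<delta>"
proof -
  note f = arrD[OF assms(2)]
  show "k \<odot>\<^bsub>Hom \<C> X B\<^esub> f \<in> arr \<C> X B"
    using module.smult_closed[OF hom_module[OF f(1,2)] assms(1) f(3)] f(1,2) by (simp add: arr_def)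
  show "pull \<C> (k \<odot>\<^bsub>Hom \<C> X B\<^esub> f) \<delta> = k \<odot>\<^bsub>Ext \<C> X N\<^esub> pull \<C> f \<delta>"
    by (rule module_hom_smult[OF pull_linear_mor[OF N_Obj B_Obj f(1) extsD(3)[OF \<delta>]] assms(1) f(3)])
qed

lemma stable_smult:
  assumes k: "k \<in> carrier K" and f: "f \<in> arr \<C> X B"
  shows "k \<odot>\<^bsub>stable_hom \<C> X B\<^esub> stable_class \<C> X B f = stable_class \<C> X B (k \<odot>\<^bsub>Hom \<C> X B\<^esub> f)"
proof -
  have "stable_class \<C> X B (k \<odot>\<^bsub>Hom \<C> X B\<^esub> g) = stable_class \<C> X B (k \<odot>\<^bsub>Hom \<C> X B\<^esub> f)"
    if "g \<in> stable_class \<C> X B f" for g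
  proof -
    have g: "g \<in> arr \<C> X B" "pull \<C> g \<delta> = pull \<C> f \<delta>" using that by (simp_all add: stable_class_iff[OF f])
    show ?thesis
      unfolding stable_class_eq_iff[OF arr_smult(1)[OF k g(1)] arr_smult(1)[OF k f]]
        arr_smult(2)[OF k g(1)] arr_smult(2)[OF k f] g(2) ..
  qed
  then have "(\<Union>g \<in> stable_class \<C> X B f. stable_class \<C> X B (k \<odot>\<^bsub>Hom \<C> X B\<^esub> g)) =
    stable_class \<C> X B (k \<odot>\<^bsub>Hom \<C> X B\<^esub> f)"
    using stable_class_refl[OF f] by blast
  then show ?thesis by (simp add: stable_hom_def)
qed

lemma stable_ext_bij:
  assumes X: "X \<in> Obj \<C>"
  shows "bij_betw (stable_ext \<C> \<delta>) (carrier (stable_hom \<C> X B)) (carrier (Ext \<C> X N))"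
proof (rule bij_betw_imageI)
  show "inj_on (stable_ext \<C> \<delta>) (carrier (stable_hom \<C> X B))"
  proof (rule inj_onI)
    fix F G assume FG: "F \<in> carrier (stable_hom \<C> X B)" "G \<in> carrier (stable_hom \<C> X B)"
      and eq: "stable_ext \<C> \<delta> F = stable_ext \<C> \<delta> G"
    obtain f where f: "f \<in> arr \<C> X B" "F = stable_class \<C> X B f" using stable_hom_carrier[OF X FG(1)] .
    obtain g where g: "g \<in> arr \<C> X B" "G = stable_class \<C> X B g" using stable_hom_carrier[OF X FG(2)] .
    have "pull \<C> f \<delta> = pull \<C> g \<delta>"
      using eq by (simp add: f(2) g(2) stable_ext_class[OF f(1) \<delta>] stable_ext_class[OF g(1) \<delta>])
    then show "F = G" by (simp add: f(2) g(2) stable_class_eq_iff[OF f(1) g(1)])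
  qed
next
  show "stable_ext \<C> \<delta> ` carrier (stable_hom \<C> X B) = carrier (Ext \<C> X N)"
  proof (intro equalityI subsetI)
    fix e assume "e \<in> stable_ext \<C> \<delta> ` carrier (stable_hom \<C> X B)"
    then obtain F where F: "F \<in> carrier (stable_hom \<C> X B)" "e = stable_ext \<C> \<delta> F" by blast
    obtain f where f: "f \<in> arr \<C> X B" "F = stable_class \<C> X B f" using stable_hom_carrier[OF X F(1)] .
    show "e \<in> carrier (Ext \<C> X N)"
      unfolding F(2) f(2) stable_ext_class[OF f(1) \<delta>] using extsD(3)[OF exts_pull[OF f(1) \<delta>]] .
  next
    fix e assume "e \<in> carrier (Ext \<C> X N)"
    then have e: "e \<in> exts \<C> X N" using X N_Obj by (simp add: exts_def)
    \<comment> \<open>Surjectivity rests on the injectivity of \<open>P\<close>: every extension by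
      \<open>N\<close> dies in \<open>Ext X P\<close> and so is pulled back from \<delta>.\<close>
    have v: "ext_vanish \<C> X P" using P X by (simp add: proj_inj_def injectives_iff)
    obtain f where f: "f \<in> arr \<C> X B" "e = pull \<C> f \<delta>"
      using conflation_ext_pull[OF conf e ext_vanishD[OF v exts_push[OF conflationD(2)[OF conf] e]]] .
    then have "e = stable_ext \<C> \<delta> (stable_class \<C> X B f)" by (simp add: stable_ext_class[OF f(1) \<delta>])
    then show "e \<in> stable_ext \<C> \<delta> ` carrier (stable_hom \<C> X B)" using stable_class_carrier[OF f(1)] by blast
  qed
qed

text \<open>At first \<open>stable_hom\<close> is just a record of operations on cosets. Its vector
  space laws are pulled back from \<open>Ext X N\<close> along the bijection
  \<open>stable_ext\<close>.\<close>

lemma stable_hom_space: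
  assumes X: "X \<in> Obj \<C>"
  shows "vectorspace K (stable_hom \<C> X B)"
    "stable_ext \<C> \<delta> \<in> module_hom K (stable_hom \<C> X B) (Ext \<C> X N)"
proof -
  let ?H = "stable_hom \<C> X B"
  have add: "F \<oplus>\<^bsub>?H\<^esub> G \<in> carrier ?H"
    "stable_ext \<C> \<delta> (F \<oplus>\<^bsub>?H\<^esub> G) = stable_ext \<C> \<delta> F \<oplus>\<^bsub>Ext \<C> X N\<^esub> stable_ext \<C> \<delta> G"
    if FG: "F \<in> carrier ?H" "G \<in> carrier ?H" for F G
  proof -
    obtain f where f: "f \<in> arr \<C> X B" "F = stable_class \<C> X B f" using stable_hom_carrier[OF X FG(1)] .
    obtain g where g: "g \<in> arr \<C> X B" "G = stable_class \<C> X B g" using stable_hom_carrier[OF X FG(2)] .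
    note fg = arr_add[OF f(1) g(1)]
    show "F \<oplus>\<^bsub>?H\<^esub> G \<in> carrier ?H"
      unfolding f(2) g(2) stable_add[OF f(1) g(1)] by (rule stable_class_carrier[OF fg])
    show "stable_ext \<C> \<delta> (F \<oplus>\<^bsub>?H\<^esub> G) = stable_ext \<C> \<delta> F \<oplus>\<^bsub>Ext \<C> X N\<^esub> stable_ext \<C> \<delta> G"
      unfolding f(2) g(2) stable_add[OF f(1) g(1)] stable_ext_class[OF fg \<delta>]
        stable_ext_class[OF f(1) \<delta>] stable_ext_class[OF g(1) \<delta>] by (rule pull_add_arr[OF \<delta> f(1) g(1)])
  qed
  have smult: "k \<odot>\<^bsub>?H\<^esub> F \<in> carrier ?H"
    "stable_ext \<C> \<delta> (k \<odot>\<^bsub>?H\<^esub> F) = k \<odot>\<^bsub>Ext \<C> X N\<^esub> stable_ext \<C> \<delta> F"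
    if k: "k \<in> carrier K" and F: "F \<in> carrier ?H" for k F
  proof -
    obtain f where f: "f \<in> arr \<C> X B" "F = stable_class \<C> X B f" using stable_hom_carrier[OF X F] .
    note kf = arr_smult[OF k f(1)]
    show "k \<odot>\<^bsub>?H\<^esub> F \<in> carrier ?H"
      unfolding f(2) stable_smult[OF k f(1)] by (rule stable_class_carrier[OF kf(1)])
    show "stable_ext \<C> \<delta> (k \<odot>\<^bsub>?H\<^esub> F) = k \<odot>\<^bsub>Ext \<C> X N\<^esub> stable_ext \<C> \<delta> F"
      unfolding f(2) stable_smult[OF k f(1)] stable_ext_class[OF kf(1) \<delta>] stable_ext_class[OF f(1) \<delta>]
      by (rule kf(2))
  qed
  have zero: "\<zero>\<^bsub>?H\<^esub> \<in> carrier ?H" "stable_ext \<C> \<delta> \<zero>\<^bsub>?H\<^esub> = \<zero>\<^bsub>Ext \<C> X N\<^esub>"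
    unfolding stable_zero[OF X] stable_ext_class[OF arr_zero[OF X B_Obj] \<delta>]
    by (rule stable_class_carrier[OF arr_zero[OF X B_Obj]]) (rule pull_zero_arr[OF \<delta> X])
  show "vectorspace K ?H"
    using vectorspace_transport[OF ext_vectorspace[OF N_Obj X] stable_ext_bij[OF X] zero add smult] .
  show "stable_ext \<C> \<delta> \<in> module_hom K ?H (Ext \<C> X N)"
    by (rule module_homI) (use bij_betwE[OF stable_ext_bij[OF X]] add(2) smult(2) in blast)+
qed

end

section \<open>Duality of extensions, stable composition and suspension\<close>

lemma stable_category_simps [simp]:
  "Obj (stable_category \<C>) = Obj \<C>" "Hom (stable_category \<C>) = stable_hom \<C>"
  by (simp_all add: stable_category_def)

lemma stable_homE:
  assumes "X \<in> Obj \<C>" "Y \<in> Obj \<C>" "F \<in> carrier (stable_hom \<C> X Y)"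
  obtains f where "f \<in> arr \<C> X Y" "F = stable_class \<C> X Y f"
proof -
  have "F \<in> stable_class \<C> X Y ` mor \<C> X Y" using assms(3) by (simp add: stable_hom_def)
  then obtain f where f: "F = stable_class \<C> X Y f" "f \<in> mor \<C> X Y" by (rule imageE)
  show ?thesis using arrI[OF assms(1,2) f(2)] f(1) by (rule that)
qed

text \<open>The Calabi-Yau duality with extensions in place of stable morphisms to a suspension.
  Only \<open>Ext\<close>, \<open>push\<close> and \<open>pull\<close> occur, and a full subcategory
  keeps all three, so the condition restricts unchanged.\<close>

definition ext_duality ::
  "('k, 'r) ring_scheme \<Rightarrow> ('k, 'o, 'm, 'e) extri_cat \<Rightarrow> ('o \<Rightarrow> 'o \<Rightarrow> 'e \<Rightarrow> 'e \<Rightarrow> 'k) \<Rightarrow> bool" where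
  "ext_duality K \<C> \<Psi> \<longleftrightarrow>
     (\<forall>X \<in> Obj \<C>. \<forall>Y \<in> Obj \<C>. \<Psi> X Y \<in> module_hom K (Ext \<C> X Y) (dual_space K (Ext \<C> Y X)) \<and>
        bij_betw (\<Psi> X Y) (carrier (Ext \<C> X Y)) (carrier (dual_space K (Ext \<C> Y X)))) \<and>
     (\<forall>X X' Y Y'. \<forall>u \<in> arr \<C> X' X. \<forall>v \<in> arr \<C> Y Y'. \<forall>\<delta> \<in> exts \<C> X Y. \<forall>\<gamma> \<in> exts \<C> Y' X'.
        \<Psi> X' Y' (push \<C> v (pull \<C> u \<delta>)) \<gamma> = \<Psi> X Y \<delta> (push \<C> u (pull \<C> v \<gamma>)))"

text \<open>The dual of a zero space has a single element, and \<open>\<Psi> Y X\<close> embeds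
  \<open>Ext Y X\<close> into the dual of \<open>Ext X Y\<close>.\<close>

lemma (in extriangulated) ext_duality_sym:
  assumes \<Psi>: "ext_duality K \<C> \<Psi>" and v: "ext_vanish \<C> X Y"
  shows "ext_vanish \<C> Y X"
proof (rule ext_vanishI)
  show O: "Y \<in> Obj \<C>" "X \<in> Obj \<C>" using v by (simp_all add: ext_vanish_def)
  have bij: "bij_betw (\<Psi> Y X) (carrier (Ext \<C> Y X)) (carrier (dual_space K (Ext \<C> X Y)))"
    using \<Psi> O unfolding ext_duality_def by blast
  have cX: "carrier (Ext \<C> X Y) = {\<zero>\<^bsub>Ext \<C> X Y\<^esub>}" using v by (simp add: ext_vanish_def)
  have zero: "\<phi> \<zero>\<^bsub>Ext \<C> X Y\<^esub> = \<zero>" if "\<phi> \<in> module_hom K (Ext \<C> X Y) (self_module K)" for \<phi>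
  proof -
    let ?z = "\<zero>\<^bsub>Ext \<C> X Y\<^esub>"
    have z: "?z \<in> carrier (Ext \<C> X Y)" using cX by simp
    have zz: "?z \<oplus>\<^bsub>Ext \<C> X Y\<^esub> ?z = ?z"
      using abelian_groupE(5)[OF ext_group[OF O(2,1)] z] .
    have c: "\<phi> ?z \<in> carrier K" using module_hom_carrier[OF that z] by simp
    have "\<phi> ?z \<oplus> \<phi> ?z = \<phi> ?z" using module_hom_add[OF that z z] zz by simp
    then show ?thesis using c add.r_cancel_one by simp
  qed
  have "\<phi> = \<psi>" if "\<phi> \<in> carrier (dual_space K (Ext \<C> X Y))" "\<psi> \<in> carrier (dual_space K (Ext \<C> X Y))" for \<phi> \<psi>
  proof (rule extensionalityI[of _ "carrier (Ext \<C> X Y)"])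
    fix e assume "e \<in> carrier (Ext \<C> X Y)"
    then show "\<phi> e = \<psi> e" using that zero[of \<phi>] zero[of \<psi>] cX by (simp add: dual_space_simps)
  qed (use that in \<open>simp_all add: dual_space_simps\<close>)
  then have eq: "\<Psi> Y X \<delta> = \<Psi> Y X \<gamma>" if "\<delta> \<in> carrier (Ext \<C> Y X)" "\<gamma> \<in> carrier (Ext \<C> Y X)" for \<delta> \<gamma>
    using bij_betwE[OF bij] that by simp
  fix \<delta> assume d: "\<delta> \<in> exts \<C> Y X"
  show "\<delta> = \<zero>\<^bsub>Ext \<C> Y X\<^esub>"
    using inj_onD[OF bij_betw_imp_inj_on[OF bij] eq] extsD(3)[OF d] extsD(3)[OF exts_zero[OF O]] by simp
qed

locale frobenius_category = extriangulated K \<C>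
  for K :: "('k, 'r) ring_scheme" (structure) and \<C> :: "('k, 'o, 'm, 'e) extri_cat" +
  assumes frobenius: "frobenius \<C>"
begin

text \<open>No minimality is meant: any deflation from a projective serves. Its use is to make
  \<open>stable_conflation\<close> available at an arbitrary target.\<close>

lemma projective_cover:
  assumes "A \<in> Obj \<C>"
  obtains N x P y \<delta> where "conflation \<C> N x P y A \<delta>" "stable_conflation K \<C> N x P y A \<delta>"
proof -
  have "\<exists>P \<in> projectives \<C>. \<exists>y. is_deflation \<C> P A y"
    using frobenius assms unfolding frobenius_def by blast
  then obtain P N x y \<delta> where 1: "P \<in> projectives \<C>" "conflation \<C> N x P y A \<delta>"
    unfolding is_deflation_iff by (elim bexE exE)
  have "P \<in> proj_inj \<C>" using frobenius 1(1) by (simp add: frobenius_def proj_inj_def)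
  then have "stable_conflation K \<C> N x P y A \<delta>"
    using 1(2) by (intro stable_conflation.intro stable_conflation_axioms.intro extriangulated_axioms)
  with 1(2) show ?thesis by (rule that)
qed

lemma suspension_exists: "\<exists>\<Sigma> \<epsilon>. is_suspension \<C> \<Sigma> \<epsilon>"
proof -
  have "\<exists>t. fst t \<in> Obj \<C> \<and> snd t \<in> carrier (Ext \<C> (fst t) A) \<and>
      (\<exists>x I y. I \<in> proj_inj \<C> \<and> (x, I, y) \<in> realise \<C> (fst t) A (snd t))" if A: "A \<in> Obj \<C>" for A
  proof -
    have "\<exists>I \<in> injectives \<C>. \<exists>x. is_inflation \<C> A I x"
      using frobenius A unfolding frobenius_def by blast
    then obtain I x y S \<epsilon> where 1: "I \<in> injectives \<C>" "conflation \<C> A x I y S \<epsilon>"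
      unfolding is_inflation_iff by (elim bexE exE)
    have "I \<in> proj_inj \<C>" using frobenius 1(1) by (simp add: frobenius_def proj_inj_def)
    then show ?thesis
      using 1(2) by (intro exI[of _ "(S, \<epsilon>)"]) (auto simp: conflation_def exts_def)
  qed
  \<comment> \<open>The object and the class are chosen as one pair, since the class has to live
    over the chosen object.\<close>
  then obtain t where t: "\<And>A. A \<in> Obj \<C> \<Longrightarrow> fst (t A) \<in> Obj \<C> \<and> snd (t A) \<in> carrier (Ext \<C> (fst (t A)) A) \<and>
      (\<exists>x I y. I \<in> proj_inj \<C> \<and> (x, I, y) \<in> realise \<C> (fst (t A)) A (snd (t A)))" by metis
  have "is_suspension \<C> (\<lambda>A. fst (t A)) (\<lambda>A. snd (t A))" unfolding is_suspension_def using t by simp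
  then show ?thesis by blast
qed

lemma stable_class_self:
  assumes f: "f \<in> arr \<C> X B"
  shows "f \<in> stable_class \<C> X B f"
proof -
  obtain N x P y \<delta> where "stable_conflation K \<C> N x P y B \<delta>" using projective_cover[OF arrD(2)[OF f]] .
  then interpret stable_conflation K \<C> N x P y B \<delta> .
  show ?thesis by (rule stable_class_refl[OF f])
qed

text \<open>Stable composition is a union over all typings and all representatives. Disjointness of
  the morphism spaces fixes the typing, and pulling back \<delta> shows that every choice of
  representatives gives the same class, so the union has a single member.\<close>

lemma stable_comp:
  assumes f: "f \<in> arr \<C> X Y" and g: "g \<in> arr \<C> Y W"
  shows "stable_class \<C> Y W g \<cdot>\<^bsub>stable_category \<C>\<^esub> stable_class \<C> X Y f = stable_class \<C> X W (g \<bullet> f)"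
proof -
  obtain N x P y \<delta> where "stable_conflation K \<C> N x P y W \<delta>" using projective_cover[OF arrD(2)[OF g]] .
  then interpret stable_conflation K \<C> N x P y W \<delta> .
  let ?S = "{stable_class \<C> A C (b \<bullet> a) | A B C a b. A \<in> Obj \<C> \<and> B \<in> Obj \<C> \<and> C \<in> Obj \<C> \<and>
     a \<in> stable_class \<C> X Y f \<inter> mor \<C> A B \<and> b \<in> stable_class \<C> Y W g \<inter> mor \<C> B C}"
  note O = arrD(1,2)[OF f] arrD(2)[OF g]
  have mem: "f \<in> stable_class \<C> X Y f" "g \<in> stable_class \<C> Y W g"
    using stable_class_self f g by blast+
  have "T = stable_class \<C> X W (g \<bullet> f)" if T: "T \<in> ?S" for T
  proof -
    obtain A B C a b where ab: "A \<in> Obj \<C>" "B \<in> Obj \<C>" "C \<in> Obj \<C>" "a \<in> stable_class \<C> X Y f" "a \<in> mor \<C> A B"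
       "b \<in> stable_class \<C> Y W g" "b \<in> mor \<C> B C" "T = stable_class \<C> A C (b \<bullet> a)"
      using T by blast
    obtain N' x' P' y' \<delta>' where sc: "stable_conflation K \<C> N' x' P' y' Y \<delta>'" using projective_cover[OF O(2)] .
    have a: "a \<in> arr \<C> X Y"
      using ab(4) stable_conflation.stable_class_iff[OF sc f] by blast
    have b: "b \<in> arr \<C> Y W" "pull \<C> b \<delta> = pull \<C> g \<delta>"
      using ab(6) stable_class_iff[OF g] by blast+
    have "A = X \<and> B = Y" by (rule hom_disjoint[OF ab(1,2) O(1,2) ab(5) arrD(3)[OF a]])
    moreover have "B = Y \<and> C = W" by (rule hom_disjoint[OF ab(2,3) O(2,3) ab(7) arrD(3)[OF b(1)]])
    ultimately have T': "T = stable_class \<C> X W (b \<bullet> a)" using ab(8) by simp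
    \<comment> \<open>Replacing \<open>g\<close> by \<open>b\<close> does not change the pullback of
      \<delta>; replacing \<open>f\<close> by \<open>a\<close> changes no pullback at all, in
      particular not that of \<open>pull g \<delta>\<close>.\<close>
    have "pull \<C> (b \<bullet> a) \<delta> = pull \<C> (g \<bullet> f) \<delta>"
      unfolding ext_pull_comp[OF b(1) a \<delta>] ext_pull_comp[OF g f \<delta>] b(2)
      by (rule stable_class_pull(2)[OF ab(4) f exts_pull[OF g \<delta>]])
    then show ?thesis
      unfolding T' stable_class_eq_iff[OF arr_comp[OF b(1) a] arr_comp[OF g f]] .
  qed
  moreover have "stable_class \<C> X W (g \<bullet> f) \<in> ?S"
    using O mem arrD(3)[OF f] arrD(3)[OF g] by blast
  ultimately have "\<Union>?S = stable_class \<C> X W (g \<bullet> f)" by blast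
  then show ?thesis by (simp add: stable_category_def)
qed

end

locale suspended = frobenius_category K \<C>
  for K :: "('k, 'r) ring_scheme" (structure) and \<C> :: "('k, 'o, 'm, 'e) extri_cat" +
  fixes \<Sigma> \<epsilon>
  assumes susp: "is_suspension \<C> \<Sigma> \<epsilon>"
begin

lemma susp_conflation:
  assumes "A \<in> Obj \<C>"
  obtains x I y where "conflation \<C> A x I y (\<Sigma> A) (\<epsilon> A)" "stable_conflation K \<C> A x I y (\<Sigma> A) (\<epsilon> A)"
    "I \<in> proj_inj \<C>"
proof -
  obtain x I y where 1: "\<Sigma> A \<in> Obj \<C>" "\<epsilon> A \<in> carrier (Ext \<C> (\<Sigma> A) A)" "I \<in> proj_inj \<C>"
    "(x, I, y) \<in> realise \<C> (\<Sigma> A) A (\<epsilon> A)"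
    using susp assms unfolding is_suspension_def by blast
  then have c: "conflation \<C> A x I y (\<Sigma> A) (\<epsilon> A)" using assms by (simp add: conflation_def exts_def)
  then have "stable_conflation K \<C> A x I y (\<Sigma> A) (\<epsilon> A)"
    using 1(3) by (intro stable_conflation.intro stable_conflation_axioms.intro extriangulated_axioms)
  with c show ?thesis using 1(3) by (rule that)
qed

lemma susp_ext: "A \<in> Obj \<C> \<Longrightarrow> \<epsilon> A \<in> exts \<C> (\<Sigma> A) A"
  using susp by (simp add: is_suspension_def exts_def)

lemma susp_Obj: "A \<in> Obj \<C> \<Longrightarrow> \<Sigma> A \<in> Obj \<C>"
  using susp by (simp add: is_suspension_def)

abbreviation \<theta> where "\<theta> Y \<equiv> stable_ext \<C> (\<epsilon> Y)"

lemma susp_ext_iso: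
  assumes "X \<in> Obj \<C>" "Y \<in> Obj \<C>"
  shows "vectorspace K (stable_hom \<C> X (\<Sigma> Y))"
    "\<theta> Y \<in> module_hom K (stable_hom \<C> X (\<Sigma> Y)) (Ext \<C> X Y)"
    "bij_betw (\<theta> Y) (carrier (stable_hom \<C> X (\<Sigma> Y))) (carrier (Ext \<C> X Y))"
proof -
  obtain x I y where "stable_conflation K \<C> Y x I y (\<Sigma> Y) (\<epsilon> Y)" using susp_conflation[OF assms(2)] .
  then interpret stable_conflation K \<C> Y x I y "\<Sigma> Y" "\<epsilon> Y" .
  show "vectorspace K (stable_hom \<C> X (\<Sigma> Y))"
    "\<theta> Y \<in> module_hom K (stable_hom \<C> X (\<Sigma> Y)) (Ext \<C> X Y)"
    "bij_betw (\<theta> Y) (carrier (stable_hom \<C> X (\<Sigma> Y))) (carrier (Ext \<C> X Y))"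
    using stable_hom_space[OF assms(1)] stable_ext_bij[OF assms(1)] .
qed

lemma susp_ext_class:
  assumes f: "f \<in> arr \<C> X (\<Sigma> Y)" and "Y \<in> Obj \<C>"
  shows "\<theta> Y (stable_class \<C> X (\<Sigma> Y) f) = pull \<C> f (\<epsilon> Y)"
    "stable_class \<C> X (\<Sigma> Y) f \<in> carrier (stable_hom \<C> X (\<Sigma> Y))"
proof -
  obtain x I y where "stable_conflation K \<C> Y x I y (\<Sigma> Y) (\<epsilon> Y)" using susp_conflation[OF assms(2)] .
  then interpret stable_conflation K \<C> Y x I y "\<Sigma> Y" "\<epsilon> Y" .
  show "\<theta> Y (stable_class \<C> X (\<Sigma> Y) f) = pull \<C> f (\<epsilon> Y)" by (rule stable_ext_class[OF f \<delta>])
  show "stable_class \<C> X (\<Sigma> Y) f \<in> carrier (stable_hom \<C> X (\<Sigma> Y))" by (rule stable_class_carrier[OF f])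
qed

lemma ext_class:
  assumes d: "\<delta> \<in> exts \<C> X Y"
  obtains f where "f \<in> arr \<C> X (\<Sigma> Y)" "\<delta> = pull \<C> f (\<epsilon> Y)"
proof -
  note O = extsD[OF d]
  have "\<delta> \<in> \<theta> Y ` carrier (stable_hom \<C> X (\<Sigma> Y))"
    using bij_betw_imp_surj_on[OF susp_ext_iso(3)[OF O(1,2)]] O(3) by simp
  then obtain F where F: "\<delta> = \<theta> Y F" "F \<in> carrier (stable_hom \<C> X (\<Sigma> Y))" by (rule imageE)
  obtain f where f: "f \<in> arr \<C> X (\<Sigma> Y)" "F = stable_class \<C> X (\<Sigma> Y) f"
    using stable_homE[OF O(1) susp_Obj[OF O(2)] F(2)] .
  have "\<delta> = pull \<C> f (\<epsilon> Y)" using susp_ext_class(1)[OF f(1) O(2)] F(1) f(2) by simp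
  with f(1) show ?thesis by (rule that)
qed

text \<open>All \<open>w\<close> in the class of \<open>v\<close> have the same
  \<open>push w (\<epsilon> A)\<close>, and by \<open>stable_class_iff\<close> the maps pulling
  \<open>\<epsilon> B\<close> back to that extension form one coset. The set defining
  \<open>susp_map\<close> is therefore a stable class.\<close>

lemma susp_map_class:
  assumes v: "v \<in> arr \<C> A B"
  obtains c where "c \<in> arr \<C> (\<Sigma> A) (\<Sigma> B)" "push \<C> v (\<epsilon> A) = pull \<C> c (\<epsilon> B)"
    "susp_map \<C> \<Sigma> \<epsilon> A B (stable_class \<C> A B v) = stable_class \<C> (\<Sigma> A) (\<Sigma> B) c"
proof -
  note O = arrD(1,2)[OF v] and eA = susp_ext[OF arrD(1)[OF v]]
  obtain c where c: "c \<in> arr \<C> (\<Sigma> A) (\<Sigma> B)" "push \<C> v (\<epsilon> A) = pull \<C> c (\<epsilon> B)"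
    using ext_class[OF exts_push[OF v eA]] .
  obtain x I y where "stable_conflation K \<C> B x I y (\<Sigma> B) (\<epsilon> B)" using susp_conflation[OF O(2)] .
  then interpret stable_conflation K \<C> B x I y "\<Sigma> B" "\<epsilon> B" .
  have push: "push \<C> w (\<epsilon> A) = push \<C> v (\<epsilon> A)" if "w \<in> stable_class \<C> A B v" for w
    by (rule stable_class_push[OF that v eA])
  have *: "d \<in> susp_map \<C> \<Sigma> \<epsilon> A B (stable_class \<C> A B v) \<longleftrightarrow>
     d \<in> arr \<C> (\<Sigma> A) (\<Sigma> B) \<and> push \<C> v (\<epsilon> A) = pull \<C> d (\<epsilon> B)" for d
  proof
    assume "d \<in> susp_map \<C> \<Sigma> \<epsilon> A B (stable_class \<C> A B v)"
    then obtain w where w: "d \<in> mor \<C> (\<Sigma> A) (\<Sigma> B)" "w \<in> stable_class \<C> A B v"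
      "push \<C> w (\<epsilon> A) = pull \<C> d (\<epsilon> B)" unfolding susp_map_def by blast
    show "d \<in> arr \<C> (\<Sigma> A) (\<Sigma> B) \<and> push \<C> v (\<epsilon> A) = pull \<C> d (\<epsilon> B)"
      using arrI[OF arrD(1,2)[OF c(1)] w(1)] push[OF w(2)] w(3) by simp
  next
    assume "d \<in> arr \<C> (\<Sigma> A) (\<Sigma> B) \<and> push \<C> v (\<epsilon> A) = pull \<C> d (\<epsilon> B)"
    then show "d \<in> susp_map \<C> \<Sigma> \<epsilon> A B (stable_class \<C> A B v)"
      using stable_class_self[OF v] arrD(3)[of d \<C> "\<Sigma> A" "\<Sigma> B"] unfolding susp_map_def by blast
  qed
  have "susp_map \<C> \<Sigma> \<epsilon> A B (stable_class \<C> A B v) = stable_class \<C> (\<Sigma> A) (\<Sigma> B) c"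
    by (rule Set.set_eqI, unfold * stable_class_iff[OF c(1)] c(2)) (rule conj_cong[OF refl eq_commute])
  with c show ?thesis by (rule that)
qed

text \<open>Under \<theta> the two-sided action of stable morphisms, through the suspension on the
  left, becomes push and pull of extensions. This is what matches the two naturality
  conditions.\<close>

lemma susp_ext_natural:
  assumes u: "u \<in> arr \<C> X' X" and v: "v \<in> arr \<C> Y Y'" and f: "f \<in> arr \<C> X (\<Sigma> Y)"
  obtains h where "h \<in> arr \<C> X' (\<Sigma> Y')"
    "susp_map \<C> \<Sigma> \<epsilon> Y Y' (stable_class \<C> Y Y' v) \<cdot>\<^bsub>stable_category \<C>\<^esub> stable_class \<C> X (\<Sigma> Y) f
       \<cdot>\<^bsub>stable_category \<C>\<^esub> stable_class \<C> X' X u = stable_class \<C> X' (\<Sigma> Y') h"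
    "pull \<C> h (\<epsilon> Y') = push \<C> v (pull \<C> u (pull \<C> f (\<epsilon> Y)))"
proof -
  obtain c where c: "c \<in> arr \<C> (\<Sigma> Y) (\<Sigma> Y')" "push \<C> v (\<epsilon> Y) = pull \<C> c (\<epsilon> Y')"
    "susp_map \<C> \<Sigma> \<epsilon> Y Y' (stable_class \<C> Y Y' v) = stable_class \<C> (\<Sigma> Y) (\<Sigma> Y') c"
    using susp_map_class[OF v] .
  note eY = susp_ext[OF arrD(1)[OF v]] and eY' = susp_ext[OF arrD(2)[OF v]]
  note cf = arr_comp[OF c(1) f]
  show ?thesis
  proof (rule that[OF arr_comp[OF cf u]])
    show "susp_map \<C> \<Sigma> \<epsilon> Y Y' (stable_class \<C> Y Y' v) \<cdot>\<^bsub>stable_category \<C>\<^esub> stable_class \<C> X (\<Sigma> Y) f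
       \<cdot>\<^bsub>stable_category \<C>\<^esub> stable_class \<C> X' X u = stable_class \<C> X' (\<Sigma> Y') (c \<bullet> f \<bullet> u)"
      unfolding c(3) stable_comp[OF f c(1)] stable_comp[OF u cf] ..
    show "pull \<C> (c \<bullet> f \<bullet> u) (\<epsilon> Y') = push \<C> v (pull \<C> u (pull \<C> f (\<epsilon> Y)))"
      unfolding ext_pull_comp[OF cf u eY'] ext_pull_comp[OF c(1) f eY'] c(2)[symmetric]
        ext_push_pull[OF v f eY, symmetric] ext_push_pull[OF v u exts_pull[OF f eY]] ..
  qed
qed

end

text \<open>Extensions of \<open>X\<close> by \<open>Y\<close> are stable maps from \<open>X\<close>
  to the suspension of \<open>Y\<close>. Conversely, stable maps from \<open>X\<close> to
  \<open>Y\<close> are extensions of \<open>X\<close> by the kernel \<open>N\<close> of a projective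
  deflation onto \<open>Y\<close>.\<close>

lemma (in frobenius_category) stable_hom_fin_dim_iff:
  "(\<forall>X \<in> Obj \<C>. \<forall>Y \<in> Obj \<C>. vectorspace.fin_dim K (stable_hom \<C> X Y)) \<longleftrightarrow>
   (\<forall>X \<in> Obj \<C>. \<forall>Y \<in> Obj \<C>. vectorspace.fin_dim K (Ext \<C> X Y))"
proof (intro iffI ballI)
  fix X Y assume fin: "\<forall>X \<in> Obj \<C>. \<forall>Y \<in> Obj \<C>. vectorspace.fin_dim K (stable_hom \<C> X Y)"
    and O: "X \<in> Obj \<C>" "Y \<in> Obj \<C>"
  obtain \<Sigma> \<epsilon> where "is_suspension \<C> \<Sigma> \<epsilon>" using suspension_exists by blast
  then interpret suspended K \<C> \<Sigma> \<epsilon> by unfold_locales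
  show "vectorspace.fin_dim K (Ext \<C> X Y)"
    using fin_dim_image[OF susp_ext_iso(1)[OF O] ext_vectorspace[OF O(2,1)] susp_ext_iso(2)[OF O]
        bij_betw_imp_surj_on[OF susp_ext_iso(3)[OF O]]] fin O susp_Obj by simp
next
  fix X Y assume fin: "\<forall>X \<in> Obj \<C>. \<forall>Y \<in> Obj \<C>. vectorspace.fin_dim K (Ext \<C> X Y)"
    and O: "X \<in> Obj \<C>" "Y \<in> Obj \<C>"
  obtain N x P y \<delta> where "stable_conflation K \<C> N x P y Y \<delta>" using projective_cover[OF O(2)] .
  then interpret stable_conflation K \<C> N x P y Y \<delta> .
  note h = stable_hom_space[OF O(1)] and b = stable_ext_bij[OF O(1)]
  have m: "module K (stable_hom \<C> X Y)" using h(1) by (simp add: vectorspace_def)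
  show "vectorspace.fin_dim K (stable_hom \<C> X Y)"
    by (rule fin_dim_image[OF ext_vectorspace[OF N_Obj O(1)] h(1) module_hom_inv[OF m h(2) b]
        bij_betw_imp_surj_on[OF bij_betw_inv_into[OF b]]]) (use fin O(1) N_Obj in simp)
qed

section \<open>Stable Calabi-Yau pairings and dualities of extensions\<close>

definition cy_pairing ::
  "('k, 'r) ring_scheme \<Rightarrow> ('k, 'o, 'm, 'e) extri_cat \<Rightarrow> ('o \<Rightarrow> 'o) \<Rightarrow> ('o \<Rightarrow> 'e) \<Rightarrow>
   ('o \<Rightarrow> 'o \<Rightarrow> 'm set \<Rightarrow> 'm set \<Rightarrow> 'k) \<Rightarrow> bool" where
  "cy_pairing K \<C> \<Sigma> \<epsilon> \<Phi> \<longleftrightarrow> (let \<S> = stable_category \<C> in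
        (\<forall>X \<in> Obj \<S>. \<forall>Y \<in> Obj \<S>.
           \<Phi> X Y \<in> module_hom K (Hom \<S> X (\<Sigma> Y)) (dual_space K (Hom \<S> Y (\<Sigma> X))) \<and>
           bij_betw (\<Phi> X Y) (mor \<S> X (\<Sigma> Y)) (carrier (dual_space K (Hom \<S> Y (\<Sigma> X))))) \<and>
        (\<forall>X \<in> Obj \<S>. \<forall>X' \<in> Obj \<S>. \<forall>Y \<in> Obj \<S>. \<forall>Y' \<in> Obj \<S>.
           \<forall>U \<in> mor \<S> X' X. \<forall>V \<in> mor \<S> Y Y'. \<forall>F \<in> mor \<S> X (\<Sigma> Y). \<forall>G \<in> mor \<S> Y' (\<Sigma> X').
             \<Phi> X' Y' (susp_map \<C> \<Sigma> \<epsilon> Y Y' V \<cdot>\<^bsub>\<S>\<^esub> F \<cdot>\<^bsub>\<S>\<^esub> U) G =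
             \<Phi> X Y F (susp_map \<C> \<Sigma> \<epsilon> X' X U \<cdot>\<^bsub>\<S>\<^esub> G \<cdot>\<^bsub>\<S>\<^esub> V)))"

lemma stably_2_calabi_yau_iff:
  "stably_2_calabi_yau K \<C> \<longleftrightarrow>
    (\<forall>X \<in> Obj \<C>. \<forall>Y \<in> Obj \<C>. vectorspace.fin_dim K (stable_hom \<C> X Y)) \<and>
    (\<exists>\<Sigma> \<epsilon> \<Phi>. is_suspension \<C> \<Sigma> \<epsilon> \<and> cy_pairing K \<C> \<Sigma> \<epsilon> \<Phi>)"
  unfolding stably_2_calabi_yau_def cy_pairing_def Let_def stable_category_simps ..

context suspended
begin

text \<open>The pairing \<Phi> is evaluated on the stable classes that \<theta> assigns to two
  extensions, \<open>J\<close> being the inverse of \<theta>. Naturality carries over by applying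
  \<open>susp_ext_natural\<close> once in each variable.\<close>

lemma ext_duality_of_pairing:
  assumes \<Phi>: "cy_pairing K \<C> \<Sigma> \<epsilon> \<Phi>"
  shows "\<exists>\<Psi>. ext_duality K \<C> \<Psi>"
proof -
  define J where "J X Y = inv_into (carrier (stable_hom \<C> X (\<Sigma> Y))) (\<theta> Y)" for X Y
  have J: "J X Y (pull \<C> f (\<epsilon> Y)) = stable_class \<C> X (\<Sigma> Y) f" if f: "f \<in> arr \<C> X (\<Sigma> Y)" and Y: "Y \<in> Obj \<C>" for X Y f
    unfolding J_def using bij_betw_inv_into_left[OF susp_ext_iso(3)[OF arrD(1)[OF f] Y] susp_ext_class(2)[OF f Y]]
    by (simp add: susp_ext_class(1)[OF f Y])
  have Jhom: "J X Y \<in> module_hom K (Ext \<C> X Y) (stable_hom \<C> X (\<Sigma> Y))"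
    "bij_betw (J X Y) (carrier (Ext \<C> X Y)) (carrier (stable_hom \<C> X (\<Sigma> Y)))"
    if O: "X \<in> Obj \<C>" "Y \<in> Obj \<C>" for X Y
    unfolding J_def using module_hom_inv[OF _ susp_ext_iso(2,3)[OF O]] susp_ext_iso(1)[OF O] bij_betw_inv_into[OF susp_ext_iso(3)[OF O]]
    by (simp_all add: vectorspace_def)
  define \<Psi> where "\<Psi> X Y = (\<lambda>\<delta>. \<lambda>\<gamma> \<in> carrier (Ext \<C> Y X). \<Phi> X Y (J X Y \<delta>) (J Y X \<gamma>))" for X Y
  have "ext_duality K \<C> \<Psi>"
    unfolding ext_duality_def
  proof (intro conjI ballI allI)
    fix X Y assume O: "X \<in> Obj \<C>" "Y \<in> Obj \<C>"
    have m: "module K (stable_hom \<C> Y (\<Sigma> X))" using susp_ext_iso(1)[OF O(2,1)] by (simp add: vectorspace_def)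
    have p: "\<Phi> X Y \<in> module_hom K (stable_hom \<C> X (\<Sigma> Y)) (dual_space K (stable_hom \<C> Y (\<Sigma> X)))"
      "bij_betw (\<Phi> X Y) (carrier (stable_hom \<C> X (\<Sigma> Y))) (carrier (dual_space K (stable_hom \<C> Y (\<Sigma> X))))"
      using \<Phi> O unfolding cy_pairing_def Let_def stable_category_simps by simp_all
    note t = dual_transport[OF m ext_module[OF O(2,1)] Jhom[OF O] Jhom[OF O(2,1)] p]
    show "\<Psi> X Y \<in> module_hom K (Ext \<C> X Y) (dual_space K (Ext \<C> Y X))" unfolding \<Psi>_def by (rule t(1))
    show "bij_betw (\<Psi> X Y) (carrier (Ext \<C> X Y)) (carrier (dual_space K (Ext \<C> Y X)))"
      unfolding \<Psi>_def by (rule t(2))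
  next
    fix X X' Y Y' u v \<delta> \<gamma>
    assume u: "u \<in> arr \<C> X' X" and v: "v \<in> arr \<C> Y Y'" and \<delta>: "\<delta> \<in> exts \<C> X Y" and \<gamma>: "\<gamma> \<in> exts \<C> Y' X'"
    note O = arrD(1,2)[OF u] arrD(1,2)[OF v]
    obtain f where f: "f \<in> arr \<C> X (\<Sigma> Y)" "\<delta> = pull \<C> f (\<epsilon> Y)" using ext_class[OF \<delta>] .
    obtain g where g: "g \<in> arr \<C> Y' (\<Sigma> X')" "\<gamma> = pull \<C> g (\<epsilon> X')" using ext_class[OF \<gamma>] .
    let ?U = "stable_class \<C> X' X u" and ?V = "stable_class \<C> Y Y' v"
    let ?F = "stable_class \<C> X (\<Sigma> Y) f" and ?G = "stable_class \<C> Y' (\<Sigma> X') g"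
    let ?S = "stable_category \<C>"
    obtain h where h: "h \<in> arr \<C> X' (\<Sigma> Y')"
      "susp_map \<C> \<Sigma> \<epsilon> Y Y' ?V \<cdot>\<^bsub>?S\<^esub> ?F \<cdot>\<^bsub>?S\<^esub> ?U = stable_class \<C> X' (\<Sigma> Y') h"
      "pull \<C> h (\<epsilon> Y') = push \<C> v (pull \<C> u \<delta>)"
      using susp_ext_natural[OF u v f(1), folded f(2)] .
    obtain k where k: "k \<in> arr \<C> Y (\<Sigma> X)"
      "susp_map \<C> \<Sigma> \<epsilon> X' X ?U \<cdot>\<^bsub>?S\<^esub> ?G \<cdot>\<^bsub>?S\<^esub> ?V = stable_class \<C> Y (\<Sigma> X) k"
      "pull \<C> k (\<epsilon> X) = push \<C> u (pull \<C> v \<gamma>)"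
      using susp_ext_natural[OF v u g(1), folded g(2)] .
    have UV: "?U \<in> carrier (stable_hom \<C> X' X)" "?V \<in> carrier (stable_hom \<C> Y Y')"
      using arrD(3)[OF u] arrD(3)[OF v] by (simp_all add: stable_hom_def)
    have eq: "\<Phi> X' Y' (susp_map \<C> \<Sigma> \<epsilon> Y Y' ?V \<cdot>\<^bsub>?S\<^esub> ?F \<cdot>\<^bsub>?S\<^esub> ?U) ?G =
        \<Phi> X Y ?F (susp_map \<C> \<Sigma> \<epsilon> X' X ?U \<cdot>\<^bsub>?S\<^esub> ?G \<cdot>\<^bsub>?S\<^esub> ?V)"
      using \<Phi> O UV susp_ext_class(2)[OF f(1) O(3)] susp_ext_class(2)[OF g(1) O(1)]
      unfolding cy_pairing_def Let_def stable_category_simps by blast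
    have k': "pull \<C> k (\<epsilon> X) \<in> carrier (Ext \<C> Y X)"
      using extsD(3)[OF exts_pull[OF k(1) susp_ext[OF O(2)]]] .
    have "\<Psi> X' Y' (push \<C> v (pull \<C> u \<delta>)) \<gamma> = \<Phi> X' Y' (stable_class \<C> X' (\<Sigma> Y') h) ?G"
      unfolding \<Psi>_def h(3)[symmetric] J[OF h(1) O(4)] using extsD(3)[OF \<gamma>] J[OF g(1) O(1)] g(2) by simp
    also have "\<dots> = \<Phi> X Y ?F (stable_class \<C> Y (\<Sigma> X) k)" using eq unfolding h(2) k(2) .
    also have "\<dots> = \<Psi> X Y \<delta> (push \<C> u (pull \<C> v \<gamma>))"
      unfolding \<Psi>_def k(3)[symmetric] using k' J[OF k(1) O(2)] J[OF f(1) O(3)] f(2) by simp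
    finally show "\<Psi> X' Y' (push \<C> v (pull \<C> u \<delta>)) \<gamma> = \<Psi> X Y \<delta> (push \<C> u (pull \<C> v \<gamma>))" .
  qed
  then show ?thesis by blast
qed

text \<open>The suspension is arbitrary. In the perpendicular category, whose suspension need not be
  the ambient one, the pairing can thus be rebuilt over any suspension chosen there.\<close>

lemma pairing_of_ext_duality:
  assumes \<Psi>: "ext_duality K \<C> \<Psi>"
  shows "\<exists>\<Phi>. cy_pairing K \<C> \<Sigma> \<epsilon> \<Phi>"
proof -
  define \<Phi> where "\<Phi> X Y = (\<lambda>F. \<lambda>G \<in> carrier (stable_hom \<C> Y (\<Sigma> X)). \<Psi> X Y (\<theta> Y F) (\<theta> X G))" for X Y
  have "cy_pairing K \<C> \<Sigma> \<epsilon> \<Phi>"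
    unfolding cy_pairing_def Let_def stable_category_simps
  proof (intro conjI ballI)
    fix X Y assume O: "X \<in> Obj \<C>" "Y \<in> Obj \<C>"
    have m: "module K (stable_hom \<C> Y (\<Sigma> X))" using susp_ext_iso(1)[OF O(2,1)] by (simp add: vectorspace_def)
    have p: "\<Psi> X Y \<in> module_hom K (Ext \<C> X Y) (dual_space K (Ext \<C> Y X))"
      "bij_betw (\<Psi> X Y) (carrier (Ext \<C> X Y)) (carrier (dual_space K (Ext \<C> Y X)))"
      using \<Psi> O unfolding ext_duality_def by simp_all
    note t = dual_transport[OF ext_module[OF O(2,1)] m susp_ext_iso(2,3)[OF O] susp_ext_iso(2,3)[OF O(2,1)] p]
    show "\<Phi> X Y \<in> module_hom K (stable_hom \<C> X (\<Sigma> Y)) (dual_space K (stable_hom \<C> Y (\<Sigma> X)))"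
      unfolding \<Phi>_def by (rule t(1))
    show "bij_betw (\<Phi> X Y) (carrier (stable_hom \<C> X (\<Sigma> Y))) (carrier (dual_space K (stable_hom \<C> Y (\<Sigma> X))))"
      unfolding \<Phi>_def by (rule t(2))
  next
    fix X X' Y Y' U V F G
    assume O: "X \<in> Obj \<C>" "X' \<in> Obj \<C>" "Y \<in> Obj \<C>" "Y' \<in> Obj \<C>"
      and U: "U \<in> carrier (stable_hom \<C> X' X)" and V: "V \<in> carrier (stable_hom \<C> Y Y')"
      and F: "F \<in> carrier (stable_hom \<C> X (\<Sigma> Y))" and G: "G \<in> carrier (stable_hom \<C> Y' (\<Sigma> X'))"
    let ?S = "stable_category \<C>"
    obtain u where u: "u \<in> arr \<C> X' X" "U = stable_class \<C> X' X u" using stable_homE[OF O(2,1) U] .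
    obtain v where v: "v \<in> arr \<C> Y Y'" "V = stable_class \<C> Y Y' v" using stable_homE[OF O(3,4) V] .
    obtain f where f: "f \<in> arr \<C> X (\<Sigma> Y)" "F = stable_class \<C> X (\<Sigma> Y) f"
      using stable_homE[OF O(1) susp_Obj[OF O(3)] F] .
    obtain g where g: "g \<in> arr \<C> Y' (\<Sigma> X')" "G = stable_class \<C> Y' (\<Sigma> X') g"
      using stable_homE[OF O(4) susp_Obj[OF O(2)] G] .
    obtain h where h: "h \<in> arr \<C> X' (\<Sigma> Y')"
      "susp_map \<C> \<Sigma> \<epsilon> Y Y' V \<cdot>\<^bsub>?S\<^esub> F \<cdot>\<^bsub>?S\<^esub> U = stable_class \<C> X' (\<Sigma> Y') h"
      "pull \<C> h (\<epsilon> Y') = push \<C> v (pull \<C> u (pull \<C> f (\<epsilon> Y)))"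
      using susp_ext_natural[OF u(1) v(1) f(1), folded u(2) v(2) f(2)] .
    obtain k where k: "k \<in> arr \<C> Y (\<Sigma> X)"
      "susp_map \<C> \<Sigma> \<epsilon> X' X U \<cdot>\<^bsub>?S\<^esub> G \<cdot>\<^bsub>?S\<^esub> V = stable_class \<C> Y (\<Sigma> X) k"
      "pull \<C> k (\<epsilon> X) = push \<C> u (pull \<C> v (pull \<C> g (\<epsilon> X')))"
      using susp_ext_natural[OF v(1) u(1) g(1), folded u(2) v(2) g(2)] .
    note \<delta> = exts_pull[OF f(1) susp_ext[OF O(3)]] and \<gamma> = exts_pull[OF g(1) susp_ext[OF O(2)]]
    have "\<Phi> X' Y' (stable_class \<C> X' (\<Sigma> Y') h) G =
        \<Psi> X' Y' (push \<C> v (pull \<C> u (pull \<C> f (\<epsilon> Y)))) (pull \<C> g (\<epsilon> X'))"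
      using susp_ext_class(1)[OF h(1) O(4)] h(3) susp_ext_class(1)[OF g(1) O(2)] g(2) G by (simp add: \<Phi>_def)
    also have "\<dots> = \<Psi> X Y (pull \<C> f (\<epsilon> Y)) (push \<C> u (pull \<C> v (pull \<C> g (\<epsilon> X'))))"
      using \<Psi> u(1) v(1) \<delta> \<gamma> unfolding ext_duality_def by blast
    also have "\<dots> = \<Phi> X Y F (stable_class \<C> Y (\<Sigma> X) k)"
      using susp_ext_class[OF k(1) O(1)] k(3) susp_ext_class(1)[OF f(1) O(3)] f(2) by (simp add: \<Phi>_def)
    finally show "\<Phi> X' Y' (susp_map \<C> \<Sigma> \<epsilon> Y Y' V \<cdot>\<^bsub>?S\<^esub> F \<cdot>\<^bsub>?S\<^esub> U) G =
        \<Phi> X Y F (susp_map \<C> \<Sigma> \<epsilon> X' X U \<cdot>\<^bsub>?S\<^esub> G \<cdot>\<^bsub>?S\<^esub> V)"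
      unfolding h(2) k(2) .
  qed
  then show ?thesis by blast
qed

end

text \<open>A suspension is mentioned on the left only; for the converse direction
  \<open>suspension_exists\<close> supplies one.\<close>

lemma (in frobenius_category) calabi_yau_iff_ext_duality:
  "stably_2_calabi_yau K \<C> \<longleftrightarrow>
    (\<forall>X \<in> Obj \<C>. \<forall>Y \<in> Obj \<C>. vectorspace.fin_dim K (Ext \<C> X Y)) \<and> (\<exists>\<Psi>. ext_duality K \<C> \<Psi>)"
proof -
  have susp: "suspended K \<C> \<Sigma> \<epsilon>" if "is_suspension \<C> \<Sigma> \<epsilon>" for \<Sigma> \<epsilon>
    using that by unfold_locales
  have "(\<exists>\<Sigma> \<epsilon> \<Phi>. is_suspension \<C> \<Sigma> \<epsilon> \<and> cy_pairing K \<C> \<Sigma> \<epsilon> \<Phi>) \<longleftrightarrow> (\<exists>\<Psi>. ext_duality K \<C> \<Psi>)"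
  proof
    assume "\<exists>\<Sigma> \<epsilon> \<Phi>. is_suspension \<C> \<Sigma> \<epsilon> \<and> cy_pairing K \<C> \<Sigma> \<epsilon> \<Phi>"
    then obtain \<Sigma> \<epsilon> \<Phi> where "is_suspension \<C> \<Sigma> \<epsilon>" "cy_pairing K \<C> \<Sigma> \<epsilon> \<Phi>" by blast
    then show "\<exists>\<Psi>. ext_duality K \<C> \<Psi>" using suspended.ext_duality_of_pairing[OF susp] by blast
  next
    assume "\<exists>\<Psi>. ext_duality K \<C> \<Psi>"
    then obtain \<Psi> where "ext_duality K \<C> \<Psi>" by blast
    moreover obtain \<Sigma> \<epsilon> where s: "is_suspension \<C> \<Sigma> \<epsilon>" using suspension_exists by blast
    ultimately show "\<exists>\<Sigma> \<epsilon> \<Phi>. is_suspension \<C> \<Sigma> \<epsilon> \<and> cy_pairing K \<C> \<Sigma> \<epsilon> \<Phi>"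
      using suspended.pairing_of_ext_duality[OF susp[OF s]] by blast
  qed
  then show ?thesis unfolding stably_2_calabi_yau_iff stable_hom_fin_dim_iff by simp
qed

theorem theorem3p21:
  fixes K :: "('k, 'r) ring_scheme" and \<C> :: "('k, 'o, 'm, 'e) extri_cat" and \<P> \<X> :: "'o set"
  assumes "stably_2_calabi_yau_frobenius K \<C>"
    and "\<P> = proj_inj \<C>"
    and "\<X> \<subseteq> Obj \<C>"
    and "rigid \<C> \<X>"
    and "functorially_finite \<C> \<X>"
  shows "stably_2_calabi_yau_frobenius K (full_sub \<C> (right_perp \<C> \<X>)) \<and>
         functorially_finite \<C> (right_perp \<C> \<X>) \<and>
         proj_inj (full_sub \<C> (right_perp \<C> \<X>)) = add_closure \<C> (\<X> \<union> \<P>) \<and>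
         (weakly_idempotent_complete \<C> \<longrightarrow>
            weakly_idempotent_complete (full_sub \<C> (right_perp \<C> \<X>))) \<and>
         {\<T>. cluster_tilting (full_sub \<C> (right_perp \<C> \<X>)) \<T>} =
            {\<T>. cluster_tilting \<C> \<T> \<and> \<X> \<subseteq> \<T>}"
proof -
  have C: "extriangulated K \<C>" "frobenius \<C>" "stably_2_calabi_yau K \<C>"
    using assms(1) by (simp_all add: stably_2_calabi_yau_frobenius_def)
  then interpret frobenius_category K \<C>
    by (intro frobenius_category.intro frobenius_category_axioms.intro)
  obtain \<Psi> where fin: "\<forall>X \<in> Obj \<C>. \<forall>Y \<in> Obj \<C>. vectorspace.fin_dim K (Ext \<C> X Y)"
    and \<Psi>: "ext_duality K \<C> \<Psi>" using C(3) calabi_yau_iff_ext_duality by blast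
  interpret rigid_frobenius K \<C> \<X>
  proof (unfold_locales)
    show "\<X> \<subseteq> Obj \<C>" "functorially_finite \<C> \<X>" "frobenius \<C>" by (fact assms C)+
    show "ext_vanish \<C> X X'" if "X \<in> \<X>" "X' \<in> \<X>" for X X'
      using assms(4) that right_perp_iff[OF assms(3)] unfolding rigid_def by blast
    show "ext_vanish \<C> A B \<Longrightarrow> ext_vanish \<C> B A" for A B by (rule ext_duality_sym[OF \<Psi>])
  qed
  let ?D = "full_sub \<C> (right_perp \<C> \<X>)"
  \<comment> \<open>The Frobenius property of the subcategory has to come first: it provides the
    suspension over which the duality is turned back into a stable pairing.\<close>
  interpret D: frobenius_category K ?D
    by (intro frobenius_category.intro frobenius_category_axioms.intro perp.sub_extriangulated sub_frobenius)
  \<comment> \<open>The same \<Psi> serves, since the subcategory has fewer objects but the same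
    extension spaces and the same actions on them.\<close>
  have "ext_duality K ?D \<Psi>"
    using \<Psi> perp_Obj unfolding ext_duality_def full_sub_simps full_sub_notions[OF perp.sub_Obj] by simp
  moreover have "\<forall>X \<in> Obj ?D. \<forall>Y \<in> Obj ?D. vectorspace.fin_dim K (Ext ?D X Y)"
    using fin perp_Obj by simp
  ultimately have "stably_2_calabi_yau K ?D" using D.calabi_yau_iff_ext_duality by blast
  then have "stably_2_calabi_yau_frobenius K ?D"
    using perp.sub_extriangulated sub_frobenius by (simp add: stably_2_calabi_yau_frobenius_def)
  then show ?thesis
    using perp_functorially_finite sub_proj_inj perp_weakly_idempotent_complete cluster_tilting_sub_iff
    unfolding assms(2) by blast
qed

end
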